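(* Let $p\in(1,\infty)$. Suppose that $(K,d,\{K_w\}_{w\in T},m)$ satisfies the basic geometric framework, that $m$ is Ahlfors regular with respect to $d$, that $K$ is $p$-conductively homogeneous, and that there exists $C_0\in(0,\infty)$ such that for any $(x,s)\in K\times(0,1]$, $$\inf\bigl\{\mathcal{N}_p(f)^p\bigm| f\in\mathcal{W}^p\cap C(K),\ f|_{B_d(x,s)}=1,\ \operatorname{supp}_K[f]\subseteq B_d(x,2s)\bigr\}\le C_0\,s^{d_{\mathrm f}-d_{\mathrm{w},p}}.$$ Then there exists $C\in(0,\infty)$ such that for any $E\subseteq K$, any open neighborhood $E'$ of the closure $\overline{E}$ in $K$ and any $u\in\mathcal{W}^p_{\mathrm{loc}}(E')$, $$\limsup_{n\to\infty}\widetilde{\mathcal{E}}_{p,T_n[E]}^n(u)\le C\lim_{\delta\downarrow0}\liminf_{r\downarrow0}\int_{(E)_{d,\delta}}\frac{1}{m(B_d(x,r))}\int_{B_d(x,r)}\frac{|u(x)-u(y)|^p}{r^{d_{\mathrm{w},p}}}\,m(dy)\,m(dx).$$ Furthermore, with the same $C$, for any $f\in L^p(K,m)$, $$\mathcal{N}_p(f)^p\le C\liminf_{r\downarrow0}\int_K\frac{1}{m(B_d(x,r))}\int_{B_d(x,r)}\frac{|f(x)-f(y)|^p}{r^{d_{\mathrm{w},p}}}\,m(dy)\,m(dx).$$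
   Context: Tree. $(T,E_T)$ is a locally finite infinite undirected tree with root $\phi\in T$, every vertex having at least two neighbours. For $w\ne\phi$, $\pi(w)$ is the vertex preceding $w$ on the unique simple path from $\phi$ to $w$; $\pi(\phi)=\phi$. $S(w)=\{v:\pi(v)=w\}\setminus\{w\}$, $S^0(w)=\{w\}$, $S^1=S$, $S^{k+1}(w)=\bigcup_{v\in S(w)}S^k(v)$, $S^k(A)=\bigcup_{w\in A}S^k(w)$. $|w|=\min\{n\ge0:\pi^n(w)=\phi\}$, $T_n=\{w:|w|=n\}$. Partition. $K$ is a compact metrizable space without isolated points. A family $\{K_w\}_{w\in T}$ of non-empty compact subsets is a partition of $K$ parametrized by the tree if $K_\phi=K$; $\#K_w\ge2$ and $K_w=\bigcup_{v\in S(w)}K_v$ for all $w$; and $\bigcap_{n\ge0}K_{\omega_n}$ is a single point whenever $\omega_n\in T_n$ and $\omega_n=\pi(\omega_{n+1})$ for all $n\ge0$. For $A\subseteq T_n$: $E_n^*=\{\{v,w\}:v,w\in T_n,v\ne w,K_v\cap K_w\ne\emptyset\}$, $E_n^*(A)=\{\{v,w\}\in E_n^*:v,w\in A\}$; $d_n$ is the graph distance of $(T_n,E_n^* )$; for $w\in T_n$, $\Gamma_M(w)=\{v\in T_n:d_n(v,w)\le M\}$; $U_M(x;n)=\bigcup_{w\in T_n,x\in K_w}\bigcup_{v\in\Gamma_M(w)}K_v$; $T_n[U]=\{w\in T_n:K_w\cap U\ne\emptyset\}$ for $U\subseteq K$. The partition is minimal if $K_w\setminus\bigcup_{v\in T_{|w|}\setminus\{w\}}K_v\ne\emptyset$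 for all $w$, and uniformly finite if $\sup_w\#\Gamma_1(w)<\infty$. $B_d(x,r)=\{y:d(x,y)<r\}$, $(E)_{d,r}=\bigcup_{x\in E}B_d(x,r)$. Basic geometric framework. $K$ is connected, $\{K_w\}_{w\in T}$ is a partition of $K$ parametrized by the tree $(T,E_T)$ with root $\phi$, $d$ is a metric giving the topology of $K$ with $\operatorname{diam}(K,d)=1$, $m$ is a Borel probability measure on $K$, and there are $M_*\in\mathbb{N}$, $r_*\in(0,1)$ such that: (1) each $K_w$ is connected, $\{K_w\}$ is minimal and uniformly finite, and $\#S(w)\ge2$ for all $w\in T$. (2) There are $c_1,\dots,c_5>0$ with: $c_1r_*^{|w|}\le\operatorname{diam}(K_w,d)\le c_2r_*^{|w|}$ for $w\in T$; $B_d(x,c_3r_*^n)\subseteq U_{M_*}(x;n)\subseteq B_d(x,c_4r_*^n)$ for $n\in\mathbb{N}$, $x\in K$; for $n\in\mathbb{N}$, $w\in T_n$ there is $x\in K_w$ with $K_w\supseteq B_d(x,c_5r_*^n)$. (3) There are $m_1\in\mathbb{N}$, $\gamma_1,\gamma\in(0,1)$ with $m(K_w)\ge\gamma m(K_{\pi(w)})$ for $w\in T$ and $m(K_v)\le\gamma_1m(K_w)$ for $w\in T$, $v\in S^{m_1}(w)$; $m$ is volume doubling ($m(B_d(x,2s))\le C_{\mathrm D}m(B_d(x,s))<\infty$ for all $x\in K,s>0$, some constant $C_{\mathrm D}$); and $m(K_w)=\sum_{v\in S(w)}m(K_v)$ for $w\in T$. (4) There is $M_0\ge M_*$ such that for $w\in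 T$, $k\ge1$, $v\in S^k(w)$ and $v'\in\Gamma_{M_*}(v)\cap S^k(w)$ there are $l\le M_0$ and $(v_0,\dots,v_l)\in S^k(w)^{l+1}$ with $v_0=v$, $v_l=v'$ and $\{v_{j-1},v_j\}\in E^*_{|v|}$ for $1\le j\le l$. (5) $\pi(\Gamma_{M_*+1}(w))\subseteq\Gamma_{M_*}(\pi(w))$ for $w\in T$. Ahlfors regular: for some $Q>0$, $C\ge1$, $C^{-1}s^Q\le m(B_d(x,s))\le Cs^Q$ for $x\in K$, $s\in(0,2\operatorname{diam}(K,d))$. $p$-conductive homogeneity. For $A\subseteq T_n$, $f\in\mathbb{R}^A$: $\mathcal{E}_{p,A}^n(f)=\sum_{\{u,v\}\in E_n^*(A)}|f(u)-f(v)|^p$, $\mathcal{E}_p^n=\mathcal{E}_{p,T_n}^n$. For $A_0,A_1\subseteq A$, $\mathrm{cap}_p^n(A_0,A_1;A)=\inf\{\mathcal{E}_{p,A}^n(f):f\in\mathbb{R}^A,f|_{A_i}=i,\ i=0,1\}$. $\mathcal{E}_{M,p,k}=\sup_{w\in T}\mathrm{cap}_p^{|w|+k}(S^k(w),S^k(T_{|w|}\setminus\Gamma_M(w));T_{|w|+k})$. For $f\colon S^k(A)\to\mathbb{R}$ and $w\in A$, $P_{n,k}f(w)=\frac{1}{\sum_{v\in S^k(w)}m(K_v)}\sum_{v\in S^k(w)}f(v)m(K_v)$; $\sigma_{p,k}(A)=\sup_{f\colon S^k(A)\to\mathbb{R}}\mathcal{E}_{p,A}^n(P_{n,k}f)/\mathcal{E}_{p,S^k(A)}^{n+k}(f)$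 (with $0/0=0$). A collection $\{G_i\}_{i=1}^k$, $G_i\subseteq T_n$, is a covering of $(A,E_n^*(A))$ with covering numbers $(N_T,N_E)\in\mathbb{N}^2$ if $A=\bigcup_iG_i$, $\max_{x\in A}\#\{i:x\in G_i\}\le N_T$, and for every $\{u,v\}\in E_n^*(A)$ there are $l\le N_E$ and $w(1),\dots,w(l+1)\in A$ with $w(1)=u$, $w(l+1)=v$, $\{w(i),w(i+1)\}\in\bigcup_jE_n^*(G_j)$ for $1\le i\le l$. A family $\mathscr{J}$ of sets each contained in some $T_n$ is a covering system if for some $(N_T,N_E)$: $\sup_{A\in\mathscr{J}}\#A<\infty$; for all $w\in T$, $k\in\mathbb{N}$ there is a finite $\mathscr{N}\subseteq\{A\in\mathscr{J}:A\subseteq T_{|w|+k}\}$ that is a covering of $(S^k(w),E^*_{|w|+k}(S^k(w)))$ with covering numbers $(N_T,N_E)$; and for all $G\in\mathscr{J}$ with $G\subseteq T_n$ and $k\ge0$ there is a finite $\mathscr{N}\subseteq\{A\in\mathscr{J}:A\subseteq T_{n+k}\}$ that is a covering of $(S^k(G),E^*_{n+k}(S^k(G)))$ with these covering numbers. Put $\sigma_{p,k}^{\mathscr{J}}=\sup_{n\ge0}\max\{\sigma_{p,k}(A):A\in\mathscr{J},A\subseteq T_n\}$. $K$ is $p$-conductively homogeneous if $\sup_{k\ge0}\sigma_{p,k}^{\mathscr{J}}\mathcal{E}_{M_*,p,k}<\infty$ for some covering system $\mathscr{J}$. In that case (a known theorem of Kigami) there is a unique $\sigma_p\in(0,\infty)$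 such that for some $c_1',c_2'>0$ and covering system $\mathscr{J}$: $c_1'\sigma_p^{-k}\le\mathcal{E}_{M_*,p,k}\le c_2'\sigma_p^{-k}$ and $c_1'\sigma_p^k\le\sigma_{p,k}^{\mathscr{J}}\le c_2'\sigma_p^k$ for all $k\ge0$. Energies. For a Borel set $F\supseteq K_w$, $w\in T_n$, and $f\in L^1(F,m|_F)$, $P_nf(w)=\frac{1}{m(K_w)}\int_{K_w}f\,dm$. For $A\subseteq T_n$ and $f\in L^1(F,m|_F)$ with $F\supseteq\bigcup_{w\in A}K_w$, $\widetilde{\mathcal{E}}_{p,A}^n(f)=\sigma_p^n\mathcal{E}_{p,A}^n(P_nf)$ (in the local estimate all quantities are well defined for all large $n$ and all small $\delta,r$). $\mathcal{N}_p(f)=(\sup_{n\ge0}\sigma_p^n\mathcal{E}_p^n(P_nf))^{1/p}$ for $f\in L^p(K,m)$; $\mathcal{W}^p=\{f\in L^p(K,m):\mathcal{N}_p(f)<\infty\}$. For a non-empty open $U\subseteq K$, $\mathcal{W}^p_{\mathrm{loc}}(U)$ is the set of ($m$-classes of) real measurable functions $f$ on $U$ such that for each relatively compact open subset $V$ of $U$ there is $f^{\#}\in\mathcal{W}^p$ with $f=f^{\#}$ $m$-a.e. on $V$. $d_{\mathrm f}$ is the Hausdorff dimension of $(K,d)$ and $d_{\mathrm{w},p}=d_{\mathrm f}+\log\sigma_p/\log r_*^{-1}$. $\operatorname{supp}_K[f]$ is the closure of $\{f\neq0\}$; continuous functions are identified with their $m$-classes. *)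

theory Defs
  imports "HOL-Analysis.Analysis" "HOL-Probability.Probability_Measure"
begin

section \<open>Graphs\<close>

text \<open>An undirected graph is a vertex set \<open>V\<close> with a set \<open>Es\<close> of two-element edges \<open>{u, v}\<close>.
  A walk with \<open>l\<close> steps is a list of \<open>l + 1\<close> vertices.\<close>

definition walk :: "'v set \<Rightarrow> 'v set set \<Rightarrow> 'v list \<Rightarrow> bool" where
  "walk V Es xs \<longleftrightarrow> xs \<noteq> [] \<and> set xs \<subseteq> V \<and> successively (\<lambda>u v. {u, v} \<in> Es) xs"

definition walk_between :: "'v set \<Rightarrow> 'v set set \<Rightarrow> 'v \<Rightarrow> 'v \<Rightarrow> 'v list \<Rightarrow> bool" where
  "walk_between V Es u v xs \<longleftrightarrow> walk V Es xs \<and> hd xs = u \<and> last xs = v"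

definition graph_dist :: "'v set \<Rightarrow> 'v set set \<Rightarrow> 'v \<Rightarrow> 'v \<Rightarrow> enat" where
  "graph_dist V Es u v = (INF xs\<in>{xs. walk_between V Es u v xs}. enat (length xs - 1))"

definition simple_path :: "'v set set \<Rightarrow> 'v \<Rightarrow> 'v \<Rightarrow> 'v list \<Rightarrow> bool" where
  "simple_path Es u v xs \<longleftrightarrow> walk_between UNIV Es u v xs \<and> distinct xs"

text \<open>The vertex set of the tree is the whole type \<open>'v\<close>.\<close>

definition admissible_tree :: "'v set set \<Rightarrow> bool" where
  "admissible_tree ET \<longleftrightarrow>
     (\<forall>e\<in>ET. card e = 2) \<and>
     infinite (UNIV :: 'v set) \<and>
     (\<forall>w. finite {v. {w, v} \<in> ET}) \<and>
     (\<forall>w. card {v. {w, v} \<in> ET} \<ge> 2) \<and>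
     (\<forall>u v. u \<noteq> v \<longrightarrow> (\<exists>!xs. simple_path ET u v xs))"

section \<open>Hausdorff dimension\<close>

text \<open>\<open>diameter\<close> is only meaningful on bounded sets. The exponent is
  restricted to \<open>s > 0\<close>, because \<open>0 powr 0 = 0\<close>.\<close>

definition hausdorff_premeasure :: "real \<Rightarrow> real \<Rightarrow> 'a::metric_space set \<Rightarrow> ennreal" where
  "hausdorff_premeasure s \<delta> A =
     (INF U \<in> {U :: nat \<Rightarrow> 'a set. A \<subseteq> (\<Union>i. U i) \<and> (\<forall>i. bounded (U i) \<and> diameter (U i) \<le> \<delta>)}.
        \<Sum>i. ennreal (diameter (U i) powr s))"

definition hausdorff_measure :: "real \<Rightarrow> 'a::metric_space set \<Rightarrow> ennreal" where
  "hausdorff_measure s A = (SUP \<delta>\<in>{0<..}. hausdorff_premeasure s \<delta> A)"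

definition hausdorff_dim :: "'a::metric_space set \<Rightarrow> ennreal" where
  "hausdorff_dim A = (INF s \<in> {s. 0 < s \<and> hausdorff_measure s A = 0}. ennreal s)"

section \<open>Function spaces and powers\<close>

text \<open>Functions stand for their \<open>m\<close>-classes; every notion below in which only the class
  should matter is invariant under changes on \<open>m\<close>-null sets.\<close>

definition Lp_space :: "real \<Rightarrow> 'a measure \<Rightarrow> ('a \<Rightarrow> real) set" where
  "Lp_space p m = {f \<in> borel_measurable m. integrable m (\<lambda>x. \<bar>f x\<bar> powr p)}"

definition ennpowr :: "ennreal \<Rightarrow> real \<Rightarrow> ennreal" where
  "ennpowr x a = (if x = \<infinity> then \<infinity> else ennreal (enn2real x powr a))"

section \<open>Partitions parametrized by a tree\<close>

text \<open>The compact space is the whole type \<open>'a\<close>, with the metric \<open>d = dist\<close>;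
  \<open>K w\<close> is the cell of the vertex \<open>w\<close>. The locale carries no assumptions and
  only names the data.\<close>

locale tree_partition =
  fixes ET :: "'v set set"
    and \<phi> :: 'v
    and K :: "'v \<Rightarrow> 'a::metric_space set"
    and m :: "'a measure"
    and Ms :: nat
    and rs :: real
    and p :: real
begin

definition parent :: "'v \<Rightarrow> 'v" where
  "parent w = (if w = \<phi> then \<phi> else last (butlast (THE xs. simple_path ET \<phi> w xs)))"

definition children :: "'v \<Rightarrow> 'v set" where
  "children w = {v. parent v = w} - {w}"

primrec desc :: "nat \<Rightarrow> 'v \<Rightarrow> 'v set" where
  "desc 0 w = {w}"
| "desc (Suc k) w = (\<Union>v\<in>children w. desc k v)"

definition descs :: "nat \<Rightarrow> 'v set \<Rightarrow> 'v set" where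
  "descs k A = (\<Union>w\<in>A. desc k w)"

definition level :: "'v \<Rightarrow> nat" where
  "level w = (LEAST n. (parent ^^ n) w = \<phi>)"

definition Tn :: "nat \<Rightarrow> 'v set" where
  "Tn n = {w. level w = n}"

definition is_partition :: bool where
  "is_partition \<longleftrightarrow>
     compact (UNIV :: 'a set) \<and> (\<forall>x::'a. \<not> open {x}) \<and>
     (\<forall>w. K w \<noteq> {} \<and> compact (K w)) \<and>
     K \<phi> = UNIV \<and>
     (\<forall>w. \<exists>x\<in>K w. \<exists>y\<in>K w. x \<noteq> y) \<and>
     (\<forall>w. K w = (\<Union>v\<in>children w. K v)) \<and>
     (\<forall>\<omega> :: nat \<Rightarrow> 'v. (\<forall>n. \<omega> n \<in> Tn n \<and> \<omega> n = parent (\<omega> (Suc n))) \<longrightarrow>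
        (\<exists>x. (\<Inter>n. K (\<omega> n)) = {x}))"

definition Estar :: "nat \<Rightarrow> 'v set set" where
  "Estar n = {{v, w} | v w. v \<in> Tn n \<and> w \<in> Tn n \<and> v \<noteq> w \<and> K v \<inter> K w \<noteq> {}}"

definition Estar_on :: "nat \<Rightarrow> 'v set \<Rightarrow> 'v set set" where
  "Estar_on n A = {e \<in> Estar n. e \<subseteq> A}"

definition Gam :: "nat \<Rightarrow> 'v \<Rightarrow> 'v set" where
  "Gam M w = {v \<in> Tn (level w). graph_dist (Tn (level w)) (Estar (level w)) v w \<le> enat M}"

definition U_nbhd :: "nat \<Rightarrow> 'a \<Rightarrow> nat \<Rightarrow> 'a set" where
  "U_nbhd M x n = (\<Union>w\<in>{w \<in> Tn n. x \<in> K w}. \<Union>v\<in>Gam M w. K v)"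

definition Tn_meet :: "nat \<Rightarrow> 'a set \<Rightarrow> 'v set" where
  "Tn_meet n U = {w \<in> Tn n. K w \<inter> U \<noteq> {}}"

definition minimal_partition :: bool where
  "minimal_partition \<longleftrightarrow> (\<forall>w. K w - (\<Union>v\<in>Tn (level w) - {w}. K v) \<noteq> {})"

definition uniformly_finite :: bool where
  "uniformly_finite \<longleftrightarrow> (\<exists>N. \<forall>w. finite (Gam 1 w) \<and> card (Gam 1 w) \<le> N)"

section \<open>The basic geometric framework\<close>

text \<open>Here \<open>\<nat>\<close> in the informal conditions is \<open>{1, 2, \<dots>}\<close>.\<close>

definition framework1 :: bool where
  "framework1 \<longleftrightarrow> (\<forall>w. connected (K w)) \<and> minimal_partition \<and> uniformly_finite \<and>
     (\<forall>w. card (children w) \<ge> 2)"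

definition framework2 :: bool where
  "framework2 \<longleftrightarrow> (\<exists>c1>0. \<exists>c2>0. \<exists>c3>0. \<exists>c4>0. \<exists>c5>0.
     (\<forall>w. c1 * rs ^ level w \<le> diameter (K w) \<and> diameter (K w) \<le> c2 * rs ^ level w) \<and>
     (\<forall>n\<ge>1. \<forall>x. ball x (c3 * rs ^ n) \<subseteq> U_nbhd Ms x n \<and> U_nbhd Ms x n \<subseteq> ball x (c4 * rs ^ n)) \<and>
     (\<forall>n\<ge>1. \<forall>w\<in>Tn n. \<exists>x\<in>K w. ball x (c5 * rs ^ n) \<subseteq> K w))"

definition framework3 :: bool where
  "framework3 \<longleftrightarrow>
     (\<exists>m1::nat. \<exists>\<gamma>1 \<gamma>. m1 \<ge> 1 \<and> 0 < \<gamma>1 \<and> \<gamma>1 < 1 \<and> 0 < \<gamma> \<and> \<gamma> < 1 \<and>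
        (\<forall>w. measure m (K w) \<ge> \<gamma> * measure m (K (parent w))) \<and>
        (\<forall>w. \<forall>v\<in>desc m1 w. measure m (K v) \<le> \<gamma>1 * measure m (K w))) \<and>
     (\<exists>CD. \<forall>x. \<forall>s>0. measure m (ball x (2 * s)) \<le> CD * measure m (ball x s)) \<and>
     (\<forall>w. measure m (K w) = (\<Sum>v\<in>children w. measure m (K v)))"

definition framework4 :: bool where
  "framework4 \<longleftrightarrow> (\<exists>M0\<ge>Ms. \<forall>w. \<forall>k\<ge>1. \<forall>v\<in>desc k w. \<forall>v'\<in>Gam Ms v \<inter> desc k w.
     \<exists>xs. walk_between (desc k w) (Estar (level v)) v v' xs \<and> length xs \<le> M0 + 1)"

definition framework5 :: bool where
  "framework5 \<longleftrightarrow> (\<forall>w. parent ` Gam (Ms + 1) w \<subseteq> Gam Ms (parent w))"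

definition basic_framework :: bool where
  "basic_framework \<longleftrightarrow>
     admissible_tree ET \<and> is_partition \<and>
     connected (UNIV :: 'a set) \<and> diameter (UNIV :: 'a set) = 1 \<and>
     prob_space m \<and> sets m = sets borel \<and>
     Ms \<ge> 1 \<and> 0 < rs \<and> rs < 1 \<and>
     framework1 \<and> framework2 \<and> framework3 \<and> framework4 \<and> framework5"

definition ahlfors_regular :: bool where
  "ahlfors_regular \<longleftrightarrow> (\<exists>Q>0. \<exists>C\<ge>1. \<forall>x. \<forall>s. 0 < s \<and> s < 2 * diameter (UNIV :: 'a set) \<longrightarrow>
     s powr Q / C \<le> measure m (ball x s) \<and> measure m (ball x s) \<le> C * s powr Q)"

section \<open>Conductive homogeneity\<close>

text \<open>Each unordered edge is counted twice in the sum over ordered pairs.\<close>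

definition energy :: "nat \<Rightarrow> 'v set \<Rightarrow> ('v \<Rightarrow> real) \<Rightarrow> real" where
  "energy n A f = (\<Sum>(u, v) \<in> {(u, v). {u, v} \<in> Estar_on n A}. \<bar>f u - f v\<bar> powr p) / 2"

definition cap :: "nat \<Rightarrow> 'v set \<Rightarrow> 'v set \<Rightarrow> 'v set \<Rightarrow> ennreal" where
  "cap n A0 A1 A =
     (INF f \<in> {f. (\<forall>v\<in>A0. f v = 0) \<and> (\<forall>v\<in>A1. f v = 1)}. ennreal (energy n A f))"

definition cap_sup :: "nat \<Rightarrow> nat \<Rightarrow> ennreal" where
  "cap_sup M k =
     (SUP w. cap (level w + k) (desc k w) (descs k (Tn (level w) - Gam M w)) (Tn (level w + k)))"

definition avg_desc :: "nat \<Rightarrow> ('v \<Rightarrow> real) \<Rightarrow> 'v \<Rightarrow> real" where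
  "avg_desc k f w = (\<Sum>v\<in>desc k w. f v * measure m (K v)) / (\<Sum>v\<in>desc k w. measure m (K v))"

text \<open>In \<open>ennreal\<close>, \<open>0 / 0 = 0\<close> and \<open>x / 0 = \<infinity>\<close> for \<open>x > 0\<close>.
  Only the values of \<open>f\<close> on \<open>descs k A\<close> matter.\<close>

definition sigma_A :: "nat \<Rightarrow> nat \<Rightarrow> 'v set \<Rightarrow> ennreal" where
  "sigma_A n k A =
     (SUP f. ennreal (energy n A (avg_desc k f)) / ennreal (energy (n + k) (descs k A) f))"

definition is_covering :: "nat \<Rightarrow> 'v set \<Rightarrow> 'v set set \<Rightarrow> nat \<Rightarrow> nat \<Rightarrow> bool" where
  "is_covering n A \<N> NT NE \<longleftrightarrow>
     finite \<N> \<and> A = \<Union>\<N> \<and>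
     (\<forall>x\<in>A. card {G \<in> \<N>. x \<in> G} \<le> NT) \<and>
     (\<forall>u v. {u, v} \<in> Estar_on n A \<longrightarrow>
        (\<exists>xs. walk_between A (\<Union>G\<in>\<N>. Estar_on n G) u v xs \<and> length xs \<le> NE + 1))"

definition covering_system :: "'v set set \<Rightarrow> bool" where
  "covering_system \<J> \<longleftrightarrow>
     (\<forall>A\<in>\<J>. \<exists>n. A \<subseteq> Tn n) \<and>
     (\<exists>NT NE. NT \<ge> 1 \<and> NE \<ge> 1 \<and>
        (\<exists>N. \<forall>A\<in>\<J>. finite A \<and> card A \<le> N) \<and>
        (\<forall>w. \<forall>k\<ge>1. \<exists>\<N>. \<N> \<subseteq> {A \<in> \<J>. A \<subseteq> Tn (level w + k)} \<and>
           is_covering (level w + k) (desc k w) \<N> NT NE) \<and>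
        (\<forall>G\<in>\<J>. \<forall>n k. G \<subseteq> Tn n \<longrightarrow>
           (\<exists>\<N>. \<N> \<subseteq> {A \<in> \<J>. A \<subseteq> Tn (n + k)} \<and> is_covering (n + k) (descs k G) \<N> NT NE)))"

definition sigma_J :: "'v set set \<Rightarrow> nat \<Rightarrow> ennreal" where
  "sigma_J \<J> k = (SUP n. SUP A\<in>{A \<in> \<J>. A \<subseteq> Tn n}. sigma_A n k A)"

definition conductively_homogeneous :: bool where
  "conductively_homogeneous \<longleftrightarrow>
     (\<exists>\<J>. covering_system \<J> \<and> (SUP k. sigma_J \<J> k * cap_sup Ms k) < \<infinity>)"

definition sigma_p :: real where
  "sigma_p = (THE s. 0 < s \<and> (\<exists>c1>0. \<exists>c2>0. \<exists>\<J>. covering_system \<J> \<and>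
     (\<forall>k. ennreal (c1 / s ^ k) \<le> cap_sup Ms k \<and> cap_sup Ms k \<le> ennreal (c2 / s ^ k) \<and>
          ennreal (c1 * s ^ k) \<le> sigma_J \<J> k \<and> sigma_J \<J> k \<le> ennreal (c2 * s ^ k))))"

section \<open>Energies of functions on the space\<close>

definition avg :: "('a \<Rightarrow> real) \<Rightarrow> 'v \<Rightarrow> real" where
  "avg f w = (LINT x:K w|m. f x) / measure m (K w)"

definition energy_tilde :: "nat \<Rightarrow> 'v set \<Rightarrow> ('a \<Rightarrow> real) \<Rightarrow> real" where
  "energy_tilde n A f = sigma_p ^ n * energy n A (avg f)"

definition Np :: "('a \<Rightarrow> real) \<Rightarrow> ennreal" where
  "Np f = ennpowr (SUP n. ennreal (sigma_p ^ n * energy n (Tn n) (avg f))) (1 / p)"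

definition Wp :: "('a \<Rightarrow> real) set" where
  "Wp = {f \<in> Lp_space p m. Np f < \<infinity>}"

text \<open>Only the values of \<open>u\<close> on \<open>U\<close> matter.\<close>

definition Wp_loc :: "'a set \<Rightarrow> ('a \<Rightarrow> real) set" where
  "Wp_loc U = {u \<in> borel_measurable (restrict_space m U).
     \<forall>V. open V \<and> compact (closure V) \<and> closure V \<subseteq> U \<longrightarrow>
       (\<exists>g\<in>Wp. AE x in m. x \<in> V \<longrightarrow> u x = g x)}"

definition df :: real where
  "df = enn2real (hausdorff_dim (UNIV :: 'a set))"

definition dw :: real where
  "dw = df + ln sigma_p / ln (1 / rs)"

definition KS_integral :: "'a set \<Rightarrow> ('a \<Rightarrow> real) \<Rightarrow> real \<Rightarrow> ennreal" where
  "KS_integral A u r =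
     (\<integral>\<^sup>+x\<in>A. (1 / emeasure m (ball x r)) *
        (\<integral>\<^sup>+y\<in>ball x r. ennreal (\<bar>u x - u y\<bar> powr p / r powr dw) \<partial>m) \<partial>m)"

end

end

theory Submission
  imports Defs
begin

text \<open>
  Both estimates come from one statement about a function \<open>g\<close> in \<open>L\<^sup>p\<close>
  (\<open>energy_le_Liminf_KS_integral\<close>): up to a constant, the energy of \<open>g\<close> over the cells of level \<open>n\<close> that
  meet \<open>E\<close> is at most the lower limit, as \<open>r\<close> tends to zero, of the Korevaar--Schoen integral over the
  neighbourhood of \<open>E\<close> of radius \<open>L * rs ^ n\<close>. For \<open>E\<close> the whole space this bounds \<open>Np\<close>. For a local
  function it applies to a global function that agrees with it near \<open>E\<close>, and the neighbourhoods
  shrink to \<open>E\<close> as \<open>n\<close> grows.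

  Given a small \<open>r\<close>, choose \<open>k\<close> such that the cells of level \<open>n + k\<close> have size comparable to \<open>r\<close>.

  First, the energy at level \<open>n + k\<close> is controlled by the integral at scale \<open>r\<close>
  (\<open>energy_le_KS_integral\<close>). By Jensen's inequality, the difference of the averages of \<open>g\<close> over two
  neighbouring cells is bounded by the mean of \<open>\<bar>g x - g y\<bar> powr p\<close> over the two cells, and the second
  cell lies in the ball of radius \<open>r\<close> about each point of the first. The normalisations agree since
  the Hausdorff dimension is the Ahlfors exponent (\<open>df_eq_Q\<close>), so that
  \<open>rs powr dw = rs powr df / sigma_p\<close>.

  Second, the energy at level \<open>n\<close> is controlled by the energy at level \<open>n + k\<close>
  (\<open>covering_system_energy_local\<close>). The averages over coarse cells are averages of the averages over
  fine cells, because cells of one level overlap in null sets. A covering system splits the level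
  into small pieces on each of which the conductance constant, of order \<open>sigma_p ^ k\<close>, compares the
  two energies, and every edge of the level is joined by a short path through such pieces. The
  pieces may be disconnected and hence spread out over the whole space; but a union of components of
  a piece has no larger conductance constant (\<open>sigma_A_components\<close>). Therefore only components near
  \<open>E\<close> are needed, and the estimate is local.

  It remains to know that \<open>sigma_p\<close>, which is introduced by a definite description, has its defining
  property (\<open>sigma_p_bounds\<close>). Conductances are submultiplicative in the number of levels
  (\<open>sigma_J_submultiplicative\<close>). Testing the conductance inequality with a capacity potential shows
  that the product of conductance and capacity is bounded below (\<open>sigma_cap_lower\<close>), and conductive
  homogeneity bounds it above, so capacities are supermultiplicative up to a constant. They are also
  submultiplicative (\<open>cap_sup_submultiplicative\<close>): a potential on a coarse level is carried over to a
  finer one by a partition of unity made from the potentials of the finer cells. A sequence that is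
  multiplicative up to a constant is comparable to a geometric one
  (\<open>quasi_multiplicative_exponential\<close>).
\<close>

section \<open>Walks and the tree order\<close>

text \<open>Walks are traded for iterates of the edge relation, which compose and invert without list
  surgery.\<close>

lemma walk_between_imp_relpow:
  assumes "walk_between V Es u v xs"
  shows "(u, v) \<in> {(a, b). a \<in> V \<and> b \<in> V \<and> {a, b} \<in> Es} ^^ (length xs - 1)"
  using assms
proof (induction xs arbitrary: u)
  case Nil
  then show ?case by (simp add: walk_between_def walk_def)
next
  case (Cons x xs)
  let ?R = "{(a, b). a \<in> V \<and> b \<in> V \<and> {a, b} \<in> Es}"
  show ?case
  proof (cases xs)
    case Nil
    then show ?thesis using Cons.prems by (auto simp: walk_between_def walk_def)
  next
    case (Cons y ys)
    have "walk_between V Es y v xs" "(u, y) \<in> ?R"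
      using Cons.prems Cons by (auto simp: walk_between_def walk_def)
    then have "(u, v) \<in> ?R ^^ Suc (length xs - 1)"
      by (intro relpow_Suc_I2 [OF _ Cons.IH])
    then show ?thesis using Cons by simp
  qed
qed

lemma relpow_imp_walk_between:
  assumes "(u, v) \<in> {(a, b). a \<in> V \<and> b \<in> V \<and> {a, b} \<in> Es} ^^ i" "u \<in> V"
  shows "\<exists>xs. walk_between V Es u v xs \<and> length xs = Suc i"
  using assms
proof (induction i arbitrary: u)
  case 0
  then have "walk_between V Es u v [u]" by (simp add: walk_between_def walk_def)
  then show ?case by force
next
  case (Suc i)
  let ?R = "{(a, b). a \<in> V \<and> b \<in> V \<and> {a, b} \<in> Es}"
  obtain y where y: "(u, y) \<in> ?R" "(y, v) \<in> ?R ^^ i"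
    using relpow_Suc_D2 [OF Suc.prems(1)] by auto
  then obtain xs where xs: "walk_between V Es y v xs" "length xs = Suc i"
    using Suc.IH by blast
  then have "walk_between V Es u v (u # xs)"
    using y Suc.prems by (cases xs) (auto simp: walk_between_def walk_def)
  then show ?case using xs(2) by (intro exI [of _ "u # xs"]) simp
qed

lemma simple_path_butlast:
  assumes "simple_path Es u v xs" "u \<noteq> v"
  shows "simple_path Es u (last (butlast xs)) (butlast xs)" "2 \<le> length xs"
proof -
  obtain ys where ys: "xs = ys @ [v]"
    using assms(1) unfolding simple_path_def walk_between_def walk_def
    by (metis append_butlast_last_id)
  have "ys \<noteq> []" using ys assms by (auto simp: simple_path_def walk_between_def)
  then show "simple_path Es u (last (butlast xs)) (butlast xs)" "2 \<le> length xs"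
    using assms ys
    by (auto simp: simple_path_def walk_between_def walk_def successively_append_iff Suc_le_eq)
qed

context tree_partition
begin

text \<open>Removing the last vertex of the simple path from the root shortens it by one, so iterating
  \<open>parent\<close> reaches the root; all other properties of the tree order follow from this.\<close>

lemma parent_iterate_root:
  assumes "admissible_tree ET"
  shows "\<exists>n. (parent ^^ n) w = \<phi>"
proof -
  define len where "len w = length (THE xs. simple_path ET \<phi> w xs)" for w
  have "w = \<phi> \<or> (\<exists>n. (parent ^^ n) w = \<phi>)"
  proof (induction "len w" arbitrary: w rule: less_induct)
    case less
    show ?case
    proof (cases "w = \<phi>")
      case False
      define xs where "xs = (THE xs. simple_path ET \<phi> w xs)"
      have ex1: "\<exists>!xs. simple_path ET \<phi> v xs" if "v \<noteq> \<phi>" for v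
        using assms that by (auto simp: admissible_tree_def)
      have xs: "simple_path ET \<phi> w xs"
        unfolding xs_def by (rule theI' [OF ex1 [OF False]])
      have par: "parent w = last (butlast xs)" using False by (simp add: parent_def xs_def)
      have sp: "simple_path ET \<phi> (parent w) (butlast xs)" "2 \<le> length xs"
        using simple_path_butlast [OF xs] False par by auto
      have "\<exists>n. (parent ^^ n) (parent w) = \<phi>"
      proof (cases "parent w = \<phi>")
        case True
        then show ?thesis by (intro exI [of _ 0]) simp
      next
        case False
        then have "(THE xs. simple_path ET \<phi> (parent w) xs) = butlast xs"
          using sp(1) ex1 [OF False] by (intro the1_equality)
        then have "len (parent w) < len w"
          using sp(2) by (simp add: len_def xs_def [symmetric])
        then show ?thesis using less False by blast
      qed
      then obtain n where "(parent ^^ n) (parent w) = \<phi>" ..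
      then have "(parent ^^ Suc n) w = \<phi>" by (simp add: funpow_Suc_right del: funpow.simps)
      then show ?thesis by blast
    qed simp
  qed
  then show ?thesis by (metis funpow_0)
qed

end

locale basic_geometry = tree_partition ET \<phi> K m Ms rs p
  for ET :: "'v set set" and \<phi> :: 'v and K :: "'v \<Rightarrow> 'a::metric_space set"
    and m :: "'a measure" and Ms :: nat and rs p :: real +
  assumes basic: basic_framework
begin

lemma parent_root [simp]: "parent \<phi> = \<phi>"
  by (simp add: parent_def)

lemma level_eq_0_iff [simp]: "level w = 0 \<longleftrightarrow> w = \<phi>"
proof -
  obtain n where n: "(parent ^^ n) w = \<phi>"
    using parent_iterate_root basic by (auto simp: basic_framework_def)
  have "(parent ^^ level w) w = \<phi>" unfolding level_def
    by (rule LeastI [where P = "\<lambda>n. (parent ^^ n) w = \<phi>", OF n])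
  then show ?thesis by (auto simp: level_def intro!: Least_eq_0)
qed

lemma level_root [simp]: "level \<phi> = 0"
  by simp

lemma level_parent:
  assumes "w \<noteq> \<phi>" shows "level w = Suc (level (parent w))"
proof -
  obtain n where n: "(parent ^^ n) w = \<phi>"
    using parent_iterate_root basic by (auto simp: basic_framework_def)
  have "(LEAST n. (parent ^^ n) w = \<phi>) = Suc (LEAST n. (parent ^^ Suc n) w = \<phi>)"
    by (rule Least_Suc [where P = "\<lambda>n. (parent ^^ n) w = \<phi>", OF n]) (use assms in simp)
  then show ?thesis by (simp add: level_def funpow_Suc_right del: funpow.simps)
qed

text \<open>Truncated subtraction makes the root no exception.\<close>

lemma level_parent_diff: "level (parent w) = level w - 1"
  by (cases "w = \<phi>") (auto simp: level_parent)

lemma level_funpow_parent: "level ((parent ^^ k) w) = level w - k"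
  by (induction k) (auto simp: level_parent_diff)

lemma children_iff: "v \<in> children w \<longleftrightarrow> level v = Suc (level w) \<and> parent v = w"
proof
  assume "v \<in> children w"
  then have "parent v = w" "v \<noteq> w" by (auto simp: children_def)
  moreover from this have "v \<noteq> \<phi>" by auto
  ultimately show "level v = Suc (level w) \<and> parent v = w" using level_parent [of v] by auto
next
  assume "level v = Suc (level w) \<and> parent v = w"
  then show "v \<in> children w" by (auto simp: children_def)
qed

text \<open>The condition on the level excludes the root from its own proper descendants: it is its own
  parent.\<close>

lemma desc_iff: "v \<in> desc k w \<longleftrightarrow> level v = level w + k \<and> (parent ^^ k) v = w"
proof (induction k arbitrary: w)
  case 0
  then show ?case by auto
next
  case (Suc k)
  have "v \<in> desc (Suc k) w \<longleftrightarrow> (\<exists>u. level u = Suc (level w) \<and> parent u = w \<and>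
      level v = level u + k \<and> (parent ^^ k) v = u)"
    by (auto simp: Suc children_iff)
  also have "\<dots> \<longleftrightarrow> level v = level w + Suc k \<and> (parent ^^ Suc k) v = w"
    using level_funpow_parent [of k v] by auto
  finally show ?case .
qed

lemma desc_root: "desc n \<phi> = Tn n"
proof -
  have "(parent ^^ n) v = \<phi>" if "level v = n" for v
    using level_funpow_parent [of n v] that by simp
  then show ?thesis by (auto simp: desc_iff Tn_def)
qed

lemma Tn_iff: "w \<in> Tn n \<longleftrightarrow> level w = n"
  by (simp add: Tn_def)

lemma descs_iff:
  assumes "A \<subseteq> Tn n"
  shows "v \<in> descs k A \<longleftrightarrow> level v = n + k \<and> (parent ^^ k) v \<in> A"
  using assms by (auto simp: descs_def desc_iff Tn_iff subset_iff)

lemma descs_subset_Tn: "A \<subseteq> Tn n \<Longrightarrow> descs k A \<subseteq> Tn (n + k)"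
  by (auto simp: descs_iff Tn_iff)

lemma descs_add:
  assumes "A \<subseteq> Tn n" shows "descs (k + l) A = descs l (descs k A)"
proof (rule set_eqI)
  fix v
  have "(parent ^^ k) ((parent ^^ l) v) = (parent ^^ (k + l)) v"
    by (simp add: funpow_add)
  then show "v \<in> descs (k + l) A \<longleftrightarrow> v \<in> descs l (descs k A)"
    by (auto simp: descs_iff [OF assms] descs_iff [OF descs_subset_Tn [OF assms]]
        level_funpow_parent)
qed

lemma descs_Tn: "descs k (Tn n) = Tn (n + k)"
  by (auto simp: descs_iff [OF subset_refl] Tn_iff level_funpow_parent)

lemma children_finite: "finite (children w)"
proof -
  have "card (children w) \<ge> 2" using basic by (simp add: basic_framework_def framework1_def)
  then show ?thesis by (intro card_ge_0_finite) simp
qed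

lemma desc_finite: "finite (desc k w)"
  by (induction k arbitrary: w) (auto simp: children_finite)

lemma Tn_finite: "finite (Tn n)"
  using desc_finite [of n \<phi>] by (simp add: desc_root)

lemma K_nonempty: "K w \<noteq> {}" and K_compact: "compact (K w)"
proof -
  have "\<forall>w. K w \<noteq> {} \<and> compact (K w)"
    using basic unfolding basic_framework_def is_partition_def by (elim conjE) assumption
  then show "K w \<noteq> {}" "compact (K w)" by simp_all
qed

lemma K_root: "K \<phi> = UNIV"
  using basic unfolding basic_framework_def is_partition_def by (elim conjE) assumption

lemma K_children: "K w = (\<Union>v\<in>children w. K v)"
proof -
  have "\<forall>w. K w = (\<Union>v\<in>children w. K v)"
    using basic unfolding basic_framework_def is_partition_def by (elim conjE) assumption
  then show ?thesis by (rule spec)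
qed

lemma K_desc: "K w = (\<Union>v\<in>desc k w. K v)"
proof (induction k arbitrary: w)
  case (Suc k)
  have "K w = (\<Union>v\<in>children w. K v)" by (rule K_children)
  also have "\<dots> = (\<Union>v\<in>children w. \<Union>u\<in>desc k v. K u)" using Suc by blast
  finally show ?case by simp
qed simp

lemma K_subset_parent: "K w \<subseteq> K (parent w)"
proof (cases "w = \<phi>")
  case False
  then have "w \<in> children (parent w)" by (simp add: children_iff level_parent)
  then show ?thesis using K_children [of "parent w"] by blast
qed simp

section \<open>The graphs on the levels\<close>

definition adj :: "nat \<Rightarrow> 'v set \<Rightarrow> ('v \<times> 'v) set" where
  "adj n A = {(u, v). {u, v} \<in> Estar_on n A}"

lemma adj_iff:
  "(u, v) \<in> adj n A \<longleftrightarrow>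
     u \<in> A \<and> v \<in> A \<and> u \<in> Tn n \<and> v \<in> Tn n \<and> u \<noteq> v \<and> K u \<inter> K v \<noteq> {}"
  by (auto simp: adj_def Estar_on_def Estar_def doubleton_eq_iff)

lemma adj_sym: "(u, v) \<in> adj n A \<longleftrightarrow> (v, u) \<in> adj n A"
  by (auto simp: adj_iff)

lemma adj_relpow_sym:
  assumes "(u, v) \<in> adj n A ^^ i" shows "(v, u) \<in> adj n A ^^ i"
  using assms
proof (induction i arbitrary: u)
  case (Suc i)
  then obtain y where "(u, y) \<in> adj n A" "(y, v) \<in> adj n A ^^ i"
    using relpow_Suc_D2 by metis
  then show ?case using Suc.IH adj_sym by (meson relpow_Suc_I)
qed simp

lemma adj_finite: "finite (adj n A)"
  by (rule finite_subset [of _ "Tn n \<times> Tn n"]) (auto simp: adj_iff Tn_finite)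

lemma adj_mono: "A \<subseteq> B \<Longrightarrow> adj n A \<subseteq> adj n B"
  by (auto simp: adj_iff)

text \<open>Distances are infima in \<open>enat\<close>, hence attained as soon as they are finite.\<close>

lemma Gam_iff:
  "v \<in> Gam M w \<longleftrightarrow> (\<exists>i\<le>M. (w, v) \<in> adj (level w) (Tn (level w)) ^^ i)"
proof -
  define n where "n = level w"
  define R where "R = {(a, b). a \<in> Tn n \<and> b \<in> Tn n \<and> {a, b} \<in> Estar n}"
  have R: "R = adj n (Tn n)" by (auto simp: R_def adj_def Estar_on_def)
  define L where "L = (\<lambda>xs. enat (length xs - 1)) ` {xs. walk_between (Tn n) (Estar n) v w xs}"
  have wn: "w \<in> Tn n" by (simp add: n_def Tn_iff)
  have "v \<in> Gam M w \<longleftrightarrow> v \<in> Tn n \<and> Inf L \<le> enat M"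
    by (simp add: Gam_def graph_dist_def n_def L_def)
  also have "Inf L \<le> enat M \<longleftrightarrow> (\<exists>xs. walk_between (Tn n) (Estar n) v w xs \<and> length xs - 1 \<le> M)"
  proof
    assume le: "Inf L \<le> enat M"
    have "L \<noteq> {}" using le by (auto simp: Inf_enat_def)
    then have "Inf L \<in> L" by (auto simp: Inf_enat_def intro: LeastI)
    then show "\<exists>xs. walk_between (Tn n) (Estar n) v w xs \<and> length xs - 1 \<le> M"
      using le by (auto simp: L_def)
  next
    assume "\<exists>xs. walk_between (Tn n) (Estar n) v w xs \<and> length xs - 1 \<le> M"
    then obtain xs where "walk_between (Tn n) (Estar n) v w xs" "length xs - 1 \<le> M" by blast
    then have "enat (length xs - 1) \<in> L" "enat (length xs - 1) \<le> enat M" by (auto simp: L_def)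
    then show "Inf L \<le> enat M" using Inf_lower order_trans by blast
  qed
  also have "v \<in> Tn n \<and> \<dots> \<longleftrightarrow> (\<exists>i\<le>M. v \<in> Tn n \<and> (v, w) \<in> R ^^ i)"
  proof
    assume "v \<in> Tn n \<and> (\<exists>xs. walk_between (Tn n) (Estar n) v w xs \<and> length xs - 1 \<le> M)"
    then show "\<exists>i\<le>M. v \<in> Tn n \<and> (v, w) \<in> R ^^ i"
      using walk_between_imp_relpow [of "Tn n" "Estar n" v w] unfolding R_def by blast
  next
    assume "\<exists>i\<le>M. v \<in> Tn n \<and> (v, w) \<in> R ^^ i"
    then obtain i where i: "i \<le> M" "v \<in> Tn n" "(v, w) \<in> R ^^ i" by blast
    obtain xs where "walk_between (Tn n) (Estar n) v w xs" "length xs = Suc i"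
      using relpow_imp_walk_between [OF i(3) [unfolded R_def] i(2)] by blast
    then have "walk_between (Tn n) (Estar n) v w xs \<and> length xs - 1 \<le> M" using i by simp
    then show "v \<in> Tn n \<and> (\<exists>xs. walk_between (Tn n) (Estar n) v w xs \<and> length xs - 1 \<le> M)"
      using i(2) by blast
  qed
  also have "\<dots> \<longleftrightarrow> (\<exists>i\<le>M. (w, v) \<in> R ^^ i)"
  proof -
    have "v \<in> Tn n" if "(w, v) \<in> R ^^ i" for i
      using that wn by (cases i) (auto simp: R_def)
    then show ?thesis using adj_relpow_sym unfolding R by blast
  qed
  finally show ?thesis by (simp add: R n_def)
qed

lemma Gam_refl [simp]: "w \<in> Gam M w"
  unfolding Gam_iff by (rule exI [of _ 0]) simp

lemma Gam_level: "v \<in> Gam M w \<Longrightarrow> level v = level w"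
  by (auto simp: Gam_def Tn_iff)

lemma Gam_sym: "v \<in> Gam M w \<longleftrightarrow> w \<in> Gam M v"
  using adj_relpow_sym Gam_level unfolding Gam_iff by metis

lemma Gam_mono: "a \<le> b \<Longrightarrow> Gam a w \<subseteq> Gam b w"
  unfolding subset_iff Gam_iff using order_trans by blast

lemma Gam_trans:
  assumes "u \<in> Gam a v" "v \<in> Gam b w" shows "u \<in> Gam (b + a) w"
proof -
  define n where "n = level w"
  have n: "level v = n" using assms Gam_level n_def by simp
  obtain i j where "i \<le> a" "j \<le> b" "(v, u) \<in> adj n (Tn n) ^^ i" "(w, v) \<in> adj n (Tn n) ^^ j"
    using assms unfolding Gam_iff n n_def [symmetric] by blast
  then have "(w, u) \<in> adj n (Tn n) ^^ (j + i)" "j + i \<le> b + a"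
    by (auto simp: relpow_add)
  then show ?thesis unfolding Gam_iff n_def by blast
qed

lemma Gam_1_iff: "v \<in> Gam 1 w \<longleftrightarrow> level v = level w \<and> K v \<inter> K w \<noteq> {}"
proof -
  have le1: "(\<exists>i\<le>1. Pr i) \<longleftrightarrow> Pr 0 \<or> Pr (Suc 0)" for Pr :: "nat \<Rightarrow> bool"
    by (metis One_nat_def le_Suc_eq le_zero_eq)
  have "v \<in> Gam 1 w \<longleftrightarrow> w = v \<or> (w, v) \<in> adj (level w) (Tn (level w))"
    unfolding Gam_iff le1 by simp
  then show ?thesis using K_nonempty [of w] by (auto simp: adj_iff Tn_iff)
qed

lemma Gam_Suc_obtain:
  assumes "u \<in> Gam (Suc a) w"
  obtains v where "v \<in> Gam a w" "u \<in> Gam 1 v"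
proof -
  define n where "n = level w"
  obtain i where i: "i \<le> Suc a" "(w, u) \<in> adj n (Tn n) ^^ i"
    using assms unfolding Gam_iff n_def by blast
  show ?thesis
  proof (cases "i \<le> a")
    case True
    then have "u \<in> Gam a w" using i unfolding Gam_iff n_def by blast
    then show ?thesis using that by simp
  next
    case False
    then have "i = Suc a" using i by simp
    then obtain v where v: "(w, v) \<in> adj n (Tn n) ^^ a" "(v, u) \<in> adj n (Tn n)"
      using i by auto
    then have "v \<in> Gam a w" unfolding Gam_iff n_def by blast
    moreover have "u \<in> Gam 1 v" using v(2) unfolding Gam_1_iff by (auto simp: adj_iff Tn_iff)
    ultimately show ?thesis using that by blast
  qed
qed

text \<open>Cells that meet have parents whose cells meet, so passing to parents does not increase
  distances.\<close>

lemma parent_Gam: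
  assumes "v \<in> Gam M w" shows "parent v \<in> Gam M (parent w)"
  using assms
proof (induction M arbitrary: v)
  case 0
  then have "v = w" by (simp add: Gam_iff)
  then show ?case by simp
next
  case (Suc M)
  then obtain u where u: "u \<in> Gam M w" "v \<in> Gam 1 u" using Gam_Suc_obtain by blast
  then have "parent v \<in> Gam 1 (parent u)"
    using K_subset_parent [of v] K_subset_parent [of u]
    unfolding Gam_1_iff by (auto simp: level_parent_diff)
  then show ?case using Gam_trans [of "parent v" 1 "parent u" M "parent w"] Suc.IH u(1) by simp
qed

lemma funpow_parent_Gam: "v \<in> Gam M w \<Longrightarrow> (parent ^^ k) v \<in> Gam M ((parent ^^ k) w)"
  by (induction k) (auto simp: parent_Gam)

text \<open>Iterating the framework's condition on parents: passing to ancestors eats up the radius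
  in excess of \<open>Ms\<close>.\<close>

lemma funpow_parent_Gam_shrink:
  assumes "v \<in> Gam (Ms + j) w" shows "(parent ^^ j) v \<in> Gam Ms ((parent ^^ j) w)"
proof -
  have step: "parent v \<in> Gam (Ms + i) (parent w)" if "v \<in> Gam (Ms + Suc i) w" for v w i
    using that
  proof (induction i arbitrary: v)
    case 0
    then show ?case using basic by (auto simp: basic_framework_def framework5_def)
  next
    case (Suc i)
    then obtain u where u: "u \<in> Gam (Ms + Suc i) w" "v \<in> Gam 1 u"
      using Gam_Suc_obtain [of v "Ms + Suc i" w] by auto
    then show ?case
      using Gam_trans [OF parent_Gam [OF u(2)] Suc.IH [OF u(1)]] by simp
  qed
  show ?thesis
    using assms
  proof (induction j arbitrary: v w)
    case (Suc j)
    have "(parent ^^ j) (parent v) \<in> Gam Ms ((parent ^^ j) (parent w))"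
      by (rule Suc.IH) (use step Suc.prems in simp)
    then show ?case by (simp add: funpow_Suc_right del: funpow.simps)
  qed simp
qed

end

section \<open>Measures of cells and averages\<close>

context basic_geometry
begin

lemma prob_m: "prob_space m" and sets_m [measurable_cong, simp]: "sets m = sets borel"
  and space_m [simp]: "space m = UNIV"
proof -
  show p: "prob_space m" and s: "sets m = sets borel"
    using basic unfolding basic_framework_def by simp_all
  show "space m = UNIV" using sets_eq_imp_space_eq [OF s] by simp
qed

lemma finite_m: "finite_measure m"
  using prob_m by (rule prob_space.finite_measure)

lemma emeasure_m: "emeasure m A = ennreal (measure m A)"
  by (rule finite_measure.emeasure_eq_measure [OF finite_m])

lemma K_sets [measurable, simp]: "K w \<in> sets borel"
  using K_compact [of w] by (simp add: borel_compact)

lemma measure_K_children: "measure m (K w) = (\<Sum>v\<in>children w. measure m (K v))"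
  using basic unfolding basic_framework_def framework3_def by blast

lemma measure_K_parent:
  obtains \<gamma> where "0 < \<gamma>" "\<And>w. \<gamma> * measure m (K (parent w)) \<le> measure m (K w)"
  using basic unfolding basic_framework_def framework3_def by blast

lemma measure_K_pos: "0 < measure m (K w)"
proof -
  obtain \<gamma> where \<gamma>: "0 < \<gamma>" "\<And>w. \<gamma> * measure m (K (parent w)) \<le> measure m (K w)"
    using measure_K_parent by blast
  show ?thesis
  proof (induction "level w" arbitrary: w)
    case 0
    then have "measure m (K w) = measure m (space m)" by (simp add: K_root)
    then show ?case using prob_space.prob_space [OF prob_m] by simp
  next
    case (Suc n)
    then have "level (parent w) = n" by (simp add: level_parent_diff)
    then have "0 < \<gamma> * measure m (K (parent w))" using Suc \<gamma> by simp
    then show ?case using \<gamma>(2) [of w] by linarith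
  qed
qed

text \<open>Each child carries a fixed fraction of the measure of its parent, so there cannot be too many
  of them.\<close>

lemma children_bounded: "\<exists>D. \<forall>w. card (children w) \<le> D"
proof -
  obtain \<gamma> where \<gamma>: "0 < \<gamma>" "\<And>w. \<gamma> * measure m (K (parent w)) \<le> measure m (K w)"
    using measure_K_parent by blast
  have "card (children w) \<le> nat \<lceil>1 / \<gamma>\<rceil>" for w
  proof -
    have "real (card (children w)) * (\<gamma> * measure m (K w)) \<le> (\<Sum>v\<in>children w. measure m (K v))"
      using \<gamma>(2) by (intro sum_bounded_below) (metis children_iff)
    also have "\<dots> = 1 * measure m (K w)" by (simp add: measure_K_children [of w])
    finally have "(real (card (children w)) * \<gamma>) * measure m (K w) \<le> 1 * measure m (K w)"
      by (simp add: mult.assoc)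
    then have "real (card (children w)) * \<gamma> \<le> 1"
      using measure_K_pos [of w] by (simp only: mult_le_cancel_right)
    then have "real (card (children w)) \<le> 1 / \<gamma>" using \<gamma>(1) by (simp add: field_simps)
    then show ?thesis by linarith
  qed
  then show ?thesis by blast
qed

lemma measure_K_desc: "measure m (K w) = (\<Sum>v\<in>desc k w. measure m (K v))"
proof (induction k arbitrary: w)
  case (Suc k)
  have "(\<Sum>v\<in>desc (Suc k) w. measure m (K v)) = (\<Sum>u\<in>children w. \<Sum>v\<in>desc k u. measure m (K v))"
    unfolding desc.simps
    by (rule sum.UNION_disjoint) (auto simp: children_finite desc_finite desc_iff)
  also have "\<dots> = (\<Sum>u\<in>children w. measure m (K u))"
    by (rule sum.cong [OF refl Suc [symmetric]])
  finally show ?case using measure_K_children [of w] by simp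
qed simp

text \<open>The measures of the descendants add up to the measure of the cell that they cover, so the
  number of descendants covering a point, which is at least one on the cell, equals one almost
  everywhere.\<close>

lemma AE_indicator_desc:
  "AE x in m. indicator (K w) x = (\<Sum>v\<in>desc k w. indicator (K v) x :: real)"
proof -
  interpret finite_measure m by (rule finite_m)
  define h where "h x = (\<Sum>v\<in>desc k w. indicator (K v) x :: real) - indicator (K w) x" for x
  have int: "integrable m (indicator (K v) :: _ \<Rightarrow> real)" for v
    by (simp add: integrable_indicator_iff emeasure_m)
  have h0: "0 \<le> h x" for x
  proof (cases "x \<in> K w")
    case True
    then obtain v where v: "v \<in> desc k w" "x \<in> K v" using K_desc [of w k] by blast
    then have "indicator (K v) x \<le> (\<Sum>v\<in>desc k w. indicator (K v) x :: real)"
      by (intro member_le_sum) (auto simp: desc_finite)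
    then show ?thesis using v True by (simp add: h_def)
  qed (simp add: h_def sum_nonneg)
  have "integral\<^sup>L m h = 0" "integrable m h"
    using int measure_K_desc [of w k] by (simp_all add: h_def [abs_def])
  then have "AE x in m. h x = 0"
    using integral_nonneg_eq_0_iff_AE [of m h] h0 by simp
  then show ?thesis by (auto simp: h_def)
qed

lemma set_integral_K_desc:
  fixes g :: "'a \<Rightarrow> real"
  assumes "integrable m g"
  shows "(LINT x:K w|m. g x) = (\<Sum>v\<in>desc k w. LINT x:K v|m. g x)"
proof -
  have int: "integrable m (\<lambda>x. indicator (K v) x * g x)" for v
    using integrable_mult_indicator [OF _ assms, of "K v"] by simp
  have "(LINT x:K w|m. g x) = (\<integral>x. (\<Sum>v\<in>desc k w. indicator (K v) x * g x) \<partial>m)"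
    unfolding set_lebesgue_integral_def
  proof (rule integral_cong_AE)
    show "AE x in m. indicator (K w) x *\<^sub>R g x = (\<Sum>v\<in>desc k w. indicator (K v) x * g x)"
      using AE_indicator_desc [of w k] by eventually_elim (simp add: sum_distrib_right)
  qed (use assms in measurable)
  also have "\<dots> = (\<Sum>v\<in>desc k w. LINT x:K v|m. g x)"
    using int by (simp add: set_lebesgue_integral_def)
  finally show ?thesis .
qed

text \<open>Averaging in two steps is consistent because the cells of one level overlap in null sets
  only.\<close>

lemma avg_desc_avg:
  assumes "integrable m g" shows "avg_desc k (avg g) w = avg g w"
proof -
  have "avg g v * measure m (K v) = (LINT x:K v|m. g x)" for v
    using measure_K_pos [of v] by (simp add: avg_def)
  then show ?thesis
    using set_integral_K_desc [OF assms, of w k] measure_K_desc [of w k]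
    by (simp add: avg_desc_def avg_def [of g w])
qed

lemma avg_desc_add: "avg_desc k (avg_desc l f) w = avg_desc (k + l) f w"
proof -
  have *: "avg_desc l f v * measure m (K v) = (\<Sum>u\<in>desc l v. f u * measure m (K u))" for v
    using measure_K_desc [of v l] measure_K_pos [of v] by (simp add: avg_desc_def)
  have un: "desc (k + l) w = (\<Union>v\<in>desc k w. desc l v)"
    using descs_add [of "{w}" "level w" k l] by (simp add: descs_def Tn_iff)
  have "(\<Sum>u\<in>desc (k + l) w. f u * measure m (K u))
      = (\<Sum>v\<in>desc k w. \<Sum>u\<in>desc l v. f u * measure m (K u))"
    unfolding un by (rule sum.UNION_disjoint) (auto simp: desc_finite desc_iff)
  then show ?thesis
    using measure_K_desc [of w k] measure_K_desc [of w "k + l"] *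
    by (simp add: avg_desc_def [of k] avg_desc_def [of "k + l"])
qed

lemma Lp_integrable:
  assumes "1 \<le> p" "g \<in> Lp_space p m" shows "integrable m g"
proof -
  interpret finite_measure m by (rule finite_m)
  have g [measurable]: "g \<in> borel_measurable m" and ip: "integrable m (\<lambda>x. \<bar>g x\<bar> powr p)"
    using assms(2) by (auto simp: Lp_space_def)
  show ?thesis
  proof (rule Bochner_Integration.integrable_bound)
    show "integrable m (\<lambda>x. 1 + \<bar>g x\<bar> powr p)" using ip by simp
    have "\<bar>g x\<bar> \<le> 1 + \<bar>g x\<bar> powr p" for x
    proof (cases "\<bar>g x\<bar> \<le> 1")
      case False
      then have "\<bar>g x\<bar> powr 1 \<le> \<bar>g x\<bar> powr p" using assms(1) by (intro powr_mono) auto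
      then show ?thesis using False by simp
    qed (simp add: add_increasing2)
    then show "AE x in m. norm (g x) \<le> norm (1 + \<bar>g x\<bar> powr p)" by simp
  qed simp
qed

end

section \<open>Energies along paths\<close>

lemma relpow_path_bound:
  fixes f :: "'v \<Rightarrow> real"
  assumes "(u, v) \<in> R ^^ i"
    and "\<And>s t j. j < i \<Longrightarrow> (u, s) \<in> R ^^ j \<Longrightarrow> (s, t) \<in> R \<Longrightarrow> \<bar>f s - f t\<bar> \<le> c"
  shows "\<bar>f u - f v\<bar> \<le> real i * c"
  using assms
proof (induction i arbitrary: v)
  case (Suc i)
  obtain y where y: "(u, y) \<in> R ^^ i" "(y, v) \<in> R" using Suc.prems(1) by auto
  have "\<bar>f u - f y\<bar> \<le> real i * c"
    by (rule Suc.IH [OF y(1)]) (use Suc.prems(2) less_SucI in blast)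
  moreover have "\<bar>f y - f v\<bar> \<le> c" by (rule Suc.prems(2) [OF _ y]) simp
  ultimately show ?case by (simp add: algebra_simps)
qed simp

text \<open>Only the edges that the path can use enter the sum; keeping track of where they lie is what
  makes the later estimates local.\<close>

lemma relpow_path_energy:
  fixes f :: "'v \<Rightarrow> real"
  assumes path: "(u, v) \<in> R ^^ i" and "0 < p" and S: "finite S"
    and RS: "\<And>s t j. j < i \<Longrightarrow> (u, s) \<in> R ^^ j \<Longrightarrow> (s, t) \<in> R \<Longrightarrow> (s, t) \<in> S"
  shows "\<bar>f u - f v\<bar> powr p \<le> real i powr p * (\<Sum>(s, t)\<in>S. \<bar>f s - f t\<bar> powr p)"
proof -
  define \<Sigma> where "\<Sigma> = (\<Sum>(s, t)\<in>S. \<bar>f s - f t\<bar> powr p)"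
  have \<Sigma>: "0 \<le> \<Sigma>" unfolding \<Sigma>_def by (rule sum_nonneg) auto
  have "\<bar>f u - f v\<bar> \<le> real i * \<Sigma> powr (1 / p)"
  proof (rule relpow_path_bound [OF path])
    fix s t j assume "j < i" "(u, s) \<in> R ^^ j" "(s, t) \<in> R"
    then have "(s, t) \<in> S" by (rule RS)
    then have "(\<lambda>(s, t). \<bar>f s - f t\<bar> powr p) (s, t) \<le> \<Sigma>"
      unfolding \<Sigma>_def by (intro member_le_sum) (auto simp: S)
    then have "(\<bar>f s - f t\<bar> powr p) powr (1 / p) \<le> \<Sigma> powr (1 / p)"
      using \<open>0 < p\<close> by (intro powr_mono2) auto
    then show "\<bar>f s - f t\<bar> \<le> \<Sigma> powr (1 / p)" using \<open>0 < p\<close> by (simp add: powr_powr)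
  qed
  then have "\<bar>f u - f v\<bar> powr p \<le> (real i * \<Sigma> powr (1 / p)) powr p"
    using \<open>0 < p\<close> by (intro powr_mono2) auto
  also have "\<dots> = real i powr p * \<Sigma>"
    using \<open>0 < p\<close> \<Sigma> by (simp add: powr_mult powr_powr)
  finally show ?thesis by (simp add: \<Sigma>_def)
qed

context basic_geometry
begin

lemma energy_adj: "energy n A f = (\<Sum>(u, v)\<in>adj n A. \<bar>f u - f v\<bar> powr p) / 2"
  by (simp add: energy_def adj_def)

lemma energy_nonneg: "0 \<le> energy n A f"
  unfolding energy_adj by (auto intro!: sum_nonneg)

lemma energy_mono: "A \<subseteq> B \<Longrightarrow> energy n A f \<le> energy n B f"
  unfolding energy_adj
  by (intro divide_right_mono sum_mono2) (auto simp: adj_finite dest: adj_mono)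

lemma energy_cong: "(\<And>v. v \<in> A \<Longrightarrow> f v = g v) \<Longrightarrow> energy n A f = energy n A g"
  unfolding energy_adj by (intro arg_cong2 [where f = "(/)"] sum.cong) (auto simp: adj_iff)

end

locale bounded_geometry = basic_geometry ET \<phi> K m Ms rs p
  for ET :: "'v set set" and \<phi> :: 'v and K :: "'v \<Rightarrow> 'a::metric_space set"
    and m :: "'a measure" and Ms :: nat and rs p :: real +
  fixes N D :: nat
  assumes p_gt_1: "1 < p"
    and Gam_1_finite: "finite (Gam 1 w)" and Gam_1_card: "card (Gam 1 w) \<le> N"
    and children_card: "card (children w) \<le> D"
begin

lemma N_ge_1: "1 \<le> N"
proof -
  have "card {\<phi>} \<le> card (Gam 1 \<phi>)" using Gam_1_finite by (intro card_mono) auto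
  then show ?thesis using Gam_1_card [of \<phi>] by simp
qed

lemma D_ge_1: "1 \<le> D"
proof -
  have "card (children w) \<ge> 2" for w
    using basic by (simp add: basic_framework_def framework1_def)
  from this [of \<phi>] show ?thesis using children_card [of \<phi>] by simp
qed

lemma Gam_finite: "finite (Gam M w)"
  by (rule finite_subset [OF _ Tn_finite [of "level w"]]) (auto simp: Gam_level Tn_iff)

lemma Gam_card: "card (Gam M w) \<le> N ^ M"
proof (induction M)
  case 0
  have "Gam 0 w = {w}" by (auto simp: Gam_iff)
  then show ?case by simp
next
  case (Suc M)
  have "card (Gam (Suc M) w) \<le> card (\<Union>v\<in>Gam M w. Gam 1 v)"
  proof (rule card_mono)
    show "Gam (Suc M) w \<subseteq> (\<Union>v\<in>Gam M w. Gam 1 v)"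
    proof
      fix u assume "u \<in> Gam (Suc M) w"
      then obtain v where "v \<in> Gam M w" "u \<in> Gam 1 v" by (rule Gam_Suc_obtain)
      then show "u \<in> (\<Union>v\<in>Gam M w. Gam 1 v)" by blast
    qed
  qed (use Gam_finite in auto)
  also have "\<dots> \<le> (\<Sum>v\<in>Gam M w. card (Gam 1 v))" by (rule card_UN_le) (rule Gam_finite)
  also have "\<dots> \<le> (\<Sum>v\<in>Gam M w. N)" by (rule sum_mono) (rule Gam_1_card)
  also have "\<dots> \<le> N ^ Suc M" using Suc by simp
  finally show ?case .
qed

lemma desc_card: "card (desc k w) \<le> D ^ k"
proof (induction k arbitrary: w)
  case (Suc k)
  have "card (desc (Suc k) w) \<le> (\<Sum>v\<in>children w. card (desc k v))"
    unfolding desc.simps by (rule card_UN_le) (rule children_finite)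
  also have "\<dots> \<le> (\<Sum>v\<in>children w. D ^ k)" by (rule sum_mono) (rule Suc)
  also have "\<dots> \<le> D ^ Suc k" using children_card [of w] by simp
  finally show ?case .
qed simp

end

section \<open>Coarse-graining through coverings\<close>

lemma sum_UN_le:
  fixes e :: "'b \<Rightarrow> real"
  assumes "finite I" "\<And>i. i \<in> I \<Longrightarrow> finite (A i)" "\<And>z. 0 \<le> e z"
  shows "sum e (\<Union>i\<in>I. A i) \<le> (\<Sum>i\<in>I. sum e (A i))"
  using assms(1,2)
proof (induction I rule: finite_induct)
  case (insert j I)
  have "sum e (\<Union>i\<in>insert j I. A i) = sum e (A j \<union> (\<Union>i\<in>I. A i))" by simp
  also have "\<dots> \<le> sum e (A j) + sum e (\<Union>i\<in>I. A i)"
    using insert sum.union_inter [of "A j" "\<Union>i\<in>I. A i" e] assms(3)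
      sum_nonneg [of "A j \<inter> (\<Union>i\<in>I. A i)" e] by auto
  finally show ?case using insert by simp
qed simp

text \<open>Double counting: interchange the sums and count how often each \<open>z\<close> occurs.\<close>

lemma sum_multiplicity_le:
  fixes e :: "'b \<Rightarrow> real"
  assumes I: "finite I" and S: "finite S" and A: "\<And>i. i \<in> I \<Longrightarrow> A i \<subseteq> S"
    and e: "\<And>z. 0 \<le> e z" and c: "\<And>z. z \<in> S \<Longrightarrow> real (card {i \<in> I. z \<in> A i}) \<le> c"
  shows "(\<Sum>i\<in>I. sum e (A i)) \<le> c * sum e S"
proof -
  have "(\<Sum>i\<in>I. sum e (A i)) = (\<Sum>i\<in>I. \<Sum>z\<in>S. if z \<in> A i then e z else 0)"
  proof (rule sum.cong [OF refl])
    fix i assume "i \<in> I"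
    then have "A i = S \<inter> A i" using A by blast
    then show "sum e (A i) = (\<Sum>z\<in>S. if z \<in> A i then e z else 0)"
      using S by (metis sum.inter_restrict)
  qed
  also have "\<dots> = (\<Sum>z\<in>S. \<Sum>i\<in>I. if z \<in> A i then e z else 0)" by (rule sum.swap)
  also have "\<dots> = (\<Sum>z\<in>S. real (card {i \<in> I. z \<in> A i}) * e z)"
    using I by (simp add: sum.If_cases Int_def)
  also have "\<dots> \<le> (\<Sum>z\<in>S. c * e z)"
    by (intro sum_mono mult_right_mono c e)
  finally show ?thesis by (simp add: sum_distrib_left)
qed

lemma relpow_restrict:
  assumes "(u, v) \<in> R ^^ i"
    and "\<And>s t j. j < i \<Longrightarrow> (u, s) \<in> R ^^ j \<Longrightarrow> (s, t) \<in> R \<Longrightarrow> (s, t) \<in> R'"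
  shows "(u, v) \<in> R' ^^ i"
  using assms
proof (induction i arbitrary: v)
  case (Suc i)
  obtain y where y: "(u, y) \<in> R ^^ i" "(y, v) \<in> R" using Suc.prems(1) by auto
  have "(u, y) \<in> R' ^^ i" by (rule Suc.IH [OF y(1)]) (use Suc.prems(2) less_SucI in blast)
  moreover have "(y, v) \<in> R'" by (rule Suc.prems(2) [OF _ y]) simp
  ultimately show ?case by auto
qed simp

context bounded_geometry
begin

text \<open>If the fine energy vanishes, then so does the coarse one, because the quotient is finite and a
  positive number divided by zero is infinite.\<close>

lemma sigma_A_bound:
  assumes "sigma_A n k G \<le> ennreal s" "0 \<le> s"
  shows "energy n G (avg_desc k f) \<le> s * energy (n + k) (descs k G) f"
proof -
  define a b where "a = energy n G (avg_desc k f)" and "b = energy (n + k) (descs k G) f"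
  have ab: "0 \<le> a" "0 \<le> b" by (simp_all add: a_def b_def energy_nonneg)
  have "ennreal a / ennreal b \<le> sigma_A n k G"
    unfolding sigma_A_def a_def b_def by (rule SUP_upper) simp
  then have le: "ennreal a / ennreal b \<le> ennreal s" using assms(1) by (rule order_trans)
  have "a \<le> s * b"
  proof (cases "b = 0")
    case True
    have "a = 0"
    proof (rule ccontr)
      assume "a \<noteq> 0"
      then have "ennreal a / ennreal b = top" using True ab by (simp add: ennreal_divide_zero)
      then show False using le by (simp add: top_unique)
    qed
    then show ?thesis using True by simp
  next
    case False
    then have "a / b \<le> s" using le ab assms(2) by (simp add: divide_ennreal)
    then show ?thesis using False ab by (simp add: field_simps)
  qed
  then show ?thesis by (simp add: a_def b_def)
qed

lemma adj_Gam:
  assumes "(u, s) \<in> adj n A ^^ i" "u \<in> Tn n" "i \<le> M" shows "s \<in> Gam M u"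
proof -
  have "(u, s) \<in> adj n (Tn n) ^^ i"
    by (rule relpow_restrict [OF assms(1)]) (auto simp: adj_iff)
  then show ?thesis using assms(2,3) by (auto simp: Gam_iff Tn_iff)
qed

lemma adj_1_Gam: "(u, v) \<in> adj n A \<Longrightarrow> v \<in> Gam 1 u"
  unfolding Gam_1_iff by (auto simp: adj_iff Tn_iff)

lemma adj_funpow_parent:
  assumes "(x, y) \<in> adj (n + k) (descs k G)" "G \<subseteq> Tn n"
  shows "(parent ^^ k) x = (parent ^^ k) y \<or> ((parent ^^ k) x, (parent ^^ k) y) \<in> adj n G"
proof -
  have "y \<in> Gam 1 x" using assms(1) by (rule adj_1_Gam)
  then have "(parent ^^ k) y \<in> Gam 1 ((parent ^^ k) x)" by (rule funpow_parent_Gam)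
  then show ?thesis
    using assms unfolding Gam_1_iff by (auto simp: adj_iff descs_iff [OF assms(2)] Tn_iff
        level_funpow_parent)
qed

text \<open>Each edge of \<open>B\<close> is replaced by a short path through members of the family. An edge of the
  family serves only boundedly many edges of \<open>B\<close>, since the graph has bounded degree, and each
  vertex lies in at most \<open>NT\<close> members; so summing the conductance bounds of the members loses
  only a constant factor.\<close>

lemma covering_energy:
  assumes fin: "finite \<N>" and sub: "\<And>G. G \<in> \<N> \<Longrightarrow> G \<subseteq> Tn n"
    and mult: "\<And>x. x \<in> \<Union>\<N> \<Longrightarrow> card {G \<in> \<N>. x \<in> G} \<le> NT"
    and conn: "\<And>u v. (u, v) \<in> adj n B \<Longrightarrow> \<exists>i\<le>NE. (u, v) \<in> (\<Union>G\<in>\<N>. adj n G) ^^ i"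
    and sig: "\<And>G. G \<in> \<N> \<Longrightarrow> sigma_A n k G \<le> ennreal s" and s: "0 \<le> s"
  shows "energy n B (avg_desc k f)
    \<le> real NE powr p * real N ^ Suc NE * real NT * s * energy (n + k) (descs k (\<Union>\<N>)) f"
proof -
  define R where "R = (\<Union>G\<in>\<N>. adj n G)"
  define g where "g = avg_desc k f"
  define e where "e = (\<lambda>(s, t). \<bar>g s - g t\<bar> powr p)"
  define e' where "e' = (\<lambda>(s, t). \<bar>f s - f t\<bar> powr p)"
  define S where "S u = {z \<in> R. fst z \<in> Gam NE u}" for u
  have e: "0 \<le> e z" and e': "0 \<le> e' z" for z by (auto simp: e_def e'_def split: prod.split)
  have Rfin: "finite R" by (auto simp: R_def fin adj_finite)
  have R_sub: "R \<subseteq> adj n (\<Union>\<N>)" by (auto simp: R_def adj_iff)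
  have p0: "0 < p" using p_gt_1 by simp
  have edge: "e (u, v) \<le> real NE powr p * sum e (S u)" if uv: "(u, v) \<in> adj n B" for u v
  proof -
    obtain i where i: "i \<le> NE" "(u, v) \<in> R ^^ i" using conn [OF uv] by (auto simp: R_def)
    have "e (u, v) \<le> real i powr p * sum e (S u)"
      unfolding e_def prod.case
    proof (rule relpow_path_energy [OF i(2) p0])
      show "finite (S u)" using Rfin by (simp add: S_def)
      fix s' t j assume j: "j < i" "(u, s') \<in> R ^^ j" "(s', t) \<in> R"
      have "(u, s') \<in> adj n (\<Union>\<N>) ^^ j"
        by (rule relpow_restrict [OF j(2)]) (use R_sub in auto)
      then have "s' \<in> Gam NE u" by (rule adj_Gam) (use j i uv in \<open>auto simp: adj_iff\<close>)
      then show "(s', t) \<in> S u" using j by (simp add: S_def)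
    qed
    also have "\<dots> \<le> real NE powr p * sum e (S u)"
      using i p0 e by (intro mult_right_mono powr_mono2 sum_nonneg) auto
    finally show ?thesis .
  qed
  have "(\<Sum>z\<in>adj n B. e z) \<le> (\<Sum>z\<in>adj n B. real NE powr p * sum e (S (fst z)))"
    by (intro sum_mono) (use edge in auto)
  also have "\<dots> = real NE powr p * (\<Sum>z\<in>adj n B. sum e (S (fst z)))"
    by (simp add: sum_distrib_left)
  also have "(\<Sum>z\<in>adj n B. sum e (S (fst z))) \<le> real N ^ Suc NE * sum e R"
  proof (rule sum_multiplicity_le)
    fix z assume "z \<in> R"
    \<comment> \<open>An edge \<open>z\<close> is charged only by edges of \<open>B\<close> that start near it.\<close>
    have "{y \<in> adj n B. z \<in> S (fst y)} \<subseteq> (SIGMA u:Gam NE (fst z). Gam 1 u)"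
      using Gam_sym adj_1_Gam by (auto simp: S_def)
    then have "card {y \<in> adj n B. z \<in> S (fst y)} \<le> card (SIGMA u:Gam NE (fst z). Gam 1 u)"
      by (intro card_mono) (auto simp: Gam_finite)
    also have "\<dots> = (\<Sum>u\<in>Gam NE (fst z). card (Gam 1 u))"
      by (rule card_SigmaI) (auto simp: Gam_finite)
    also have "\<dots> \<le> (\<Sum>u\<in>Gam NE (fst z). N)" by (intro sum_mono Gam_1_card)
    also have "\<dots> \<le> N ^ Suc NE" using Gam_card [of NE "fst z"] by simp
    finally show "real (card {y \<in> adj n B. z \<in> S (fst y)}) \<le> real N ^ Suc NE"
      by (metis of_nat_le_iff of_nat_power)
  qed (auto simp: adj_finite Rfin S_def e)
  also have "sum e R \<le> (\<Sum>G\<in>\<N>. sum e (adj n G))"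
    unfolding R_def by (rule sum_UN_le) (auto simp: fin adj_finite e)
  also have "\<dots> \<le> (\<Sum>G\<in>\<N>. s * sum e' (adj (n + k) (descs k G)))"
  proof (rule sum_mono)
    fix G assume "G \<in> \<N>"
    then have "energy n G g \<le> s * energy (n + k) (descs k G) f"
      unfolding g_def using sig s by (intro sigma_A_bound)
    then show "sum e (adj n G) \<le> s * sum e' (adj (n + k) (descs k G))"
      by (simp add: energy_adj e_def e'_def)
  qed
  also have "\<dots> = s * (\<Sum>G\<in>\<N>. sum e' (adj (n + k) (descs k G)))"
    by (simp add: sum_distrib_left)
  also have "(\<Sum>G\<in>\<N>. sum e' (adj (n + k) (descs k G)))
      \<le> real NT * sum e' (adj (n + k) (descs k (\<Union>\<N>)))"
  proof (rule sum_multiplicity_le)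
    have U: "\<Union>\<N> \<subseteq> Tn n" using sub by blast
    fix z assume z: "z \<in> adj (n + k) (descs k (\<Union>\<N>))"
    define x where "x = (parent ^^ k) (fst z)"
    have x: "x \<in> \<Union>\<N>" using z by (cases z) (auto simp: adj_iff descs_iff [OF U] x_def)
    have "{G \<in> \<N>. z \<in> adj (n + k) (descs k G)} \<subseteq> {G \<in> \<N>. x \<in> G}"
    proof clarify
      fix G assume "G \<in> \<N>" "z \<in> adj (n + k) (descs k G)"
      then show "x \<in> G"
        using descs_iff [OF sub, of G] by (cases z) (auto simp: adj_iff x_def)
    qed
    then have "card {G \<in> \<N>. z \<in> adj (n + k) (descs k G)} \<le> card {G \<in> \<N>. x \<in> G}"
      using fin by (intro card_mono) auto
    then show "real (card {G \<in> \<N>. z \<in> adj (n + k) (descs k G)}) \<le> real NT"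
      using mult [OF x] by simp
  next
    show "adj (n + k) (descs k G) \<subseteq> adj (n + k) (descs k (\<Union>\<N>))" if "G \<in> \<N>" for G
      using that by (intro adj_mono) (auto simp: descs_def)
  qed (auto simp: fin adj_finite e')
  finally have "sum e (adj n B) \<le> real NE powr p * (real N ^ Suc NE *
      (s * (real NT * sum e' (adj (n + k) (descs k (\<Union>\<N>))))))"
    using s by (simp add: mult_left_mono)
  then show ?thesis
    by (simp add: energy_adj e_def e'_def g_def mult_ac)
qed

lemma is_covering_conn:
  assumes "is_covering n A \<N> NT NE" "(u, v) \<in> adj n A"
  shows "\<exists>i\<le>NE. (u, v) \<in> (\<Union>G\<in>\<N>. adj n G) ^^ i"
proof -
  have "{u, v} \<in> Estar_on n A" using assms(2) by (simp add: adj_def)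
  then obtain xs where xs: "walk_between A (\<Union>G\<in>\<N>. Estar_on n G) u v xs" "length xs \<le> NE + 1"
    using assms(1) unfolding is_covering_def by blast
  have "(u, v) \<in> {(a, b). a \<in> A \<and> b \<in> A \<and> {a, b} \<in> (\<Union>G\<in>\<N>. Estar_on n G)} ^^ (length xs - 1)"
    by (rule walk_between_imp_relpow [OF xs(1)])
  then have "(u, v) \<in> (\<Union>G\<in>\<N>. adj n G) ^^ (length xs - 1)"
    by (rule relpow_restrict) (auto simp: adj_def)
  then show ?thesis using xs(2) by (intro exI [of _ "length xs - 1"]) auto
qed

lemma is_covering_energy:
  assumes cov: "is_covering n A \<N> NT NE" and A: "A \<subseteq> Tn n"
    and sig: "\<And>G. G \<in> \<N> \<Longrightarrow> sigma_A n k G \<le> ennreal s" and s: "0 \<le> s"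
  shows "energy n A (avg_desc k f)
    \<le> real NE powr p * real N ^ Suc NE * real NT * s * energy (n + k) (descs k A) f"
proof -
  have "A = \<Union>\<N>" using cov by (simp add: is_covering_def)
  moreover have "energy n A (avg_desc k f)
    \<le> real NE powr p * real N ^ Suc NE * real NT * s * energy (n + k) (descs k (\<Union>\<N>)) f"
    by (rule covering_energy [OF _ _ _ is_covering_conn [OF cov] sig s])
      (use cov A in \<open>auto simp: is_covering_def\<close>)
  ultimately show ?thesis by simp
qed

text \<open>A union of connected components of \<open>G\<close> has no larger conductance constant: extend a
  function by zero to the descendants of the other components.\<close>

lemma sigma_A_components:
  assumes G: "G \<subseteq> Tn n" and H: "H \<subseteq> G"
    and closed: "\<And>s t. (s, t) \<in> adj n G \<Longrightarrow> s \<in> H \<Longrightarrow> t \<in> H"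
  shows "sigma_A n k H \<le> sigma_A n k G"
  unfolding sigma_A_def [of n k H]
proof (rule SUP_least)
  fix f :: "'v \<Rightarrow> real"
  define f' where "f' x = (if x \<in> descs k H then f x else 0)" for x
  have H': "H \<subseteq> Tn n" using G H by blast
  have closed_iff: "s \<in> H \<longleftrightarrow> t \<in> H" if "(s, t) \<in> adj n G" for s t
    using closed [OF that] closed [of t s] that adj_sym [of s t n G] by auto
  have in_H: "avg_desc k f' u = avg_desc k f u" if "u \<in> H" for u
  proof -
    have "f' v = f v" if "v \<in> desc k u" for v
      using that \<open>u \<in> H\<close> by (auto simp: f'_def descs_def)
    then show ?thesis by (simp add: avg_desc_def)
  qed
  have notin_H: "avg_desc k f' u = 0" if "u \<in> G - H" for u
  proof -
    have "f' v = 0" if "v \<in> desc k u" for v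
      using that \<open>u \<in> G - H\<close> by (auto simp: f'_def descs_iff [OF H'] desc_iff)
    then show ?thesis by (simp add: avg_desc_def)
  qed
  have "energy n G (avg_desc k f') = energy n H (avg_desc k f)"
    unfolding energy_adj
  proof (intro arg_cong2 [where f = "(/)"] sum.mono_neutral_cong_right)
    show "\<forall>z\<in>adj n G - adj n H. (case z of (u, v) \<Rightarrow> \<bar>avg_desc k f' u - avg_desc k f' v\<bar> powr p) = 0"
    proof (clarify)
      fix u v assume uv: "(u, v) \<in> adj n G" "(u, v) \<notin> adj n H"
      then have "u \<notin> H \<or> v \<notin> H" by (auto simp: adj_iff)
      then have "u \<in> G - H" "v \<in> G - H"
        using closed_iff [OF uv(1)] uv(1) by (auto simp: adj_iff)
      then show "\<bar>avg_desc k f' u - avg_desc k f' v\<bar> powr p = 0" by (simp add: notin_H)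
    qed
  qed (use H in \<open>auto simp: adj_finite adj_iff in_H\<close>)
  moreover have "energy (n + k) (descs k G) f' = energy (n + k) (descs k H) f"
    unfolding energy_adj
  proof (intro arg_cong2 [where f = "(/)"] sum.mono_neutral_cong_right)
    show "adj (n + k) (descs k H) \<subseteq> adj (n + k) (descs k G)"
      by (rule adj_mono) (use H in \<open>auto simp: descs_def\<close>)
    show "\<forall>z\<in>adj (n + k) (descs k G) - adj (n + k) (descs k H).
        (case z of (u, v) \<Rightarrow> \<bar>f' u - f' v\<bar> powr p) = 0"
    proof (clarify)
      fix x y
      assume xy: "(x, y) \<in> adj (n + k) (descs k G)" "(x, y) \<notin> adj (n + k) (descs k H)"
      have "(parent ^^ k) x \<in> H \<longleftrightarrow> (parent ^^ k) y \<in> H"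
        using adj_funpow_parent [OF xy(1) G] closed_iff by auto
      then have "x \<in> descs k H \<longleftrightarrow> y \<in> descs k H"
        using xy(1) by (auto simp: adj_iff descs_iff [OF H'] descs_iff [OF G])
      then have "x \<notin> descs k H" "y \<notin> descs k H" using xy by (auto simp: adj_iff)
      then show "\<bar>f' x - f' y\<bar> powr p = 0" by (simp add: f'_def)
    qed
  qed (auto simp: adj_finite adj_iff f'_def)
  moreover have "ennreal (energy n G (avg_desc k f')) / ennreal (energy (n + k) (descs k G) f')
      \<le> sigma_A n k G"
    unfolding sigma_A_def by (rule SUP_upper) simp
  ultimately show "ennreal (energy n H (avg_desc k f)) / ennreal (energy (n + k) (descs k H) f)
      \<le> sigma_A n k G" by simp
qed

text \<open>The members of a covering need not be connected, so a member that meets \<open>B\<close> may extend far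
  away from it. Keeping only the components that come near \<open>B\<close> makes the estimate local; a
  component of a graph with at most \<open>NJ\<close> vertices has diameter at most \<open>NJ\<^sup>2\<close>.\<close>

lemma is_covering_energy_local:
  assumes cov: "is_covering n (Tn n) \<N> NT NE" and B: "B \<subseteq> Tn n"
    and sig: "\<And>G. G \<in> \<N> \<Longrightarrow> sigma_A n k G \<le> ennreal s" and s: "0 \<le> s"
    and NJ: "\<And>G. G \<in> \<N> \<Longrightarrow> card G \<le> NJ"
  shows "energy n B (avg_desc k f) \<le> real NE powr p * real N ^ Suc NE * real NT * s *
    energy (n + k) (descs k (\<Union>b\<in>B. Gam (NE + NJ ^ 2) b)) f"
proof -
  define near where "near = (\<Union>b\<in>B. Gam NE b)"
  define H where "H G = {y \<in> G. \<exists>x\<in>G \<inter> near. (x, y) \<in> (adj n G)\<^sup>*}" for G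
  have fin: "finite \<N>" and U: "\<Union>\<N> = Tn n"
    and mult: "\<And>x. x \<in> Tn n \<Longrightarrow> card {G \<in> \<N>. x \<in> G} \<le> NT"
    using cov by (auto simp: is_covering_def)
  have sub: "G \<subseteq> Tn n" if "G \<in> \<N>" for G using that U by blast
  have "energy n B (avg_desc k f) \<le> real NE powr p * real N ^ Suc NE * real NT * s *
      energy (n + k) (descs k (\<Union>(H ` \<N>))) f"
  proof (rule covering_energy)
    show "finite (H ` \<N>)" using fin by simp
    show "G' \<subseteq> Tn n" if "G' \<in> H ` \<N>" for G' using that sub by (auto simp: H_def)
    show "card {G' \<in> H ` \<N>. x \<in> G'} \<le> NT" if "x \<in> \<Union>(H ` \<N>)" for x
    proof -
      have "x \<in> Tn n" using that sub by (auto simp: H_def)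
      have "{G' \<in> H ` \<N>. x \<in> G'} \<subseteq> H ` {G \<in> \<N>. x \<in> G}" by (auto simp: H_def)
      then have "card {G' \<in> H ` \<N>. x \<in> G'} \<le> card (H ` {G \<in> \<N>. x \<in> G})"
        using fin by (intro card_mono) auto
      also have "\<dots> \<le> card {G \<in> \<N>. x \<in> G}" using fin by (intro card_image_le) auto
      also have "\<dots> \<le> NT" using mult \<open>x \<in> Tn n\<close> by blast
      finally show ?thesis .
    qed
    show "sigma_A n k G' \<le> ennreal s" if "G' \<in> H ` \<N>" for G'
    proof -
      obtain G where G: "G \<in> \<N>" "G' = H G" using \<open>G' \<in> H ` \<N>\<close> by blast
      have "sigma_A n k (H G) \<le> sigma_A n k G"
      proof (rule sigma_A_components [OF sub [OF G(1)]])
        show "t \<in> H G" if st: "(s, t) \<in> adj n G" and s: "s \<in> H G" for s t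
        proof -
          have "t \<in> G" using st by (simp add: adj_iff)
          then show ?thesis using s st by (auto simp: H_def intro: rtrancl_into_rtrancl)
        qed
      qed (simp add: H_def)
      then show ?thesis using sig G order_trans by blast
    qed
    show "\<exists>i\<le>NE. (u, v) \<in> (\<Union>G'\<in>H ` \<N>. adj n G') ^^ i" if uv: "(u, v) \<in> adj n B" for u v
    proof -
      have "(u, v) \<in> adj n (Tn n)" using uv by (auto simp: adj_iff)
      then obtain i where i: "i \<le> NE" "(u, v) \<in> (\<Union>G\<in>\<N>. adj n G) ^^ i"
        using is_covering_conn [OF cov] by blast
      have "(u, v) \<in> (\<Union>G'\<in>H ` \<N>. adj n G') ^^ i"
      proof (rule relpow_restrict [OF i(2)])
        fix a b j
        assume j: "j < i" "(u, a) \<in> (\<Union>G\<in>\<N>. adj n G) ^^ j" "(a, b) \<in> (\<Union>G\<in>\<N>. adj n G)"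
        have "(u, a) \<in> adj n (Tn n) ^^ j"
          by (rule relpow_restrict [OF j(2)]) (auto simp: adj_iff)
        then have "a \<in> Gam NE u" by (rule adj_Gam) (use j i uv in \<open>auto simp: adj_iff\<close>)
        then have near: "a \<in> near" using uv by (auto simp: near_def adj_iff)
        obtain G where G: "G \<in> \<N>" "(a, b) \<in> adj n G" using j by blast
        then have "a \<in> G" "b \<in> G" by (auto simp: adj_iff)
        then have "a \<in> H G" "b \<in> H G" using near r_into_rtrancl [OF G(2)] by (auto simp: H_def)
        then have "(a, b) \<in> adj n (H G)" using G(2) by (simp add: adj_iff)
        then show "(a, b) \<in> (\<Union>G'\<in>H ` \<N>. adj n G')" using G(1) by blast
      qed
      then show ?thesis using i(1) by blast
    qed
  qed (rule s)
  also have "energy (n + k) (descs k (\<Union>(H ` \<N>))) f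
      \<le> energy (n + k) (descs k (\<Union>b\<in>B. Gam (NE + NJ ^ 2) b)) f"
  proof (rule energy_mono)
    have "\<Union>(H ` \<N>) \<subseteq> (\<Union>b\<in>B. Gam (NE + NJ ^ 2) b)"
    proof clarify
      fix y G assume G: "G \<in> \<N>" and "y \<in> H G"
      then obtain x b where x: "x \<in> G" "b \<in> B" "x \<in> Gam NE b" "(x, y) \<in> (adj n G)\<^sup>*"
        by (auto simp: H_def near_def)
      have finG: "finite G" using sub [OF G] Tn_finite finite_subset by blast
      obtain i where i: "i \<le> card (adj n G)" "(x, y) \<in> adj n G ^^ i"
        using x(4) rtrancl_finite_eq_relpow [OF adj_finite [of n G]] by auto
      have "card (adj n G) \<le> card (G \<times> G)"
        using finG by (intro card_mono) (auto simp: adj_iff)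
      also have "\<dots> \<le> NJ ^ 2"
        using NJ [OF G] by (simp add: card_cartesian_product power2_eq_square mult_le_mono)
      finally have "y \<in> Gam (NJ ^ 2) x"
        using i sub [OF G] x(1) by (intro adj_Gam [OF i(2)]) auto
      then have "y \<in> Gam (NE + NJ ^ 2) b" using Gam_trans x(3) by blast
      then show "y \<in> (\<Union>b\<in>B. Gam (NE + NJ ^ 2) b)" using x(2) by blast
    qed
    then show "descs k (\<Union>(H ` \<N>)) \<subseteq> descs k (\<Union>b\<in>B. Gam (NE + NJ ^ 2) b)"
      unfolding descs_def by (rule UN_mono) simp
  qed
  finally show ?thesis using s by (simp add: mult_left_mono)
qed

lemma sigma_A_le_sigma_J:
  "G \<in> \<J> \<Longrightarrow> G \<subseteq> Tn n \<Longrightarrow> sigma_A n k G \<le> sigma_J \<J> k"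
  unfolding sigma_J_def by (intro SUP_upper2 [of n] SUP_upper2 [of G]) auto

lemma covering_systemE:
  assumes "covering_system \<J>"
  obtains NT NE NJ where "NT \<ge> 1" "NE \<ge> 1"
    and "\<forall>A\<in>\<J>. card A \<le> NJ"
    and "\<forall>w. \<forall>k\<ge>1. \<exists>\<N>. \<N> \<subseteq> {A \<in> \<J>. A \<subseteq> Tn (level w + k)} \<and>
       is_covering (level w + k) (desc k w) \<N> NT NE"
    and "\<forall>G\<in>\<J>. \<forall>n k. G \<subseteq> Tn n \<longrightarrow> (\<exists>\<N>. \<N> \<subseteq> {A \<in> \<J>. A \<subseteq> Tn (n + k)} \<and>
       is_covering (n + k) (descs k G) \<N> NT NE)"
proof -
  obtain NT NE NJ where ge: "NT \<ge> 1" "NE \<ge> 1"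
    and NJ: "\<forall>A\<in>\<J>. finite A \<and> card A \<le> NJ"
    and c1: "\<forall>w. \<forall>k\<ge>1. \<exists>\<N>. \<N> \<subseteq> {A \<in> \<J>. A \<subseteq> Tn (level w + k)} \<and>
           is_covering (level w + k) (desc k w) \<N> NT NE"
    and c2: "\<forall>G\<in>\<J>. \<forall>n k. G \<subseteq> Tn n \<longrightarrow> (\<exists>\<N>. \<N> \<subseteq> {A \<in> \<J>. A \<subseteq> Tn (n + k)} \<and>
           is_covering (n + k) (descs k G) \<N> NT NE)"
    using assms unfolding covering_system_def by (elim conjE exE) (rule that; assumption)
  show ?thesis
    by (rule that [OF ge, of NJ]) (use NJ c1 c2 in simp_all)
qed

text \<open>The level \<open>n\<close> consists of the descendants of the root, which the system covers for \<open>n \<ge> 1\<close>.\<close>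

lemma covering_system_energy_local:
  assumes "covering_system \<J>"
  shows "\<exists>C>0. \<exists>L. \<forall>n\<ge>1. \<forall>k s f B. 0 \<le> s \<longrightarrow> sigma_J \<J> k \<le> ennreal s \<longrightarrow> B \<subseteq> Tn n \<longrightarrow>
    energy n B (avg_desc k f) \<le> C * s * energy (n + k) (descs k (\<Union>b\<in>B. Gam L b)) f"
proof -
  obtain NT NE NJ where ge: "NT \<ge> 1" "NE \<ge> 1"
    and NJ: "\<forall>A\<in>\<J>. card A \<le> NJ"
    and cov: "\<forall>w. \<forall>k\<ge>1. \<exists>\<N>. \<N> \<subseteq> {A \<in> \<J>. A \<subseteq> Tn (level w + k)} \<and>
       is_covering (level w + k) (desc k w) \<N> NT NE"
    and "\<forall>G\<in>\<J>. \<forall>n k. G \<subseteq> Tn n \<longrightarrow> (\<exists>\<N>. \<N> \<subseteq> {A \<in> \<J>. A \<subseteq> Tn (n + k)} \<and>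
       is_covering (n + k) (descs k G) \<N> NT NE)"
    by (rule covering_systemE [OF assms]) (rule that; assumption)
  define C where "C = real NE powr p * real N ^ Suc NE * real NT"
  have "0 < C" using ge N_ge_1 by (simp add: C_def)
  moreover have "energy n B (avg_desc k f)
      \<le> C * s * energy (n + k) (descs k (\<Union>b\<in>B. Gam (NE + NJ ^ 2) b)) f"
    if "n \<ge> 1" "0 \<le> s" "sigma_J \<J> k \<le> ennreal s" "B \<subseteq> Tn n" for n k s f B
  proof -
    obtain \<N> where \<N>: "\<N> \<subseteq> {A \<in> \<J>. A \<subseteq> Tn n}" "is_covering n (Tn n) \<N> NT NE"
      using cov [rule_format, OF \<open>n \<ge> 1\<close>, of \<phi>] by (auto simp: desc_root)
    show ?thesis
      unfolding C_def
    proof (rule is_covering_energy_local [OF \<N>(2) that(4) _ that(2)])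
      fix G assume "G \<in> \<N>"
      then have "G \<in> \<J>" "G \<subseteq> Tn n" using \<N>(1) by auto
      then show "sigma_A n k G \<le> ennreal s" "card G \<le> NJ"
        using sigma_A_le_sigma_J that(3) NJ order_trans by blast+
    qed
  qed
  ultimately show ?thesis by blast
qed

lemma covering_system_energy:
  assumes "covering_system \<J>"
  shows "\<exists>C>0. \<forall>n\<ge>1. \<forall>k s f. 0 \<le> s \<longrightarrow> sigma_J \<J> k \<le> ennreal s \<longrightarrow>
    energy n (Tn n) (avg_desc k f) \<le> C * s * energy (n + k) (Tn (n + k)) f"
proof -
  obtain C L where "0 < C" and C: "\<And>n k s f B. n \<ge> 1 \<Longrightarrow> 0 \<le> s \<Longrightarrow> sigma_J \<J> k \<le> ennreal s \<Longrightarrow>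
      B \<subseteq> Tn n \<Longrightarrow> energy n B (avg_desc k f) \<le> C * s * energy (n + k) (descs k (\<Union>b\<in>B. Gam L b)) f"
    using covering_system_energy_local [OF assms] by blast
  have "(\<Union>b\<in>Tn n. Gam L b) = Tn n" for n
    using Gam_level Gam_refl by (fastforce simp: Tn_iff)
  then show ?thesis using \<open>0 < C\<close> C [OF _ _ _ subset_refl] descs_Tn by (metis (no_types, lifting))
qed

text \<open>Averaging in two steps: the coverings of \<open>descs k G\<close> for \<open>G \<in> \<J>\<close> control the second step.\<close>

lemma sigma_J_submultiplicative:
  assumes "covering_system \<J>"
  shows "\<exists>C>0. \<forall>k l s t. 0 \<le> s \<longrightarrow> 0 \<le> t \<longrightarrow> sigma_J \<J> k \<le> ennreal s \<longrightarrow> sigma_J \<J> l \<le> ennreal t \<longrightarrow>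
    sigma_J \<J> (k + l) \<le> ennreal (C * s * t)"
proof -
  obtain NT NE NJ where ge: "NT \<ge> 1" "NE \<ge> 1"
    and NJ: "\<forall>A\<in>\<J>. card A \<le> NJ"
    and "\<forall>w. \<forall>k\<ge>1. \<exists>\<N>. \<N> \<subseteq> {A \<in> \<J>. A \<subseteq> Tn (level w + k)} \<and>
       is_covering (level w + k) (desc k w) \<N> NT NE"
    and cov: "\<forall>G\<in>\<J>. \<forall>n k. G \<subseteq> Tn n \<longrightarrow> (\<exists>\<N>. \<N> \<subseteq> {A \<in> \<J>. A \<subseteq> Tn (n + k)} \<and>
       is_covering (n + k) (descs k G) \<N> NT NE)"
    by (rule covering_systemE [OF assms]) (rule that; assumption)
  define C where "C = real NE powr p * real N ^ Suc NE * real NT"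
  have "0 < C" using ge N_ge_1 by (simp add: C_def)
  moreover have "sigma_J \<J> (k + l) \<le> ennreal (C * s * t)"
    if st: "0 \<le> s" "0 \<le> t" "sigma_J \<J> k \<le> ennreal s" "sigma_J \<J> l \<le> ennreal t" for k l s t
    unfolding sigma_J_def [of \<J> "k + l"] sigma_A_def
  proof (intro SUP_least)
    fix n G and f :: "'v \<Rightarrow> real"
    assume "G \<in> {A \<in> \<J>. A \<subseteq> Tn n}"
    then have G: "G \<in> \<J>" "G \<subseteq> Tn n" by auto
    obtain \<N> where \<N>: "\<N> \<subseteq> {A \<in> \<J>. A \<subseteq> Tn (n + k)}"
      "is_covering (n + k) (descs k G) \<N> NT NE"
      using cov [rule_format, OF G, of k] by (elim exE conjE)
    define a b where "a = energy n G (avg_desc (k + l) f)"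
      and "b = energy (n + (k + l)) (descs (k + l) G) f"
    have ab: "0 \<le> a" "0 \<le> b" by (simp_all add: a_def b_def energy_nonneg)
    have "a = energy n G (avg_desc k (avg_desc l f))"
      unfolding a_def by (simp add: avg_desc_add [abs_def])
    also have "\<dots> \<le> s * energy (n + k) (descs k G) (avg_desc l f)"
      using sigma_A_le_sigma_J [OF G] st by (intro sigma_A_bound) (blast intro: order_trans)+
    also have "s * energy (n + k) (descs k G) (avg_desc l f)
        \<le> s * (C * t * energy (n + k + l) (descs l (descs k G)) f)"
      unfolding C_def
    proof (rule mult_left_mono [OF is_covering_energy [OF \<N>(2) descs_subset_Tn [OF G(2)] _ st(2)] st(1)])
      show "sigma_A (n + k) l G' \<le> ennreal t" if "G' \<in> \<N>" for G'
        using sigma_A_le_sigma_J [of G' \<J> "n + k" l] that \<N>(1) st(4) order_trans by blast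
    qed
    finally have le: "a \<le> C * s * t * b"
      by (simp add: b_def add.assoc descs_add [OF G(2)] mult_ac)
    show "ennreal a / ennreal b \<le> ennreal (C * s * t)"
    proof (cases "b = 0")
      case True
      then have "a = 0" using le ab by simp
      then show ?thesis by simp
    next
      case False
      then have "a / b \<le> C * s * t" using le ab by (simp add: divide_le_eq)
      then show ?thesis using False ab by (simp add: divide_ennreal ennreal_leI)
    qed
  qed
  ultimately show ?thesis by blast
qed

end

section \<open>Capacities of cells\<close>

lemma powr_sum_le:
  fixes z :: "'b \<Rightarrow> real"
  assumes "finite I" "0 < q" "\<And>i. i \<in> I \<Longrightarrow> 0 \<le> z i"
  shows "(\<Sum>i\<in>I. z i) powr q \<le> real (card I) powr q * (\<Sum>i\<in>I. z i powr q)"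
proof -
  define S where "S = (\<Sum>i\<in>I. z i powr q)"
  have S: "0 \<le> S" unfolding S_def by (rule sum_nonneg) simp
  have "z i \<le> S powr (1 / q)" if "i \<in> I" for i
  proof -
    have "z i powr q \<le> S" unfolding S_def using that assms(1) by (intro member_le_sum) auto
    then have "(z i powr q) powr (1 / q) \<le> S powr (1 / q)" using assms by (intro powr_mono2) auto
    then show ?thesis using assms that by (simp add: powr_powr)
  qed
  then have "(\<Sum>i\<in>I. z i) \<le> real (card I) * S powr (1 / q)" by (rule sum_bounded_above)
  then have "(\<Sum>i\<in>I. z i) powr q \<le> (real (card I) * S powr (1 / q)) powr q"
    using assms by (intro powr_mono2 sum_nonneg) auto
  also have "\<dots> = real (card I) powr q * S" using assms S by (simp add: powr_mult powr_powr)
  finally show ?thesis by (simp add: S_def)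
qed

text \<open>Compare the two minima at the index where one of them is attained.\<close>

lemma Min_diff_le:
  fixes f g :: "'b \<Rightarrow> real"
  assumes "finite I" "I \<noteq> {}"
  shows "\<exists>i\<in>I. \<bar>Min (f ` I) - Min (g ` I)\<bar> \<le> \<bar>f i - g i\<bar>"
proof -
  have "Min (h ` I) \<in> h ` I" for h :: "'b \<Rightarrow> real" using assms by (intro Min_in) auto
  then obtain i j where i: "i \<in> I" "Min (f ` I) = f i" and j: "j \<in> I" "Min (g ` I) = g j"
    by (metis imageE)
  have "f i \<le> f j" "g j \<le> g i"
    using Min_le [of "f ` I" "f j"] Min_le [of "g ` I" "g i"] i j assms by auto
  then have "\<bar>f i - g j\<bar> \<le> \<bar>f i - g i\<bar> \<or> \<bar>f i - g j\<bar> \<le> \<bar>f j - g j\<bar>" by linarith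
  then show ?thesis using i j by auto
qed

text \<open>A two-sided form of Fekete's lemma. With \<open>a = ln \<circ> e\<close>, comparing both \<open>a k\<close> and \<open>a l\<close> with
  \<open>a (k * l)\<close> for \<open>k, l \<ge> 1\<close> shows that every \<open>(a k - B) / k\<close> lies below every \<open>(a l + B) / l\<close>; a
  number between them is the exponential rate.\<close>

lemma quasi_multiplicative_exponential:
  fixes e :: "nat \<Rightarrow> real"
  assumes pos: "\<And>k. 0 < e k" and A: "0 < A"
    and upper: "\<And>k l. e (k + l) \<le> A * e k * e l"
    and lower: "\<And>k l. e k * e l \<le> A * e (k + l)"
  shows "\<exists>s>0. \<forall>k. (1 / A) / s ^ k \<le> e k \<and> e k \<le> A / s ^ k"
proof -
  define a where "a k = ln (e k)" for k
  define B where "B = ln A"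
  have up: "a (k + l) \<le> B + a k + a l" for k l
  proof -
    have "ln (e (k + l)) \<le> ln (A * e k * e l)" using upper pos A by simp
    then show ?thesis using pos [of k] pos [of l] A by (simp add: a_def B_def ln_mult)
  qed
  have lo: "a k + a l \<le> B + a (k + l)" for k l
  proof -
    have "ln (e k * e l) \<le> ln (A * e (k + l))" using lower pos A by simp
    then show ?thesis using pos [of k] pos [of l] pos [of "k + l"] A
      by (simp add: a_def B_def ln_mult)
  qed
  have mult: "a (Suc n * k) \<le> real (Suc n) * a k + real n * B \<and>
      real (Suc n) * a k - real n * B \<le> a (Suc n * k)" for n k
  proof (induction n)
    case (Suc n)
    have "a (Suc (Suc n) * k) \<le> B + a k + a (Suc n * k)"
      "a k + a (Suc n * k) \<le> B + a (Suc (Suc n) * k)"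
      using up [of k "Suc n * k"] lo [of k "Suc n * k"] by simp_all
    then show ?case using Suc by (simp add: algebra_simps)
  qed simp
  have B0: "0 \<le> B" using up [of 0 0] lo [of 0 0] by simp
  have cross: "(a k - B) / real k \<le> (a l + B) / real l" if "1 \<le> k" "1 \<le> l" for k l
  proof -
    define k' l' where "k' = k - 1" and "l' = l - 1"
    have kl: "k = Suc k'" "l = Suc l'" using that by (simp_all add: k'_def l'_def)
    have "real l * a k - real l' * B \<le> a (l * k)" "a (k * l) \<le> real k * a l + real k' * B"
      using mult [of l' k] mult [of k' l] kl by simp_all
    moreover have "real l' * B \<le> real l * B" "real k' * B \<le> real k * B"
      using B0 kl by (auto intro: mult_right_mono)
    ultimately have "real l * (a k - B) \<le> real k * (a l + B)"
      by (simp add: mult.commute [of l k] right_diff_distrib distrib_left)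
    then show ?thesis using that by (simp add: field_simps)
  qed
  define L where "L = (SUP k\<in>{1..}. (a k - B) / real k)"
  have bdd: "bdd_above ((\<lambda>k. (a k - B) / real k) ` {1..})"
    using cross [of _ 1] by (intro bdd_aboveI2 [where M = "(a 1 + B) / real 1"]) auto
  have L: "a k - B \<le> L * real k \<and> L * real k \<le> a k + B" for k
  proof (cases "k = 0")
    case True
    then show ?thesis using up [of 0 0] lo [of 0 0] by simp
  next
    case False
    then have k: "1 \<le> k" by simp
    have "(a k - B) / real k \<le> L" unfolding L_def by (rule cSUP_upper [OF _ bdd]) (use k in simp)
    moreover have "L \<le> (a k + B) / real k"
      unfolding L_def by (rule cSUP_least) (use cross k in auto)
    ultimately show ?thesis using k by (simp add: field_simps)
  qed
  have pow: "exp (- L) ^ k = exp (- (L * real k))" for k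
    by (simp add: exp_of_nat_mult [symmetric] mult.commute)
  have "(1 / A) / exp (- L) ^ k \<le> e k \<and> e k \<le> A / exp (- L) ^ k" for k
  proof -
    have "exp (L * real k) \<le> exp (a k + B)" "exp (a k) \<le> exp (L * real k + B)"
      using L [of k] by simp_all
    then have "exp (L * real k) \<le> e k * A" "e k \<le> exp (L * real k) * A"
      using pos [of k] A by (simp_all add: exp_add a_def B_def)
    then show ?thesis using A unfolding pow by (simp add: exp_minus field_simps)
  qed
  then show ?thesis by (intro exI [of _ "exp (- L)"]) simp
qed

context bounded_geometry
begin

lemma p_pos: "0 < p"
  using p_gt_1 by simp

text \<open>Otherwise the cells reachable from \<open>x\<close> and the other cells of the level would cover the connected
  space by two disjoint closed sets.\<close>

lemma Tn_connected:
  assumes "x \<in> Tn n" "y \<in> Tn n" shows "(x, y) \<in> (adj n (Tn n))\<^sup>*"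
proof (rule ccontr)
  assume notin: "(x, y) \<notin> (adj n (Tn n))\<^sup>*"
  define R where "R = {z \<in> Tn n. (x, z) \<in> (adj n (Tn n))\<^sup>*}"
  define A B where "A = (\<Union>z\<in>R. K z)" and "B = (\<Union>z\<in>Tn n - R. K z)"
  have closed: "closed A" "closed B"
    unfolding A_def B_def
    by (intro closed_UN; use Tn_finite [of n] K_compact in \<open>auto simp: R_def compact_imp_closed\<close>)+
  have un: "UNIV \<subseteq> A \<union> B"
  proof -
    have "UNIV = (\<Union>z\<in>Tn n. K z)" using K_desc [of \<phi> n] by (simp add: K_root desc_root)
    then show ?thesis by (auto simp: A_def B_def)
  qed
  have disj: "A \<inter> B \<inter> UNIV = {}"
  proof -
    have False if "z \<in> K a" "z \<in> K b" "a \<in> R" "b \<in> Tn n - R" for z a b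
    proof -
      have "(a, b) \<in> adj n (Tn n)" using that by (auto simp: adj_iff R_def)
      then have "b \<in> R" using that by (auto simp: R_def intro: rtrancl_into_rtrancl)
      then show False using that by simp
    qed
    then show ?thesis by (auto simp: A_def B_def)
  qed
  have "x \<in> R" "y \<in> Tn n - R" using assms notin by (auto simp: R_def)
  then have ne: "A \<inter> UNIV \<noteq> {}" "B \<inter> UNIV \<noteq> {}"
    using K_nonempty unfolding A_def B_def by blast+
  have "connected (UNIV :: 'a set)" using basic by (simp add: basic_framework_def)
  then show False using closed un disj ne unfolding connected_closed by blast
qed

lemma energy_transition_lower:
  "\<exists>c>0. \<forall>x\<in>Tn n. \<forall>y\<in>Tn n. \<forall>f. f x = 0 \<longrightarrow> f y = 1 \<longrightarrow> c \<le> energy n (Tn n) f"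
proof -
  define L where "L = card (adj n (Tn n))"
  \<comment> \<open>\<open>Suc L\<close> instead of \<open>L\<close> keeps \<open>c\<close> positive without a case distinction.\<close>
  define c where "c = 1 / (2 * real (Suc L) powr p)"
  have "c \<le> energy n (Tn n) f" if xy: "x \<in> Tn n" "y \<in> Tn n" "f x = 0" "f y = 1" for x y f
  proof -
    obtain i where i: "i \<le> L" "(x, y) \<in> adj n (Tn n) ^^ i"
      using Tn_connected [OF xy(1,2)] rtrancl_finite_eq_relpow [OF adj_finite [of n "Tn n"]]
      by (auto simp: L_def)
    have "\<bar>f x - f y\<bar> powr p \<le> real i powr p * (\<Sum>(s, t)\<in>adj n (Tn n). \<bar>f s - f t\<bar> powr p)"
      by (rule relpow_path_energy [OF i(2) p_pos adj_finite])
    then have "1 \<le> real i powr p * (2 * energy n (Tn n) f)"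
      using xy by (simp add: energy_adj)
    also have "\<dots> \<le> real (Suc L) powr p * (2 * energy n (Tn n) f)"
      using i p_pos by (intro mult_right_mono powr_mono2) (auto simp: energy_nonneg)
    finally show ?thesis by (simp add: c_def field_simps)
  qed
  moreover have "0 < c" by (simp add: c_def)
  ultimately show ?thesis by blast
qed

lemma card_Tn_ge: "2 ^ n \<le> card (Tn n)"
proof (induction n)
  case 0
  have "Tn 0 = {\<phi>}" by (auto simp: Tn_iff)
  then show ?case by simp
next
  case (Suc n)
  have "Tn (Suc n) = (\<Union>w\<in>Tn n. children w)"
    by (auto simp: Tn_iff children_iff level_parent_diff)
  then have "card (Tn (Suc n)) = (\<Sum>w\<in>Tn n. card (children w))"
    by (simp add: card_UN_disjoint Tn_finite children_finite children_iff disjoint_iff)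
  also have "\<dots> \<ge> (\<Sum>w\<in>Tn n. 2)"
    using basic by (intro sum_mono) (simp add: basic_framework_def framework1_def)
  finally show ?case using Suc by simp
qed

text \<open>The number of cells grows exponentially with the level, whereas the neighbourhoods of radius
  \<open>M\<close> have at most \<open>N ^ M\<close> elements.\<close>

lemma exists_far_cells: "\<exists>w v. v \<in> Tn (level w) - Gam M w \<and> 1 \<le> level w"
proof -
  define n where "n = N ^ M"
  have lt: "N ^ M < card (Tn n)" unfolding n_def by (rule less_le_trans [OF less_exp card_Tn_ge])
  then have "Tn n \<noteq> {}" by auto
  then obtain w where w: "w \<in> Tn n" by blast
  have "\<not> Tn n \<subseteq> Gam M w"
    using lt Gam_card [of M w] card_mono [OF Gam_finite [of M w], of "Tn n"] by fastforce
  then obtain v where "v \<in> Tn n - Gam M w" by blast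
  moreover have "1 \<le> n" using N_ge_1 by (simp add: n_def)
  ultimately show ?thesis using w by (intro exI [of _ w] exI [of _ v]) (simp add: Tn_iff)
qed

lemma desc_nonempty: "desc k w \<noteq> {}"
  using K_desc [of w k] K_nonempty [of w] by auto

text \<open>Competitors for the capacity of a cell relative to its \<open>M\<close>-neighbourhood.\<close>

definition separates :: "nat \<Rightarrow> nat \<Rightarrow> 'v \<Rightarrow> ('v \<Rightarrow> real) \<Rightarrow> bool" where
  "separates M k w f \<longleftrightarrow> (\<forall>x. level x = level w + k \<longrightarrow>
     ((parent ^^ k) x = w \<longrightarrow> f x = 0) \<and> ((parent ^^ k) x \<notin> Gam M w \<longrightarrow> f x = 1))"

lemma cap_separates:
  "cap (level w + k) (desc k w) (descs k (Tn (level w) - Gam M w)) A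
     = (INF f \<in> {f. separates M k w f}. ennreal (energy (level w + k) A f))"
proof -
  have "x \<in> descs k (Tn (level w) - Gam M w) \<longleftrightarrow>
      level x = level w + k \<and> (parent ^^ k) x \<notin> Gam M w" for x
    using descs_iff [of "Tn (level w) - Gam M w" "level w" x k]
    by (auto simp: Tn_iff level_funpow_parent)
  then have "{f. (\<forall>v\<in>desc k w. f v = 0) \<and> (\<forall>v\<in>descs k (Tn (level w) - Gam M w). f v = 1)}
      = {f. separates M k w f}"
    unfolding separates_def by (auto simp: desc_iff)
  then show ?thesis unfolding cap_def by (rule arg_cong)
qed

lemma cap_sup_le:
  assumes "\<And>w. \<exists>f. separates M k w f \<and> energy (level w + k) (Tn (level w + k)) f \<le> e"
  shows "cap_sup M k \<le> ennreal e"
  unfolding cap_sup_def cap_separates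
proof (rule SUP_least)
  fix w
  obtain f where "separates M k w f" "energy (level w + k) (Tn (level w + k)) f \<le> e"
    using assms by blast
  then show "(INF f \<in> {f. separates M k w f}. ennreal (energy (level w + k) (Tn (level w + k)) f))
      \<le> ennreal e"
    by (intro INF_lower2 [of f]) (auto intro: ennreal_leI)
qed

lemma less_ennreal_imp_pos: "x < ennreal e \<Longrightarrow> 0 < e"
  by (metis ennreal_neg gr_zeroI leI less_zeroE not_less_zero)

lemma separates_exists:
  assumes "cap_sup M k < ennreal e"
  shows "\<exists>f. separates M k w f \<and> (\<forall>x. 0 \<le> f x \<and> f x \<le> 1) \<and>
    energy (level w + k) (Tn (level w + k)) f \<le> e"
proof -
  have e: "0 < e" using assms by (rule less_ennreal_imp_pos)
  have "(INF f \<in> {f. separates M k w f}. ennreal (energy (level w + k) (Tn (level w + k)) f))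
      \<le> cap_sup M k"
    unfolding cap_sup_def cap_separates by (rule SUP_upper) simp
  then have "(INF f \<in> {f. separates M k w f}. ennreal (energy (level w + k) (Tn (level w + k)) f))
      < ennreal e"
    using assms by (rule order_le_less_trans)
  then obtain f where f: "separates M k w f"
    "ennreal (energy (level w + k) (Tn (level w + k)) f) < ennreal e"
    unfolding INF_less_iff by blast
  \<comment> \<open>Truncation does not increase the energy.\<close>
  define f' where "f' x = max 0 (min 1 (f x))" for x
  have "energy (level w + k) (Tn (level w + k)) f' \<le> energy (level w + k) (Tn (level w + k)) f"
    unfolding energy_adj
  proof (intro divide_right_mono sum_mono)
    fix z
    show "(case z of (u, v) \<Rightarrow> \<bar>f' u - f' v\<bar> powr p) \<le> (case z of (u, v) \<Rightarrow> \<bar>f u - f v\<bar> powr p)"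
      using p_pos by (cases z) (auto simp: f'_def intro!: powr_mono2)
  qed simp
  also have "\<dots> \<le> e" using f(2) e by (simp add: ennreal_less_iff energy_nonneg)
  finally show ?thesis
    using f(1) by (intro exI [of _ f']) (auto simp: f'_def separates_def)
qed

text \<open>The function that is 0 on the descendants of the cell and 1 elsewhere varies only on the edges at
  these descendants.\<close>

lemma cap_sup_finite: "cap_sup M k \<le> ennreal (real (D ^ k * N))"
proof (rule cap_sup_le)
  fix w
  define f :: "'v \<Rightarrow> real" where "f x = (if x \<in> desc k w then 0 else 1)" for x
  define n where "n = level w + k"
  define S where "S = (SIGMA u:desc k w. Gam 1 u)"
  have S: "finite S" "card S \<le> D ^ k * N"
  proof -
    show "finite S" using desc_finite Gam_finite by (auto simp: S_def)
    have "card S = (\<Sum>u\<in>desc k w. card (Gam 1 u))"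
      unfolding S_def by (rule card_SigmaI) (auto simp: desc_finite Gam_finite)
    also have "\<dots> \<le> (\<Sum>u\<in>desc k w. N)" by (intro sum_mono Gam_1_card)
    also have "\<dots> \<le> D ^ k * N" using desc_card [of k w] by simp
    finally show "card S \<le> D ^ k * N" .
  qed
  have "(\<Sum>(u, v)\<in>adj n (Tn n). \<bar>f u - f v\<bar> powr p)
      \<le> (\<Sum>z\<in>adj n (Tn n). indicator S z + indicator (prod.swap ` S) z)"
  proof (rule sum_mono)
    fix z assume z: "z \<in> adj n (Tn n)"
    obtain u v where uv: "z = (u, v)" by (cases z)
    have "\<bar>f u - f v\<bar> powr p = 0 \<or> z \<in> S" if "u \<in> desc k w"
      using that adj_1_Gam [of u v] z uv by (auto simp: S_def)
    moreover have "\<bar>f u - f v\<bar> powr p = 0 \<or> z \<in> prod.swap ` S" if "v \<in> desc k w"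
      using that adj_1_Gam [of v u] adj_sym [of u v] z uv by (force simp: S_def image_iff)
    moreover have "\<bar>f u - f v\<bar> powr p \<le> 1" by (simp add: f_def)
    moreover have "\<bar>f u - f v\<bar> powr p = 0" if "u \<notin> desc k w" "v \<notin> desc k w"
      using that by (simp add: f_def)
    ultimately show "(case z of (u, v) \<Rightarrow> \<bar>f u - f v\<bar> powr p)
        \<le> indicator S z + indicator (prod.swap ` S) z"
      using uv by (auto simp: indicator_def)
  qed
  also have "\<dots> = real (card (adj n (Tn n) \<inter> S)) + real (card (adj n (Tn n) \<inter> prod.swap ` S))"
    by (simp add: sum.distrib adj_finite sum.If_cases indicator_def of_bool_def)
  also have "\<dots> \<le> real (card S) + real (card (prod.swap ` S))"
    using S by (intro add_mono of_nat_mono card_mono) auto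
  also have "\<dots> = 2 * real (card S)"
    using card_image [OF inj_swap, of S] by (simp add: card_image inj_swap)
  finally have "energy n (Tn n) f \<le> real (card S)" by (simp add: energy_adj)
  also have "\<dots> \<le> real (D ^ k * N)" using S(2) by (rule of_nat_mono)
  finally have "energy n (Tn n) f \<le> real (D ^ k * N)" .
  moreover have "separates M k w f"
    using Gam_refl by (auto simp: separates_def f_def desc_iff)
  ultimately show "\<exists>f. separates M k w f \<and>
      energy (level w + k) (Tn (level w + k)) f \<le> real (D ^ k * N)"
    unfolding n_def by blast
qed

lemma cap_sup_pos: "0 < cap_sup M k"
proof -
  obtain w v where wv: "v \<in> Tn (level w) - Gam M w" using exists_far_cells by blast
  obtain c where c: "0 < c" "\<And>x y f. x \<in> Tn (level w + k) \<Longrightarrow> y \<in> Tn (level w + k) \<Longrightarrow>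
      f x = 0 \<Longrightarrow> f y = 1 \<Longrightarrow> c \<le> energy (level w + k) (Tn (level w + k)) f"
    using energy_transition_lower [of "level w + k"] by blast
  obtain x y where xy: "x \<in> desc k w" "y \<in> desc k v" using desc_nonempty by blast
  have "ennreal c
      \<le> (INF f \<in> {f. separates M k w f}. ennreal (energy (level w + k) (Tn (level w + k)) f))"
  proof (intro INF_greatest ennreal_leI)
    fix f assume "f \<in> {f. separates M k w f}"
    then have "f x = 0" "f y = 1" using xy wv by (auto simp: separates_def desc_iff Tn_iff)
    then show "c \<le> energy (level w + k) (Tn (level w + k)) f"
      using c(2) [of x y f] xy wv by (auto simp: desc_iff Tn_iff)
  qed
  also have "\<dots> \<le> cap_sup M k"
    unfolding cap_sup_def cap_separates by (rule SUP_upper) simp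
  finally show ?thesis using c(1) by (metis ennreal_less_zero_iff order_less_le_trans)
qed

text \<open>Averaging a competitor for the capacity over the descendants gives a function on the coarse
  level that still jumps from 0 to 1, so its energy is bounded below.\<close>

lemma sigma_cap_lower:
  assumes "covering_system \<J>"
  shows "\<exists>c>0. \<forall>k s e. 0 \<le> s \<longrightarrow> sigma_J \<J> k \<le> ennreal s \<longrightarrow> cap_sup M k < ennreal e \<longrightarrow> c \<le> s * e"
proof -
  obtain w v where wv: "v \<in> Tn (level w) - Gam M w" "1 \<le> level w"
    using exists_far_cells by blast
  define n where "n = level w"
  obtain c where c: "0 < c" "\<And>x y f. x \<in> Tn n \<Longrightarrow> y \<in> Tn n \<Longrightarrow>
      f x = 0 \<Longrightarrow> f y = 1 \<Longrightarrow> c \<le> energy n (Tn n) f"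
    using energy_transition_lower [of n] by blast
  obtain C where C: "0 < C" "\<And>n k s f. 1 \<le> n \<Longrightarrow> 0 \<le> s \<Longrightarrow> sigma_J \<J> k \<le> ennreal s \<Longrightarrow>
      energy n (Tn n) (avg_desc k f) \<le> C * s * energy (n + k) (Tn (n + k)) f"
    using covering_system_energy [OF assms] by blast
  have "c / C \<le> s * e"
    if s: "0 \<le> s" "sigma_J \<J> k \<le> ennreal s" and e: "cap_sup M k < ennreal e" for k s e
  proof -
    obtain f where f: "separates M k w f" "energy (n + k) (Tn (n + k)) f \<le> e"
      using separates_exists [OF e, of w] by (auto simp: n_def)
    have "avg_desc k f w = 0"
      using f(1) by (simp add: avg_desc_def separates_def desc_iff)
    moreover have "avg_desc k f v = 1"
    proof -
      have "f x = 1" if "x \<in> desc k v" for x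
        using that f(1) wv by (auto simp: separates_def desc_iff Tn_iff)
      then show ?thesis
        using measure_K_desc [of v k] measure_K_pos [of v] by (simp add: avg_desc_def)
    qed
    ultimately have "c \<le> energy n (Tn n) (avg_desc k f)"
      using c(2) [of w v] wv by (auto simp: n_def Tn_iff)
    also have "\<dots> \<le> C * s * energy (n + k) (Tn (n + k)) f"
      using C(2) wv s by (simp add: n_def)
    also have "\<dots> \<le> C * s * e" using f(2) C(1) s(1) by (intro mult_left_mono) auto
    finally show ?thesis using C(1) by (simp add: field_simps)
  qed
  then show ?thesis using c(1) C(1) by (intro exI [of _ "c / C"]) simp
qed

lemma energy_Min:
  assumes "finite I" "I \<noteq> {}"
  shows "energy n A (\<lambda>x. Min ((\<lambda>i. f i x) ` I)) \<le> (\<Sum>i\<in>I. energy n A (f i))"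
proof -
  have "\<bar>Min ((\<lambda>i. f i u) ` I) - Min ((\<lambda>i. f i v) ` I)\<bar> powr p
      \<le> (\<Sum>i\<in>I. \<bar>f i u - f i v\<bar> powr p)" for u v
  proof -
    obtain j where j: "j \<in> I"
      "\<bar>Min ((\<lambda>i. f i u) ` I) - Min ((\<lambda>i. f i v) ` I)\<bar> \<le> \<bar>f j u - f j v\<bar>"
      using Min_diff_le [OF assms, of "\<lambda>i. f i u" "\<lambda>i. f i v"] by blast
    then have "\<bar>Min ((\<lambda>i. f i u) ` I) - Min ((\<lambda>i. f i v) ` I)\<bar> powr p \<le> \<bar>f j u - f j v\<bar> powr p"
      using p_pos by (intro powr_mono2) auto
    also have "\<dots> \<le> (\<Sum>i\<in>I. \<bar>f i u - f i v\<bar> powr p)"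
      using assms(1) j(1) by (intro member_le_sum) auto
    finally show ?thesis .
  qed
  then have "(\<Sum>(u, v)\<in>adj n A. \<bar>Min ((\<lambda>i. f i u) ` I) - Min ((\<lambda>i. f i v) ` I)\<bar> powr p)
      \<le> (\<Sum>(u, v)\<in>adj n A. \<Sum>i\<in>I. \<bar>f i u - f i v\<bar> powr p)"
    by (intro sum_mono) auto
  also have "\<dots> = (\<Sum>i\<in>I. \<Sum>(u, v)\<in>adj n A. \<bar>f i u - f i v\<bar> powr p)"
    unfolding split_def by (rule sum.swap)
  finally show ?thesis
    unfolding energy_adj sum_divide_distrib [symmetric] by (intro divide_right_mono) auto
qed

section \<open>Submultiplicativity of the capacities\<close>

text \<open>The minimum of the potentials of the cells in \<open>Gam Ms w\<close>. It vanishes on a whole neighbourhood of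
  the cell, so extending it to a finer level with a partition of unity of range \<open>Ms\<close> keeps it zero on
  the cell itself.\<close>

lemma separates_neighbourhood:
  assumes "cap_sup Ms k < ennreal a"
  shows "\<exists>f. (\<forall>x. 0 \<le> f x \<and> f x \<le> 1) \<and>
    (\<forall>x. level x = level w + k \<longrightarrow> (parent ^^ k) x \<in> Gam Ms w \<longrightarrow> f x = 0) \<and>
    (\<forall>x. level x = level w + k \<longrightarrow> (parent ^^ k) x \<notin> Gam (2 * Ms) w \<longrightarrow> f x = 1) \<and>
    energy (level w + k) (Tn (level w + k)) f \<le> real N ^ Ms * a"
proof -
  define n where "n = level w"
  obtain h where h: "\<And>u. separates Ms k u (h u)" "\<And>u x. 0 \<le> h u x \<and> h u x \<le> 1"
    "\<And>u. energy (level u + k) (Tn (level u + k)) (h u) \<le> a"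
    using separates_exists [OF assms] by metis
  define I where "I = Gam Ms w"
  have "w \<in> I" by (simp add: I_def)
  then have I: "finite I" "I \<noteq> {}" using Gam_finite by (auto simp del: Gam_refl simp: I_def)
  define f where "f x = Min ((\<lambda>u. h u x) ` I)" for x
  have range: "0 \<le> f x \<and> f x \<le> 1" for x
  proof -
    have "f x \<in> (\<lambda>u. h u x) ` I" unfolding f_def using I by (intro Min_in) auto
    then show ?thesis using h(2) by auto
  qed
  have f0: "f x = 0" if "level x = n + k" "(parent ^^ k) x \<in> Gam Ms w" for x
  proof -
    define u where "u = (parent ^^ k) x"
    have u: "u \<in> I" "level u = n"
      using that Gam_level by (auto simp: u_def I_def n_def)
    then have "h u x = 0" using h(1) [of u] that(1) by (auto simp: separates_def u_def)
    then have "f x \<le> 0" unfolding f_def using I u by (intro Min_le) force+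
    then show ?thesis using range [of x] by simp
  qed
  have f1: "f x = 1" if "level x = n + k" "(parent ^^ k) x \<notin> Gam (2 * Ms) w" for x
  proof -
    have "h u x = 1" if "u \<in> I" for u
    proof -
      have "(parent ^^ k) x \<notin> Gam Ms u"
        using Gam_trans [of "(parent ^^ k) x" Ms u Ms w] \<open>(parent ^^ k) x \<notin> _\<close> that
        by (auto simp: I_def mult_2)
      then show ?thesis
        using h(1) [of u] \<open>level x = n + k\<close> that Gam_level [of u Ms w]
        by (auto simp: separates_def n_def I_def)
    qed
    then have "(\<lambda>u. h u x) ` I = {1}" using I by auto
    then show ?thesis by (simp add: f_def)
  qed
  have "energy (n + k) (Tn (n + k)) f \<le> (\<Sum>u\<in>I. energy (n + k) (Tn (n + k)) (h u))"
    unfolding f_def [abs_def] by (rule energy_Min [OF I])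
  also have "\<dots> \<le> (\<Sum>u\<in>I. a)"
  proof (rule sum_mono)
    fix u assume "u \<in> I"
    then have "level u = n" using Gam_level by (simp add: I_def n_def)
    then show "energy (n + k) (Tn (n + k)) (h u) \<le> a" using h(3) [of u] by simp
  qed
  also have "\<dots> = real (card I) * a" by simp
  also have "\<dots> \<le> real N ^ Ms * a"
  proof (rule mult_right_mono)
    show "real (card I) \<le> real N ^ Ms"
      unfolding I_def using Gam_card [of Ms w] by (metis of_nat_le_iff of_nat_power)
    show "0 \<le> a" using h(3) [of w] energy_nonneg order_trans by blast
  qed
  finally show ?thesis using range f0 f1 unfolding n_def by blast
qed

text \<open>A function on a fine level is built from \<open>f\<close> on a coarse level with a partition of unity made
  from capacity potentials of the cells. Its variation over a fine edge is at most the local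
  oscillation of \<open>f\<close> times the local variation of the potentials, so its energy is at most
  a constant times the product of the energies of \<open>f\<close> and of the potentials.\<close>

lemma energy_extension:
  "\<exists>C>0. \<forall>q l b f. cap_sup Ms l < ennreal b \<longrightarrow> (\<forall>v. 0 \<le> f v) \<longrightarrow> (\<exists>F.
     (\<forall>x. 0 \<le> F x) \<and>
     (\<forall>x c. level x = q + l \<longrightarrow> (\<forall>v\<in>Gam Ms ((parent ^^ l) x). f v = c) \<longrightarrow> F x = c) \<and>
     energy (q + l) (Tn (q + l)) F \<le> C * b * energy q (Tn q) f)"
proof -
  define C1 where "C1 = (2 * (real (Suc Ms) * real N ^ Suc Ms)) powr p"
  define C2 where "C2 = real N ^ (2 * Suc Ms)"
  have N0: "0 < real N" using N_ge_1 by simp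
  have C0: "0 < C1 * C2 * 2" using N0 by (simp add: C1_def C2_def)
  have main: "\<exists>F. (\<forall>x. 0 \<le> F x) \<and>
     (\<forall>x c. level x = q + l \<longrightarrow> (\<forall>v\<in>Gam Ms ((parent ^^ l) x). f v = c) \<longrightarrow> F x = c) \<and>
     energy (q + l) (Tn (q + l)) F \<le> C1 * C2 * 2 * b * energy q (Tn q) f"
    if cap: "cap_sup Ms l < ennreal b" and f0: "\<forall>v. 0 \<le> f v" for q l b and f :: "'v \<Rightarrow> real"
  proof -
    obtain h where h: "\<And>u. separates Ms l u (h u)" "\<And>u x. 0 \<le> h u x \<and> h u x \<le> 1"
      "\<And>u. energy (level u + l) (Tn (level u + l)) (h u) \<le> b"
      using separates_exists [OF cap] by metis
    define V where "V = Tn q"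
    define \<psi> where "\<psi> v x = 1 - h v x" for v x
    define \<Phi> where "\<Phi> x = (\<Sum>v\<in>V. \<psi> v x)" for x
    define F where "F x = (\<Sum>v\<in>V. f v * \<psi> v x) / \<Phi> x" for x
    have V: "finite V" by (simp add: V_def Tn_finite)
    have \<psi>0: "0 \<le> \<psi> v x" for v x using h(2) by (simp add: \<psi>_def)
    have \<psi>_supp: "v \<in> Gam Ms ((parent ^^ l) x)"
      if "\<psi> v x \<noteq> 0" "v \<in> V" "level x = q + l" for v x
    proof -
      have "level v = q" using that by (simp add: V_def Tn_iff)
      then have "(parent ^^ l) x \<in> Gam Ms v"
        using that h(1) [of v] by (auto simp: separates_def \<psi>_def)
      then show ?thesis using Gam_sym by blast
    qed
    have \<Phi>1: "1 \<le> \<Phi> x" if "level x = q + l" for x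
    proof -
      define a where "a = (parent ^^ l) x"
      have a: "a \<in> V" "level a = q" using that by (auto simp: a_def V_def Tn_iff level_funpow_parent)
      then have "\<psi> a x = 1" using h(1) [of a] that by (auto simp: separates_def \<psi>_def a_def)
      moreover have "\<psi> a x \<le> \<Phi> x" unfolding \<Phi>_def using a V \<psi>0 by (intro member_le_sum) auto
      ultimately show ?thesis by simp
    qed
    have F0: "0 \<le> F x" for x
      unfolding F_def \<Phi>_def using f0 \<psi>0
      by (intro divide_nonneg_nonneg sum_nonneg mult_nonneg_nonneg) auto
    have Fc: "F x = c" if x: "level x = q + l" and c: "\<forall>v\<in>Gam Ms ((parent ^^ l) x). f v = c" for x c
    proof -
      have "(\<Sum>v\<in>V. f v * \<psi> v x) = (\<Sum>v\<in>V. c * \<psi> v x)"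
      proof (rule sum.cong [OF refl])
        fix v assume "v \<in> V"
        then show "f v * \<psi> v x = c * \<psi> v x" using \<psi>_supp [of v x] x c by (cases "\<psi> v x = 0") auto
      qed
      also have "\<dots> = c * \<Phi> x" by (simp add: \<Phi>_def sum_distrib_left)
      finally show ?thesis using \<Phi>1 [OF x] by (simp add: F_def)
    qed
    define G where "G a = Gam (Suc Ms) a" for a
    define Z where "Z = adj q (Tn q)"
    define X where "X = adj (q + l) (Tn (q + l))"
    define e where "e = (\<lambda>(s, t). \<bar>f s - f t\<bar> powr p)"
    define d where "d v = (\<lambda>(x, y). \<bar>\<psi> v x - \<psi> v y\<bar> powr p)" for v
    have e0: "0 \<le> e z" for z by (auto simp: e_def split: prod.split)
    have d0: "0 \<le> d v z" for v z by (auto simp: d_def split: prod.split)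
    have Gfin: "finite (G a)" for a by (simp add: G_def Gam_finite)
    have Gcard: "real (card (G a)) \<le> real N ^ Suc Ms" for a
      unfolding G_def using Gam_card [of "Suc Ms" a] by (metis of_nat_le_iff of_nat_power)
    define par where "par z = (parent ^^ l) (fst z)" for z :: "'v \<times> 'v"
    have edge: "\<bar>F x - F y\<bar> powr p \<le> C1 * (sum e {z \<in> Z. fst z \<in> G a} * (\<Sum>v\<in>G a. d v (x, y)))"
      if xy: "(x, y) \<in> X" and a: "a = par (x, y)" for x y a
    proof -
      have lev: "level x = q + l" "level y = q + l" using xy by (auto simp: X_def adj_iff Tn_iff)
      have la: "level a = q" using lev a by (simp add: par_def level_funpow_parent)
      have GV: "G a \<subseteq> V" using la Gam_level by (auto simp: G_def V_def Tn_iff)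
      have "y \<in> Gam 1 x" using xy unfolding X_def by (rule adj_1_Gam)
      then have b: "(parent ^^ l) y \<in> Gam 1 a" using a funpow_parent_Gam by (simp add: par_def)
      have supp: "\<psi> v x = 0 \<and> \<psi> v y = 0" if "v \<in> V - G a" for v
      proof -
        have "v \<notin> Gam Ms a" using that Gam_mono [of Ms "Suc Ms" a] by (auto simp: G_def)
        moreover have "v \<notin> Gam Ms ((parent ^^ l) y)"
          using that Gam_trans [OF _ b, of v Ms] by (auto simp: G_def)
        ultimately show ?thesis
          using \<psi>_supp [of v x] \<psi>_supp [of v y] lev that a by (auto simp: par_def)
      qed
      have \<Phi>G: "\<Phi> z = (\<Sum>v\<in>G a. \<psi> v z)" "F z = (\<Sum>v\<in>G a. f v * \<psi> v z) / \<Phi> z"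
        if "z = x \<or> z = y" for z
        unfolding F_def \<Phi>_def using that supp V GV by (auto intro!: sum.mono_neutral_right)
      define \<Delta> where "\<Delta> = (real (Suc Ms) powr p * sum e {z \<in> Z. fst z \<in> G a}) powr (1 / p)"
      have \<Delta>0: "0 \<le> \<Delta>" by (simp add: \<Delta>_def)
      have osc: "\<bar>f v - f a\<bar> \<le> \<Delta>" if v: "v \<in> G a" for v
      proof -
        obtain i where i: "i \<le> Suc Ms" "(a, v) \<in> adj q (Tn q) ^^ i"
          using v by (auto simp: G_def Gam_iff la)
        have "\<bar>f a - f v\<bar> powr p \<le> real i powr p * (\<Sum>(s, t)\<in>{z \<in> Z. fst z \<in> G a}. \<bar>f s - f t\<bar> powr p)"
        proof (rule relpow_path_energy [OF i(2) p_pos])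
          show "finite {z \<in> Z. fst z \<in> G a}" by (simp add: Z_def adj_finite)
          fix s t j assume j: "j < i" "(a, s) \<in> adj q (Tn q) ^^ j" "(s, t) \<in> adj q (Tn q)"
          then have "s \<in> G a"
            unfolding G_def using i(1) la by (intro adj_Gam [OF j(2)]) (auto simp: Tn_iff)
          then show "(s, t) \<in> {z \<in> Z. fst z \<in> G a}" using j by (simp add: Z_def)
        qed
        also have "\<dots> = real i powr p * sum e {z \<in> Z. fst z \<in> G a}" by (simp add: e_def)
        also have "\<dots> \<le> real (Suc Ms) powr p * sum e {z \<in> Z. fst z \<in> G a}"
          using i(1) p_pos e0 by (intro mult_right_mono powr_mono2 sum_nonneg) auto
        finally have "(\<bar>f a - f v\<bar> powr p) powr (1 / p) \<le> \<Delta>"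
          unfolding \<Delta>_def using p_pos by (intro powr_mono2) auto
        then show ?thesis using p_pos by (simp add: powr_powr abs_minus_commute)
      qed
      define \<delta> where "\<delta> = (\<Sum>v\<in>G a. \<bar>\<psi> v x - \<psi> v y\<bar>)"
      have \<delta>0: "0 \<le> \<delta>" unfolding \<delta>_def by (rule sum_nonneg) simp
      have pos: "1 \<le> \<Phi> x" "1 \<le> \<Phi> y" using \<Phi>1 lev by auto
      \<comment> \<open>The weights \<open>\<psi> v z / \<Phi> z\<close> sum to one, so constants may be subtracted from \<open>f\<close>.\<close>
      have centred: "F z - f a = (\<Sum>v\<in>G a. (f v - f a) * (\<psi> v z / \<Phi> z))" if "z = x \<or> z = y" for z
      proof -
        have "\<Phi> z \<noteq> 0" using that pos by auto
        have "(\<Sum>v\<in>G a. (f v - f a) * (\<psi> v z / \<Phi> z))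
            = ((\<Sum>v\<in>G a. f v * \<psi> v z) - f a * (\<Sum>v\<in>G a. \<psi> v z)) / \<Phi> z"
          by (simp add: sum_divide_distrib sum_distrib_left sum_subtractf diff_divide_distrib
              left_diff_distrib)
        also have "\<dots> = F z - f a"
          using \<Phi>G [OF that] \<open>\<Phi> z \<noteq> 0\<close> by (simp add: diff_divide_distrib)
        finally show ?thesis ..
      qed
      have "F x - F y = (F x - f a) - (F y - f a)" by simp
      also have "\<dots> = (\<Sum>v\<in>G a. (f v - f a) * (\<psi> v x / \<Phi> x - \<psi> v y / \<Phi> y))"
        by (simp add: centred sum_subtractf right_diff_distrib)
      finally have "\<bar>F x - F y\<bar> \<le> (\<Sum>v\<in>G a. \<bar>(f v - f a) * (\<psi> v x / \<Phi> x - \<psi> v y / \<Phi> y)\<bar>)"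
        by (simp add: sum_abs)
      also have "\<dots> \<le> (\<Sum>v\<in>G a. \<Delta> * (\<bar>\<psi> v x - \<psi> v y\<bar> + \<psi> v y / \<Phi> y * \<delta>))"
      proof (rule sum_mono)
        fix v assume v: "v \<in> G a"
        have "\<bar>\<Phi> x - \<Phi> y\<bar> \<le> \<delta>"
          unfolding \<delta>_def by (simp add: \<Phi>G(1) sum_subtractf [symmetric] sum_abs)
        moreover have "\<psi> v x / \<Phi> x - \<psi> v y / \<Phi> y
            = (\<psi> v x - \<psi> v y) / \<Phi> x + \<psi> v y / \<Phi> y * ((\<Phi> y - \<Phi> x) / \<Phi> x)"
          using pos by (simp add: field_simps)
        moreover have "\<bar>(\<psi> v x - \<psi> v y) / \<Phi> x\<bar> \<le> \<bar>\<psi> v x - \<psi> v y\<bar>"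
          using pos mult_left_mono [of 1 "\<Phi> x" "\<bar>\<psi> v x - \<psi> v y\<bar>"] by (simp add: abs_divide divide_le_eq)
        moreover have "\<bar>(\<Phi> y - \<Phi> x) / \<Phi> x\<bar> \<le> \<bar>\<Phi> x - \<Phi> y\<bar>"
          using pos mult_left_mono [of 1 "\<Phi> x" "\<bar>\<Phi> x - \<Phi> y\<bar>"]
          by (simp add: abs_divide divide_le_eq abs_minus_commute)
        moreover have r: "0 \<le> \<psi> v y / \<Phi> y" using \<psi>0 pos by simp
        ultimately have "\<bar>\<psi> v x / \<Phi> x - \<psi> v y / \<Phi> y\<bar>
            \<le> \<bar>\<psi> v x - \<psi> v y\<bar> + \<bar>\<psi> v y / \<Phi> y * ((\<Phi> y - \<Phi> x) / \<Phi> x)\<bar>"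
          "\<bar>(\<Phi> y - \<Phi> x) / \<Phi> x\<bar> \<le> \<delta>" by linarith+
        moreover have "\<bar>\<psi> v y / \<Phi> y * ((\<Phi> y - \<Phi> x) / \<Phi> x)\<bar> \<le> \<psi> v y / \<Phi> y * \<delta>"
          unfolding abs_mult using r \<open>\<bar>(\<Phi> y - \<Phi> x) / \<Phi> x\<bar> \<le> \<delta>\<close> by (intro mult_mono) auto
        ultimately have "\<bar>\<psi> v x / \<Phi> x - \<psi> v y / \<Phi> y\<bar> \<le> \<bar>\<psi> v x - \<psi> v y\<bar> + \<psi> v y / \<Phi> y * \<delta>"
          by linarith
        then show "\<bar>(f v - f a) * (\<psi> v x / \<Phi> x - \<psi> v y / \<Phi> y)\<bar>
            \<le> \<Delta> * (\<bar>\<psi> v x - \<psi> v y\<bar> + \<psi> v y / \<Phi> y * \<delta>)"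
          unfolding abs_mult using osc [OF v] \<Delta>0 by (intro mult_mono) auto
      qed
      also have "\<dots> = \<Delta> * (\<delta> + (\<Sum>v\<in>G a. \<psi> v y) / \<Phi> y * \<delta>)"
        by (simp add: sum_distrib_left [symmetric] sum.distrib \<delta>_def sum_distrib_right [symmetric]
            sum_divide_distrib [symmetric])
      also have "\<dots> = 2 * \<Delta> * \<delta>" using pos \<Phi>G(1) [of y] by simp
      finally have "\<bar>F x - F y\<bar> powr p \<le> (2 * \<Delta> * \<delta>) powr p" using p_pos by (intro powr_mono2) auto
      also have "\<dots> = 2 powr p * (\<Delta> powr p * \<delta> powr p)"
        using \<Delta>0 \<delta>0 by (simp add: powr_mult)
      also have "\<Delta> powr p = real (Suc Ms) powr p * sum e {z \<in> Z. fst z \<in> G a}"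
        unfolding \<Delta>_def using p_pos e0 by (simp add: powr_powr sum_nonneg)
      also have "2 powr p * (real (Suc Ms) powr p * sum e {z \<in> Z. fst z \<in> G a} * \<delta> powr p)
          \<le> 2 powr p * (real (Suc Ms) powr p * sum e {z \<in> Z. fst z \<in> G a} *
            ((real N ^ Suc Ms) powr p * (\<Sum>v\<in>G a. d v (x, y))))"
      proof (intro mult_left_mono)
        have "\<delta> powr p \<le> real (card (G a)) powr p * (\<Sum>v\<in>G a. \<bar>\<psi> v x - \<psi> v y\<bar> powr p)"
          unfolding \<delta>_def by (rule powr_sum_le) (auto simp: Gfin p_pos)
        also have "\<dots> = real (card (G a)) powr p * (\<Sum>v\<in>G a. d v (x, y))" by (simp add: d_def)
        also have "\<dots> \<le> (real N ^ Suc Ms) powr p * (\<Sum>v\<in>G a. d v (x, y))"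
          using Gcard p_pos d0 by (intro mult_right_mono powr_mono2 sum_nonneg) auto
        finally show "\<delta> powr p \<le> (real N ^ Suc Ms) powr p * (\<Sum>v\<in>G a. d v (x, y))" .
      qed (auto intro!: mult_nonneg_nonneg sum_nonneg e0)
      also have "\<dots> = C1 * (sum e {z \<in> Z. fst z \<in> G a} * (\<Sum>v\<in>G a. d v (x, y)))"
        using N0 by (simp add: C1_def powr_mult mult_ac)
      finally show ?thesis .
    qed
    have Zfin: "finite Z" by (simp add: Z_def adj_finite)
    \<comment> \<open>A coarse edge is within the range of boundedly many potentials only.\<close>
    have each: "(\<Sum>x\<in>X. if fst z \<in> G (par x) then \<Sum>v\<in>G (par x). d v x else 0) \<le> C2 * (2 * b)"
      if "z \<in> Z" for z
    proof -
      define J where "J = Gam (Suc Ms + Suc Ms) (fst z)"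
      have J: "finite J" by (simp add: J_def Gam_finite)
      have "(\<Sum>x\<in>X. if fst z \<in> G (par x) then \<Sum>v\<in>G (par x). d v x else 0) \<le> (\<Sum>x\<in>X. \<Sum>v\<in>J. d v x)"
      proof (rule sum_mono)
        fix x
        have "(\<Sum>v\<in>G (par x). d v x) \<le> (\<Sum>v\<in>J. d v x)" if "fst z \<in> G (par x)"
        proof (rule sum_mono2 [OF J])
          show "G (par x) \<subseteq> J"
          proof
            fix v assume "v \<in> G (par x)"
            moreover have "par x \<in> Gam (Suc Ms) (fst z)" using that Gam_sym by (auto simp: G_def)
            ultimately show "v \<in> J" unfolding G_def J_def by (rule Gam_trans)
          qed
        qed (rule d0)
        then show "(if fst z \<in> G (par x) then \<Sum>v\<in>G (par x). d v x else 0) \<le> (\<Sum>v\<in>J. d v x)"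
          using sum_nonneg [of J "\<lambda>v. d v x"] d0 by auto
      qed
      also have "\<dots> = (\<Sum>v\<in>J. \<Sum>x\<in>X. d v x)" by (rule sum.swap)
      also have "\<dots> \<le> (\<Sum>v\<in>J. 2 * b)"
      proof (rule sum_mono)
        fix v assume "v \<in> J"
        then have "level v = q" using Gam_level [of v _ "fst z"] that
          by (auto simp: J_def Z_def adj_def Estar_on_def Estar_def Tn_iff doubleton_eq_iff)
        then have "energy (q + l) (Tn (q + l)) (h v) \<le> b" using h(3) [of v] by simp
        moreover have "(\<Sum>x\<in>X. d v x) = 2 * energy (q + l) (Tn (q + l)) (h v)"
          unfolding energy_adj X_def d_def \<psi>_def
          by (auto intro!: sum.cong simp: abs_minus_commute)
        ultimately show "(\<Sum>x\<in>X. d v x) \<le> 2 * b" by simp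
      qed
      also have "\<dots> = real (card J) * (2 * b)" by simp
      also have "\<dots> \<le> C2 * (2 * b)"
      proof (rule mult_right_mono)
        have "card J \<le> N ^ (2 * Suc Ms)"
          using Gam_card [of "Suc Ms + Suc Ms" "fst z"] by (simp add: J_def mult_2)
        then show "real (card J) \<le> C2" unfolding C2_def by (metis of_nat_le_iff of_nat_power)
        show "0 \<le> 2 * b" using h(3) [of \<phi>] energy_nonneg [of "level \<phi> + l" "Tn (level \<phi> + l)" "h \<phi>"]
          by linarith
      qed
      finally show ?thesis .
    qed
    have "(\<Sum>(x, y)\<in>X. \<bar>F x - F y\<bar> powr p)
        \<le> (\<Sum>x\<in>X. C1 * (sum e {z \<in> Z. fst z \<in> G (par x)} * (\<Sum>v\<in>G (par x). d v x)))"
      by (intro sum_mono) (use edge in auto)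
    also have "\<dots> = C1 * (\<Sum>x\<in>X. \<Sum>z\<in>Z. e z *
        (if fst z \<in> G (par x) then \<Sum>v\<in>G (par x). d v x else 0))"
    proof -
      have *: "sum e {z \<in> Z. fst z \<in> G a} * W = (\<Sum>z\<in>Z. e z * (if fst z \<in> G a then W else 0))" for a W
      proof -
        have "sum e {z \<in> Z. fst z \<in> G a} = (\<Sum>z\<in>Z. if fst z \<in> G a then e z else 0)"
          using Zfin by (simp add: sum.If_cases Int_def)
        then show ?thesis by (auto simp: sum_distrib_right intro!: sum.cong)
      qed
      show ?thesis unfolding * by (rule sum_distrib_left [symmetric])
    qed
    also have "(\<Sum>x\<in>X. \<Sum>z\<in>Z. e z * (if fst z \<in> G (par x) then \<Sum>v\<in>G (par x). d v x else 0))
        = (\<Sum>z\<in>Z. e z * (\<Sum>x\<in>X. if fst z \<in> G (par x) then \<Sum>v\<in>G (par x). d v x else 0))"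
      by (subst sum.swap) (simp add: sum_distrib_left)
    also have "C1 * \<dots> \<le> C1 * (\<Sum>z\<in>Z. e z * (C2 * (2 * b)))"
      by (intro mult_left_mono sum_mono each e0) (simp_all add: C1_def)
    also have "\<dots> = C1 * (sum e Z * (C2 * (2 * b)))" by (simp only: sum_distrib_right)
    also have "\<dots> = C1 * C2 * 2 * b * sum e Z" by (simp add: mult_ac)
    finally have "energy (q + l) (Tn (q + l)) F \<le> C1 * C2 * 2 * b * energy q (Tn q) f"
      by (simp add: energy_adj X_def Z_def e_def)
    then show ?thesis using F0 Fc by blast
  qed
  show ?thesis by (rule exI [of _ "C1 * C2 * 2"]) (use C0 main in blast)
qed

text \<open>The extension of a potential of the \<open>2 * Ms\<close>-neighbourhood separates a cell only from the
  complement of its \<open>3 * Ms\<close>-neighbourhood. Taking the minimum of such functions over the descendants of a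
  cell \<open>2 * Ms\<close> levels further down compensates for the larger radius.\<close>

lemma cap_sup_submultiplicative:
  "\<exists>C>0. \<forall>k l a b. cap_sup Ms k < ennreal a \<longrightarrow> cap_sup Ms l < ennreal b \<longrightarrow>
     cap_sup Ms (k + l + 2 * Ms) \<le> ennreal (C * a * b)"
proof -
  obtain C where C: "0 < C" and ext: "\<And>q l b f. cap_sup Ms l < ennreal b \<Longrightarrow> (\<forall>v. 0 \<le> f v) \<Longrightarrow>
     (\<exists>F. (\<forall>x. 0 \<le> F x) \<and>
     (\<forall>x c. level x = q + l \<longrightarrow> (\<forall>v\<in>Gam Ms ((parent ^^ l) x). f v = c) \<longrightarrow> F x = c) \<and>
     energy (q + l) (Tn (q + l)) F \<le> C * b * energy q (Tn q) f)"
    using energy_extension by blast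
  define j where "j = 2 * Ms"
  define C' where "C' = real (D ^ j) * C * real N ^ Ms"
  have "cap_sup Ms (k + l + j) \<le> ennreal (C' * a * b)"
    if a: "cap_sup Ms k < ennreal a" and b: "cap_sup Ms l < ennreal b" for k l a b
  proof (rule cap_sup_le)
    fix w
    have b0: "0 \<le> b" using b by (simp add: less_ennreal_imp_pos less_imp_le)
    have a0: "0 \<le> a" using a by (simp add: less_ennreal_imp_pos less_imp_le)
    have "\<exists>F. (\<forall>x. 0 \<le> F x) \<and>
       (\<forall>x. level x = level v + (k + l) \<longrightarrow> (parent ^^ (k + l)) x = v \<longrightarrow> F x = 0) \<and>
       (\<forall>x. level x = level v + (k + l) \<longrightarrow> (parent ^^ (k + l)) x \<notin> Gam (Ms + j) v \<longrightarrow> F x = 1) \<and>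
       energy (level v + (k + l)) (Tn (level v + (k + l))) F \<le> C * b * (real N ^ Ms * a)" for v
    proof -
      define q where "q = level v + k"
      obtain f where f: "\<forall>x. 0 \<le> f x"
        "\<And>x. level x = q \<Longrightarrow> (parent ^^ k) x \<in> Gam Ms v \<Longrightarrow> f x = 0"
        "\<And>x. level x = q \<Longrightarrow> (parent ^^ k) x \<notin> Gam (2 * Ms) v \<Longrightarrow> f x = 1"
        "energy q (Tn q) f \<le> real N ^ Ms * a"
        using separates_neighbourhood [OF a, of v] unfolding q_def by blast
      obtain F where F: "\<forall>x. 0 \<le> F x"
        "\<And>x c. level x = q + l \<Longrightarrow> (\<forall>u\<in>Gam Ms ((parent ^^ l) x). f u = c) \<Longrightarrow> F x = c"
        "energy (q + l) (Tn (q + l)) F \<le> C * b * energy q (Tn q) f"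
        using ext [OF b f(1)] by blast
      have par: "(parent ^^ (k + l)) x = (parent ^^ k) ((parent ^^ l) x)" for x
        by (simp add: funpow_add)
      have near: "level u = q \<and> (parent ^^ k) u \<in> Gam Ms ((parent ^^ (k + l)) x)"
        if "level x = q + l" "u \<in> Gam Ms ((parent ^^ l) x)" for x u
        using that Gam_level [OF that(2)] funpow_parent_Gam [OF that(2), of k]
        by (simp add: par level_funpow_parent)
      have "F x = 0" if x: "level x = q + l" "(parent ^^ (k + l)) x = v" for x
        by (rule F(2) [OF x(1)]) (use near [OF x(1)] f(2) x(2) in auto)
      moreover have "F x = 1" if x: "level x = q + l" "(parent ^^ (k + l)) x \<notin> Gam (Ms + j) v" for x
      proof (rule F(2) [OF x(1)], rule ballI)
        fix u assume u: "u \<in> Gam Ms ((parent ^^ l) x)"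
        have "(parent ^^ (k + l)) x \<in> Gam Ms ((parent ^^ k) u)" using near [OF x(1) u] Gam_sym by blast
        then have "(parent ^^ k) u \<notin> Gam (2 * Ms) v"
          using x(2) Gam_trans [of "(parent ^^ (k + l)) x" Ms "(parent ^^ k) u" "2 * Ms" v]
          by (auto simp: j_def add.commute)
        then show "f u = 1" using f(3) near [OF x(1) u] by blast
      qed
      moreover have "energy (q + l) (Tn (q + l)) F \<le> C * b * (real N ^ Ms * a)"
        using F(3) f(4) C b0 by (meson mult_left_mono mult_nonneg_nonneg order_trans less_imp_le)
      ultimately show ?thesis using F(1) by (auto simp: q_def add.assoc)
    qed
    then obtain F where F: "\<And>v x. 0 \<le> F v x"
      "\<And>v x. level x = level v + (k + l) \<Longrightarrow> (parent ^^ (k + l)) x = v \<Longrightarrow> F v x = 0"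
      "\<And>v x. level x = level v + (k + l) \<Longrightarrow> (parent ^^ (k + l)) x \<notin> Gam (Ms + j) v \<Longrightarrow> F v x = 1"
      "\<And>v. energy (level v + (k + l)) (Tn (level v + (k + l))) (F v) \<le> C * b * (real N ^ Ms * a)"
      by metis
    define I where "I = desc j w"
    have I: "finite I" "I \<noteq> {}" by (simp_all add: I_def desc_finite desc_nonempty)
    have lev_I: "level v = level w + j" if "v \<in> I" for v using that by (simp add: I_def desc_iff)
    define n where "n = level w + (k + l + j)"
    define H where "H x = Min ((\<lambda>v. F v x) ` I)" for x
    have par: "(parent ^^ (k + l + j)) x = (parent ^^ j) ((parent ^^ (k + l)) x)" for x
      by (simp add: funpow_add add.commute [of "k + l"] del: add_is_0)
    have "separates Ms (k + l + j) w H"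
      unfolding separates_def
    proof (intro allI impI conjI)
      fix x assume x: "level x = level w + (k + l + j)" "(parent ^^ (k + l + j)) x = w"
      define v where "v = (parent ^^ (k + l)) x"
      have v: "v \<in> I" using x by (simp add: I_def desc_iff v_def level_funpow_parent par)
      have "F v x = 0" by (rule F(2)) (use x(1) lev_I [OF v] v_def in simp_all)
      then have "H x \<le> 0" unfolding H_def using I v by (intro Min_le) force+
      moreover have "H x \<in> (\<lambda>v. F v x) ` I" unfolding H_def using I by (intro Min_in) auto
      ultimately show "H x = 0" using F(1) by (auto intro: antisym)
    next
      fix x assume x: "level x = level w + (k + l + j)" "(parent ^^ (k + l + j)) x \<notin> Gam Ms w"
      have "F v x = 1" if v: "v \<in> I" for v
      proof (rule F(3))
        show "level x = level v + (k + l)" using x lev_I [OF v] by simp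
        show "(parent ^^ (k + l)) x \<notin> Gam (Ms + j) v"
        proof
          assume "(parent ^^ (k + l)) x \<in> Gam (Ms + j) v"
          then have "(parent ^^ j) ((parent ^^ (k + l)) x) \<in> Gam Ms ((parent ^^ j) v)"
            by (rule funpow_parent_Gam_shrink)
          then show False using x(2) v by (simp add: par I_def desc_iff)
        qed
      qed
      then have "(\<lambda>v. F v x) ` I = {1}" using I by auto
      then show "H x = 1" by (simp add: H_def)
    qed
    moreover have "energy n (Tn n) H \<le> C' * a * b"
    proof -
      have "energy n (Tn n) H \<le> (\<Sum>v\<in>I. energy n (Tn n) (F v))"
        unfolding H_def [abs_def] by (rule energy_Min [OF I])
      also have "\<dots> \<le> (\<Sum>v\<in>I. C * b * (real N ^ Ms * a))"
      proof (rule sum_mono)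
        fix v assume v: "v \<in> I"
        show "energy n (Tn n) (F v) \<le> C * b * (real N ^ Ms * a)"
          using F(4) [of v] lev_I [OF v] by (simp add: n_def add_ac)
      qed
      also have "\<dots> = real (card I) * (C * b * (real N ^ Ms * a))" by simp
      also have "\<dots> \<le> real (D ^ j) * (C * b * (real N ^ Ms * a))"
        using desc_card [of j w] C a0 b0 by (intro mult_right_mono of_nat_mono) (auto simp: I_def)
      finally show ?thesis by (simp add: C'_def mult_ac)
    qed
    ultimately show "\<exists>f. separates Ms (k + l + j) w f \<and>
        energy (level w + (k + l + j)) (Tn (level w + (k + l + j))) f \<le> C' * a * b"
      unfolding n_def by blast
  qed
  moreover have "0 < C'" using C N_ge_1 D_ge_1 by (simp add: C'_def)
  ultimately show ?thesis unfolding j_def by blast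
qed

end

section \<open>The scaling factor\<close>

lemma power_bounded_imp_le_1:
  fixes x :: real
  assumes "\<And>k. x ^ k \<le> C" shows "x \<le> 1"
proof (rule ccontr)
  assume "\<not> x \<le> 1"
  then obtain k where "C < x ^ k" using real_arch_pow [of x C] by auto
  then show False using assms [of k] by simp
qed

context bounded_geometry
begin

text \<open>Conductive homogeneity and the lower bound above say that conductances and capacities are
  reciprocal up to constants. Conductances are submultiplicative, so capacities are
  supermultiplicative; being submultiplicative as well (after the shift by \<open>2 * Ms\<close> levels is
  absorbed), they are comparable to a geometric sequence.\<close>

lemma sigma_p_bounds:
  assumes "conductively_homogeneous"
  shows "0 < sigma_p \<and> (\<exists>c1>0. \<exists>c2>0. \<exists>\<J>. covering_system \<J> \<and>
    (\<forall>k. ennreal (c1 / sigma_p ^ k) \<le> cap_sup Ms k \<and> cap_sup Ms k \<le> ennreal (c2 / sigma_p ^ k) \<and>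
         ennreal (c1 * sigma_p ^ k) \<le> sigma_J \<J> k \<and> sigma_J \<J> k \<le> ennreal (c2 * sigma_p ^ k)))"
proof -
  define good where "good s \<longleftrightarrow> 0 < s \<and> (\<exists>c1>0. \<exists>c2>0. \<exists>\<J>. covering_system \<J> \<and>
    (\<forall>k. ennreal (c1 / s ^ k) \<le> cap_sup Ms k \<and> cap_sup Ms k \<le> ennreal (c2 / s ^ k) \<and>
         ennreal (c1 * s ^ k) \<le> sigma_J \<J> k \<and> sigma_J \<J> k \<le> ennreal (c2 * s ^ k)))" for s
  \<comment> \<open>Two geometric sequences within a bounded factor of each other have the same ratio.\<close>
  have le: "t \<le> s" if s: "good s" and t: "good t" for s t
  proof -
    have s0: "0 < s" and t0: "0 < t" using s t by (simp_all add: good_def)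
    obtain c where c: "0 < c" "\<And>k. ennreal (c / s ^ k) \<le> cap_sup Ms k"
      using s unfolding good_def by blast
    obtain d where d: "0 < d" "\<And>k. cap_sup Ms k \<le> ennreal (d / t ^ k)"
      using t unfolding good_def by blast
    have "(t / s) ^ k \<le> d / c" for k
    proof -
      have "ennreal (c / s ^ k) \<le> ennreal (d / t ^ k)" using c(2) d(2) order_trans by blast
      then have "c / s ^ k \<le> d / t ^ k" using c d s0 t0 by simp
      then show ?thesis using c(1) s0 t0 by (simp add: field_simps power_divide)
    qed
    then have "t / s \<le> 1" by (rule power_bounded_imp_le_1)
    then show ?thesis using s0 by simp
  qed
  obtain \<J> where \<J>: "covering_system \<J>" and fin: "(SUP k. sigma_J \<J> k * cap_sup Ms k) < \<infinity>"
    using assms unfolding conductively_homogeneous_def by blast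
  define B where "B = enn2real (SUP k. sigma_J \<J> k * cap_sup Ms k)"
  have B: "sigma_J \<J> k * cap_sup Ms k \<le> ennreal B" for k
  proof -
    have "sigma_J \<J> k * cap_sup Ms k \<le> (SUP k. sigma_J \<J> k * cap_sup Ms k)"
      by (rule SUP_upper) simp
    then show ?thesis using fin by (simp add: B_def less_top)
  qed
  define e where "e k = enn2real (cap_sup Ms k)" for k
  have e: "cap_sup Ms k = ennreal (e k)" and e0: "0 < e k" for k
  proof -
    have "cap_sup Ms k < top" using cap_sup_finite [of Ms k] le_less_trans ennreal_less_top by blast
    then show "cap_sup Ms k = ennreal (e k)" "0 < e k"
      using cap_sup_pos [of Ms k] by (simp_all add: e_def enn2real_positive_iff)
  qed
  define s where "s k = enn2real (sigma_J \<J> k)" for k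
  have s: "sigma_J \<J> k = ennreal (s k)" for k
  proof -
    have "sigma_J \<J> k \<noteq> top"
    proof
      assume "sigma_J \<J> k = top"
      then have "sigma_J \<J> k * cap_sup Ms k = top"
        using cap_sup_pos [of Ms k] by (simp add: ennreal_top_mult)
      then show False using B [of k] by (simp add: top_unique)
    qed
    then show ?thesis by (simp add: s_def less_top)
  qed
  have s_nonneg: "0 \<le> s k" for k by (simp add: s_def)
  have B0: "0 \<le> B" by (simp add: B_def)
  have prod_upper: "s k * e k \<le> B" for k
    using B [of k] s_nonneg [of k] e0 [of k] B0 by (simp add: s e ennreal_mult [symmetric])
  obtain c where c: "0 < c" "\<And>k s e. 0 \<le> s \<Longrightarrow> sigma_J \<J> k \<le> ennreal s \<Longrightarrow>
      cap_sup Ms k < ennreal e \<Longrightarrow> c \<le> s * e"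
    using sigma_cap_lower [OF \<J>] by blast
  have lt: "cap_sup Ms k < ennreal (2 * e k)" for k
    using e0 [of k] by (simp add: e ennreal_less_iff)
  have prod_lower: "c \<le> 2 * (s k * e k)" for k
    using c(2) [OF s_nonneg _ lt, of k k] s by simp
  have s0: "0 < s k" for k
    using prod_lower [of k] c(1) s_nonneg [of k] by (cases "s k = 0") auto
  have Bpos: "0 < B" using prod_upper [of 0] s0 [of 0] e0 [of 0] by (meson less_le_trans mult_pos_pos)
  obtain C1 where C1: "0 < C1" "\<And>k l s t. 0 \<le> s \<Longrightarrow> 0 \<le> t \<Longrightarrow> sigma_J \<J> k \<le> ennreal s \<Longrightarrow>
      sigma_J \<J> l \<le> ennreal t \<Longrightarrow> sigma_J \<J> (k + l) \<le> ennreal (C1 * s * t)"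
    using sigma_J_submultiplicative [OF \<J>] by blast
  have s_sub: "s (k + l) \<le> C1 * s k * s l" for k l
    using C1(2) [OF s_nonneg s_nonneg, of k k l l] C1(1) s_nonneg by (simp add: s)
  obtain C2 where C2: "0 < C2" "\<And>k l a b. cap_sup Ms k < ennreal a \<Longrightarrow> cap_sup Ms l < ennreal b \<Longrightarrow>
      cap_sup Ms (k + l + 2 * Ms) \<le> ennreal (C2 * a * b)"
    using cap_sup_submultiplicative by blast
  have e_sub: "e (k + l + 2 * Ms) \<le> 4 * C2 * (e k * e l)" for k l
  proof -
    have "ennreal (e (k + l + 2 * Ms)) \<le> ennreal (C2 * (2 * e k) * (2 * e l))"
      using C2(2) [OF lt lt] by (simp add: e)
    then show ?thesis using C2(1) e0 [of k] e0 [of l] by (simp add: mult_ac)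
  qed
  \<comment> \<open>The constant of \<open>e k \<le> S * e (k + 2 * Ms)\<close>, which undoes the shift in \<open>e_sub\<close>.\<close>
  define S where "S = B * C1 * s (2 * Ms) * 2 / c"
  have shift: "e k \<le> S * e (k + 2 * Ms)" for k
  proof -
    have "c * e k \<le> 2 * (s (k + 2 * Ms) * e (k + 2 * Ms)) * e k"
      using prod_lower e0 [of k] by (intro mult_right_mono) auto
    also have "\<dots> \<le> 2 * (C1 * s k * s (2 * Ms) * e (k + 2 * Ms)) * e k"
      using s_sub [of k "2 * Ms"] e0 [of k] e0 [of "k + 2 * Ms"]
      by (intro mult_right_mono mult_left_mono) auto
    also have "\<dots> = 2 * (C1 * s (2 * Ms) * e (k + 2 * Ms)) * (s k * e k)" by (simp add: mult_ac)
    also have "\<dots> \<le> 2 * (C1 * s (2 * Ms) * e (k + 2 * Ms)) * B"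
      using prod_upper [of k] C1(1) s0 [of "2 * Ms"] e0 [of "k + 2 * Ms"] by (intro mult_left_mono) auto
    finally show ?thesis using c(1) by (simp add: S_def field_simps)
  qed
  have S0: "0 < S" using Bpos C1(1) s0 c(1) by (simp add: S_def)
  define A where "A = max (S * (4 * C2)) (B * B * C1 * 2 / c)"
  have A0: "0 < A" using S0 C2(1) by (simp add: A_def less_max_iff_disj)
  have upper: "e (k + l) \<le> A * e k * e l" for k l
  proof -
    have "e (k + l) \<le> S * e (k + l + 2 * Ms)" by (rule shift)
    also have "\<dots> \<le> S * (4 * C2 * (e k * e l))" using e_sub S0 by (intro mult_left_mono) auto
    also have "\<dots> = S * (4 * C2) * (e k * e l)" by (simp add: mult_ac)
    also have "\<dots> \<le> A * (e k * e l)"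
      using e0 [of k] e0 [of l] by (intro mult_right_mono) (auto simp: A_def)
    finally show ?thesis by (simp add: mult_ac)
  qed
  have lower: "e k * e l \<le> A * e (k + l)" for k l
  proof -
    have "c * (e k * e l) \<le> 2 * (s (k + l) * e (k + l)) * (e k * e l)"
      using prod_lower e0 [of k] e0 [of l] by (intro mult_right_mono) auto
    also have "\<dots> \<le> 2 * (C1 * s k * s l * e (k + l)) * (e k * e l)"
      using s_sub [of k l] e0 [of k] e0 [of l] e0 [of "k + l"]
      by (intro mult_right_mono mult_left_mono) auto
    also have "\<dots> = 2 * C1 * e (k + l) * ((s k * e k) * (s l * e l))" by (simp add: mult_ac)
    also have "\<dots> \<le> 2 * C1 * e (k + l) * (B * B)"
      using prod_upper C1(1) s0 e0 B0 by (intro mult_left_mono mult_mono) (auto simp: less_imp_le)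
    finally have "e k * e l \<le> B * B * C1 * 2 / c * e (k + l)"
      using c(1) by (simp add: field_simps)
    also have "\<dots> \<le> A * e (k + l)" using e0 [of "k + l"] by (intro mult_right_mono) (auto simp: A_def)
    finally show ?thesis .
  qed
  obtain t where t: "0 < t" "\<And>k. (1 / A) / t ^ k \<le> e k" "\<And>k. e k \<le> A / t ^ k"
    using quasi_multiplicative_exponential [of e A, OF e0 A0 upper lower] by blast
  have s_upper: "s k \<le> B * A * t ^ k" for k
  proof -
    have "s k * ((1 / A) / t ^ k) \<le> s k * e k" using t(2) s0 [of k] by (intro mult_left_mono) auto
    also have "\<dots> \<le> B" by (rule prod_upper)
    finally show ?thesis using A0 t(1) by (simp add: field_simps)
  qed
  have s_lower: "c / (2 * A) * t ^ k \<le> s k" for k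
  proof -
    have "c \<le> 2 * (s k * e k)" by (rule prod_lower)
    also have "\<dots> \<le> 2 * (s k * (A / t ^ k))" using t(3) s0 [of k] by (intro mult_left_mono) auto
    finally show ?thesis using A0 t(1) by (simp add: field_simps)
  qed
  define c1 c2 where "c1 = min (1 / A) (c / (2 * A))" and "c2 = max A (B * A)"
  have "good t"
    unfolding good_def
  proof (intro conjI exI allI)
    show "0 < t" by (rule t(1))
    show "0 < c1" "0 < c2" using A0 c(1) by (auto simp: c1_def c2_def less_max_iff_disj)
    show "covering_system \<J>" by (rule \<J>)
    fix k
    have "c1 / t ^ k \<le> (1 / A) / t ^ k" "A / t ^ k \<le> c2 / t ^ k"
      using t(1) by (intro divide_right_mono; simp add: c1_def c2_def)+
    then show "ennreal (c1 / t ^ k) \<le> cap_sup Ms k" "cap_sup Ms k \<le> ennreal (c2 / t ^ k)"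
      using t(2,3) [of k] unfolding e by (auto intro!: ennreal_leI)
    have "c1 * t ^ k \<le> c / (2 * A) * t ^ k" "B * A * t ^ k \<le> c2 * t ^ k"
      using t(1) by (intro mult_right_mono; simp add: c1_def c2_def)+
    then show "ennreal (c1 * t ^ k) \<le> sigma_J \<J> k" "sigma_J \<J> k \<le> ennreal (c2 * t ^ k)"
      using s_lower [of k] s_upper [of k] unfolding s by (auto intro!: ennreal_leI)
  qed
  then have "\<exists>!s. good s" using le by (blast intro: antisym)
  then have "good (THE s. good s)" by (rule theI')
  moreover have "(THE s. good s) = sigma_p" unfolding sigma_p_def good_def by simp
  ultimately show ?thesis unfolding good_def by simp
qed

end

section \<open>The Hausdorff dimension of an Ahlfors regular space\<close>

text \<open>\<open>cd\<close> and \<open>ci\<close> bound the diameters and the inner radii of the cells; \<open>ci \<le> 1\<close> keeps the radii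
  \<open>ci * rs ^ n\<close> below 2, the range of the Ahlfors estimate in a space of diameter one.\<close>

locale ahlfors_geometry = bounded_geometry ET \<phi> K m Ms rs p N D
  for ET :: "'v set set" and \<phi> :: 'v and K :: "'v \<Rightarrow> 'a::metric_space set"
    and m :: "'a measure" and Ms :: nat and rs p :: real and N D :: nat +
  fixes cd ci Q CA :: real
  assumes cd_pos: "0 < cd" and diameter_K: "diameter (K w) \<le> cd * rs ^ level w"
    and ci_pos: "0 < ci" and ci_le_1: "ci \<le> 1"
    and inner_ball: "1 \<le> level w \<Longrightarrow> \<exists>x. ball x (ci * rs ^ level w) \<subseteq> K w"
    and Q_pos: "0 < Q" and CA_ge_1: "1 \<le> CA"
    and ahlfors_lower: "0 < r \<Longrightarrow> r < 2 \<Longrightarrow> r powr Q / CA \<le> measure m (ball x r)"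
    and ahlfors_upper: "0 < r \<Longrightarrow> r < 2 \<Longrightarrow> measure m (ball x r) \<le> CA * r powr Q"
begin

lemma rs_pos: "0 < rs" and rs_less_1: "rs < 1"
  using basic by (simp_all add: basic_framework_def)

lemma rs_power_powr: "(rs ^ n) powr a = (rs powr a) ^ n"
  using rs_pos by (simp add: powr_realpow [symmetric] powr_powr mult.commute)

lemma rs_powr_less_1: "0 < a \<Longrightarrow> rs powr a < 1"
  using powr_less_mono2 [of a rs 1] rs_pos rs_less_1 by simp

lemma measure_mono_m: "A \<subseteq> B \<Longrightarrow> B \<in> sets borel \<Longrightarrow> measure m A \<le> measure m B"
  using finite_measure.finite_measure_mono [OF finite_m] by simp

lemma measure_K_lower:
  assumes "1 \<le> level w" shows "(ci * rs ^ level w) powr Q / CA \<le> measure m (K w)"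
proof -
  obtain x where x: "ball x (ci * rs ^ level w) \<subseteq> K w" using inner_ball [OF assms] by blast
  have "rs ^ level w \<le> 1" using rs_pos rs_less_1 by (intro power_le_one) auto
  then have "ci * rs ^ level w < 2"
    using ci_le_1 ci_pos mult_mono [of ci 1 "rs ^ level w" 1] rs_pos by auto
  moreover have "0 < ci * rs ^ level w" using ci_pos rs_pos by simp
  ultimately have "(ci * rs ^ level w) powr Q / CA \<le> measure m (ball x (ci * rs ^ level w))"
    by (intro ahlfors_lower)
  also have "\<dots> \<le> measure m (K w)" using x by (intro measure_mono_m) auto
  finally show ?thesis .
qed

lemma measure_singleton: "measure m {x} = 0"
proof -
  have "measure m {x} \<le> CA * (rs powr Q) ^ Suc n" for n
  proof -
    have r: "0 < rs ^ Suc n" "rs ^ Suc n < 2"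
      using rs_pos rs_less_1 power_le_one [of rs "Suc n"] by auto
    have "measure m {x} \<le> measure m (ball x (rs ^ Suc n))" using r(1) by (intro measure_mono_m) auto
    also have "\<dots> \<le> CA * (rs ^ Suc n) powr Q" using r by (rule ahlfors_upper)
    also have "(rs ^ Suc n) powr Q = (rs powr Q) ^ Suc n" by (rule rs_power_powr)
    finally show ?thesis .
  qed
  moreover have "(\<lambda>n. CA * (rs powr Q) ^ Suc n) \<longlonglongrightarrow> CA * 0"
  proof (intro tendsto_intros LIMSEQ_Suc LIMSEQ_power_zero)
    show "norm (rs powr Q) < 1" using rs_powr_less_1 [OF Q_pos] by simp
  qed
  ultimately have "measure m {x} \<le> CA * 0" by (intro LIMSEQ_le_const) auto
  then show ?thesis using measure_nonneg [of m "{x}"] by simp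
qed

text \<open>The cells of a level have total measure one.\<close>

lemma card_Tn_le:
  assumes "1 \<le> n" shows "real (card (Tn n)) * (ci * rs ^ n) powr Q \<le> CA"
proof -
  have "real (card (Tn n)) * ((ci * rs ^ n) powr Q / CA) \<le> (\<Sum>w\<in>Tn n. measure m (K w))"
    using measure_K_lower assms by (intro sum_bounded_below) (auto simp: Tn_iff)
  also have "\<dots> = measure m (K \<phi>)" using measure_K_desc [of \<phi> n] by (simp add: desc_root)
  also have "\<dots> \<le> 1" by (rule prob_space.prob_le_1 [OF prob_m])
  finally show ?thesis using CA_ge_1 by (simp add: field_simps)
qed

lemma hausdorff_premeasure_le_cells:
  assumes "1 \<le> n" "cd * rs ^ n \<le> \<delta>" "0 < s"
  shows "hausdorff_premeasure s \<delta> (UNIV :: 'a set)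
    \<le> ennreal (real (card (Tn n)) * (cd * rs ^ n) powr s)"
proof -
  define M where "M = card (Tn n)"
  obtain b where b: "bij_betw b {0..<M} (Tn n)"
    using ex_bij_betw_nat_finite [OF Tn_finite [of n]] by (auto simp: M_def)
  define U where "U i = (if i < M then K (b i) else {})" for i
  have bT: "level (b i) = n" if "i < M" for i
    using b that by (auto simp: bij_betw_def Tn_iff)
  have "UNIV \<subseteq> (\<Union>i. U i)"
  proof
    fix x :: 'a
    have "x \<in> (\<Union>w\<in>Tn n. K w)" using K_desc [of \<phi> n] by (auto simp: K_root desc_root)
    then obtain w where "w \<in> Tn n" "x \<in> K w" by blast
    moreover have "w \<in> b ` {0..<M}" using b \<open>w \<in> Tn n\<close> by (simp add: bij_betw_def)
    ultimately obtain i where "i < M" "b i = w" by auto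
    then show "x \<in> (\<Union>i. U i)" using \<open>x \<in> K w\<close> by (auto simp: U_def)
  qed
  moreover have "bounded (U i) \<and> diameter (U i) \<le> \<delta>" for i
  proof (cases "i < M")
    case True
    then show ?thesis
      using diameter_K [of "b i"] bT assms(2) K_compact [of "b i"]
      by (auto simp: U_def compact_imp_bounded)
  next
    case False
    have "0 \<le> \<delta>"
      using assms(2) cd_pos rs_pos
      by (meson less_imp_le mult_nonneg_nonneg order_trans zero_le_power)
    then show ?thesis using False by (simp add: U_def)
  qed
  ultimately have "hausdorff_premeasure s \<delta> (UNIV :: 'a set) \<le> (\<Sum>i. ennreal (diameter (U i) powr s))"
    unfolding hausdorff_premeasure_def by (intro INF_lower) auto
  also have "\<dots> = (\<Sum>i\<in>{0..<M}. ennreal (diameter (U i) powr s))"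
    by (rule suminf_finite) (auto simp: U_def)
  also have "\<dots> \<le> (\<Sum>i\<in>{0..<M}. ennreal ((cd * rs ^ n) powr s))"
  proof (intro sum_mono ennreal_leI powr_mono2)
    fix i assume i: "i \<in> {0..<M}"
    show "0 \<le> diameter (U i)"
      using i K_compact [of "b i"] by (simp add: U_def diameter_ge_0 compact_imp_bounded)
    show "diameter (U i) \<le> cd * rs ^ n" using i diameter_K [of "b i"] bT by (simp add: U_def)
  qed (use assms(3) in simp)
  also have "\<dots> = ennreal (real M * (cd * rs ^ n) powr s)"
    by (simp add: ennreal_mult' ennreal_of_nat_eq_real_of_nat)
  finally show ?thesis by (simp add: M_def)
qed

text \<open>Cover the space by the cells of level \<open>n\<close>: their number is at most of order \<open>rs powr (- n * Q)\<close>,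
  and each contributes at most of order \<open>rs powr (n * s)\<close>.\<close>

lemma hausdorff_measure_above_Q:
  assumes "Q < s" shows "hausdorff_measure s (UNIV :: 'a set) = 0"
proof -
  have s0: "0 < s" using assms Q_pos by simp
  have "hausdorff_premeasure s \<delta> (UNIV :: 'a set) \<le> 0" if \<delta>: "0 < \<delta>" for \<delta>
  proof -
    define A where "A = CA * ci powr - Q * cd powr s"
    have "(\<lambda>n. cd * rs ^ n) \<longlonglongrightarrow> cd * 0"
      using rs_pos rs_less_1 by (intro tendsto_intros LIMSEQ_power_zero) auto
    then have "\<forall>\<^sub>F n in sequentially. cd * rs ^ n < \<delta>" by (rule order_tendstoD) (use \<delta> in simp)
    then have ev: "\<forall>\<^sub>F n in sequentially. hausdorff_premeasure s \<delta> (UNIV :: 'a set)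
        \<le> ennreal (A * (rs powr (s - Q)) ^ n)"
      using eventually_ge_at_top [of 1]
    proof eventually_elim
      case (elim n)
      have "real (card (Tn n)) * (cd * rs ^ n) powr s
          = real (card (Tn n)) * (ci * rs ^ n) powr Q * (ci powr - Q * cd powr s * (rs ^ n) powr (s - Q))"
        using rs_pos ci_pos cd_pos by (simp add: powr_mult powr_diff powr_minus field_simps)
      also have "\<dots> \<le> CA * (ci powr - Q * cd powr s * (rs ^ n) powr (s - Q))"
        using card_Tn_le elim by (intro mult_right_mono) auto
      also have "\<dots> = A * (rs powr (s - Q)) ^ n" by (simp add: A_def rs_power_powr mult.assoc)
      finally have "ennreal (real (card (Tn n)) * (cd * rs ^ n) powr s)
          \<le> ennreal (A * (rs powr (s - Q)) ^ n)" by (rule ennreal_leI)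
      then show ?case using hausdorff_premeasure_le_cells [of n \<delta> s] elim s0 by (meson less_imp_le order_trans)
    qed
    have "(\<lambda>n. A * (rs powr (s - Q)) ^ n) \<longlonglongrightarrow> A * 0"
    proof (intro tendsto_intros LIMSEQ_power_zero)
      show "norm (rs powr (s - Q)) < 1" using rs_powr_less_1 [of "s - Q"] assms by simp
    qed
    then have "(\<lambda>n. ennreal (A * (rs powr (s - Q)) ^ n)) \<longlonglongrightarrow> ennreal (A * 0)" by (rule tendsto_ennrealI)
    then have "hausdorff_premeasure s \<delta> (UNIV :: 'a set) \<le> ennreal (A * 0)"
      using ev by (rule tendsto_lowerbound) simp
    then show ?thesis by simp
  qed
  then have "hausdorff_measure s (UNIV :: 'a set) \<le> 0"
    unfolding hausdorff_measure_def by (intro SUP_least) auto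
  then show ?thesis by simp
qed

text \<open>Mass distribution: a covering set of diameter \<open>d > 0\<close> lies in a ball of radius \<open>2 * d\<close>, whose
  measure is at most a constant times \<open>d powr Q\<close>; sets of diameter zero are null sets.\<close>

lemma hausdorff_measure_below_Q:
  assumes "0 < s" "s < Q" shows "hausdorff_measure s (UNIV :: 'a set) \<noteq> 0"
proof -
  define c where "c = CA * 2 powr Q"
  have c0: "0 < c" using CA_ge_1 by (simp add: c_def)
  have "ennreal (1 / c) \<le> hausdorff_premeasure s (1/2) (UNIV :: 'a set)"
    unfolding hausdorff_premeasure_def
  proof (rule INF_greatest, clarify)
    fix U :: "nat \<Rightarrow> 'a set"
    assume cov: "UNIV \<subseteq> (\<Union>i. U i)" and U: "\<forall>i. bounded (U i) \<and> diameter (U i) \<le> 1 / 2"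
    have "\<exists>B. B \<in> sets borel \<and> U i \<subseteq> B \<and> emeasure m B \<le> ennreal c * ennreal (diameter (U i) powr s)" for i
    proof (cases "U i = {}")
      case True
      then show ?thesis by (intro exI [of _ "{}"]) simp
    next
      case False
      then obtain x where x: "x \<in> U i" by blast
      define d where "d = diameter (U i)"
      have d: "0 \<le> d" "d \<le> 1 / 2" "\<And>y. y \<in> U i \<Longrightarrow> dist x y \<le> d"
        using U x by (auto simp: d_def diameter_ge_0 diameter_bounded_bound)
      show ?thesis
      proof (cases "d = 0")
        case True
        then have "U i \<subseteq> {x}" using d(3) by auto
        moreover have "emeasure m {x} = 0" by (simp add: emeasure_m measure_singleton)
        ultimately show ?thesis by (intro exI [of _ "{x}"]) simp
      next
        case False
        then have d0: "0 < d" using d(1) by simp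
        have "measure m (ball x (2 * d)) \<le> CA * (2 * d) powr Q"
          using d0 d(2) by (intro ahlfors_upper) auto
        also have "\<dots> = c * d powr Q" using d0 by (simp add: c_def powr_mult)
        also have "\<dots> \<le> c * d powr s"
          using c0 assms d0 d(2) by (intro mult_left_mono powr_mono') auto
        finally have "emeasure m (ball x (2 * d)) \<le> ennreal c * ennreal (d powr s)"
          unfolding emeasure_m using c0 by (simp add: ennreal_mult [symmetric] ennreal_leI)
        moreover have "U i \<subseteq> ball x (2 * d)" using d(3) d0 by force
        ultimately show ?thesis unfolding d_def by (intro exI [of _ "ball x (2 * diameter (U i))"]) simp
      qed
    qed
    then obtain B where B: "\<And>i. B i \<in> sets borel" "\<And>i. U i \<subseteq> B i"
      "\<And>i. emeasure m (B i) \<le> ennreal c * ennreal (diameter (U i) powr s)"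
      by metis
    have "(1 :: ennreal) = emeasure m (space m)" using prob_space.emeasure_space_1 [OF prob_m] by simp
    also have "\<dots> \<le> emeasure m (\<Union>i. B i)"
    proof (intro emeasure_mono)
      show "space m \<subseteq> (\<Union>i. B i)" using cov B(2) by blast
    qed (use B(1) in auto)
    also have "\<dots> \<le> (\<Sum>i. emeasure m (B i))"
      using B(1) by (intro emeasure_subadditive_countably) auto
    also have "\<dots> \<le> (\<Sum>i. ennreal c * ennreal (diameter (U i) powr s))"
      by (intro suminf_le B(3)) auto
    also have "\<dots> = ennreal c * (\<Sum>i. ennreal (diameter (U i) powr s))" by simp
    finally have "ennreal (1 / c) * 1 \<le> ennreal (1 / c) * (ennreal c * (\<Sum>i. ennreal (diameter (U i) powr s)))"
      by (rule mult_left_mono) simp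
    also have "\<dots> = (\<Sum>i. ennreal (diameter (U i) powr s))"
      using c0 by (simp add: mult.assoc [symmetric] ennreal_mult [symmetric])
    finally show "ennreal (1 / c) \<le> (\<Sum>i. ennreal (diameter (U i) powr s))" by simp
  qed
  also have "\<dots> \<le> hausdorff_measure s (UNIV :: 'a set)"
    unfolding hausdorff_measure_def by (intro SUP_upper) simp
  finally show ?thesis using c0 by (auto simp: ennreal_eq_0_iff)
qed

lemma df_eq_Q: "df = Q"
proof -
  have "hausdorff_dim (UNIV :: 'a set) = ennreal Q"
    unfolding hausdorff_dim_def
  proof (rule antisym)
    show "(INF s\<in>{s. 0 < s \<and> hausdorff_measure s (UNIV :: 'a set) = 0}. ennreal s) \<le> ennreal Q"
    proof (rule ennreal_le_epsilon)
      fix e :: real assume "0 < e"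
      then have "(INF s\<in>{s. 0 < s \<and> hausdorff_measure s (UNIV :: 'a set) = 0}. ennreal s) \<le> ennreal (Q + e)"
        using hausdorff_measure_above_Q [of "Q + e"] Q_pos by (intro INF_lower) auto
      then show "(INF s\<in>{s. 0 < s \<and> hausdorff_measure s (UNIV :: 'a set) = 0}. ennreal s) \<le> ennreal Q + ennreal e"
        using Q_pos \<open>0 < e\<close> by (simp add: ennreal_plus)
    qed
    show "ennreal Q \<le> (INF s\<in>{s. 0 < s \<and> hausdorff_measure s (UNIV :: 'a set) = 0}. ennreal s)"
    proof (rule INF_greatest)
      fix s assume "s \<in> {s. 0 < s \<and> hausdorff_measure s (UNIV :: 'a set) = 0}"
      then have "Q \<le> s" using hausdorff_measure_below_Q [of s] by force
      then show "ennreal Q \<le> ennreal s" by (rule ennreal_leI)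
    qed
  qed
  then show ?thesis using Q_pos by (simp add: df_def)
qed

text \<open>The second summand of \<open>dw\<close> is the exponent to which \<open>rs\<close> must be raised to give \<open>1 / sigma_p\<close>.\<close>

lemma powr_dw:
  assumes "0 < sigma_p" shows "(rs ^ j) powr dw = (rs ^ j) powr Q / sigma_p ^ j"
proof -
  define \<theta> where "\<theta> = ln sigma_p / ln (1 / rs)"
  have "ln rs < 0" using rs_pos rs_less_1 by simp
  then have "\<theta> * ln rs = - ln sigma_p" using rs_pos by (simp add: \<theta>_def ln_div)
  then have "rs powr \<theta> = 1 / sigma_p"
    using rs_pos assms by (simp add: powr_def exp_minus inverse_eq_divide)
  then have "(rs ^ j) powr \<theta> = (1 / sigma_p) ^ j" by (simp add: rs_power_powr)
  then show ?thesis
    by (simp add: dw_def df_eq_Q \<theta>_def [symmetric] powr_add power_one_over)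
qed

end

section \<open>Averages on cells and the Korevaar--Schoen integral\<close>

text \<open>Young's inequality gives the tangent line inequality for \<open>t powr p\<close> at the point \<open>a\<close>.\<close>

lemma powr_tangent_le:
  fixes p a t :: real
  assumes "1 < p" "0 < a" "0 \<le> t"
  shows "a powr p + p * a powr (p - 1) * (t - a) \<le> t powr p"
proof -
  define x where "x = t / a"
  have x: "0 \<le> x" "t = a * x" using assms by (simp_all add: x_def)
  have "p * x \<le> x powr p + (p - 1)"
  proof (cases "x = 0")
    case False
    then have x0: "0 < x" using x by simp
    have "(x powr p) powr (1 / p) * 1 powr (1 - 1 / p) \<le> 1 / p * x powr p + (1 - 1 / p) * 1"
      using assms x0 by (intro Youngs_inequality_0) auto
    then have "x \<le> 1 / p * x powr p + (1 - 1 / p)" using assms x0 by (simp add: powr_powr)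
    then have "p * x \<le> p * (1 / p * x powr p + (1 - 1 / p))" using assms by (intro mult_left_mono) auto
    also have "\<dots> = x powr p + (p - 1)" using assms by (simp add: field_simps)
    finally show ?thesis .
  qed (use assms in simp)
  then have "a powr p * (1 + p * (x - 1)) \<le> a powr p * x powr p"
    by (intro mult_left_mono) (auto simp: algebra_simps)
  moreover have "a powr p = a powr (p - 1) * a" using assms by (simp add: powr_diff)
  ultimately show ?thesis using assms x by (simp add: powr_mult algebra_simps)
qed

lemma ennreal_integral_le_nn_integral:
  fixes f :: "'b \<Rightarrow> real"
  assumes "integrable M f" shows "ennreal (integral\<^sup>L M f) \<le> (\<integral>\<^sup>+x. ennreal (f x) \<partial>M)"
proof -
  have int: "integrable M (\<lambda>x. max 0 (f x))" using assms by (intro integrable_max) auto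
  have "integral\<^sup>L M f \<le> (\<integral>x. max 0 (f x) \<partial>M)" using assms int by (intro integral_mono) auto
  then have "ennreal (integral\<^sup>L M f) \<le> ennreal (\<integral>x. max 0 (f x) \<partial>M)" by (rule ennreal_leI)
  also have "\<dots> = (\<integral>\<^sup>+x. ennreal (max 0 (f x)) \<partial>M)" using int by (simp add: nn_integral_eq_integral)
  also have "\<dots> = (\<integral>\<^sup>+x. ennreal (f x) \<partial>M)" by (intro nn_integral_cong) (simp add: max_def ennreal_neg)
  finally show ?thesis .
qed

text \<open>Jensen's inequality, including the case where the right-hand side is infinite.\<close>

lemma powr_average_le:
  fixes g :: "'b \<Rightarrow> real"
  assumes "finite_measure M" and A: "A \<in> sets M" "0 < measure M A"
    and g: "integrable M g" and p: "1 < p"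
  shows "ennreal (\<bar>c - (LINT x:A|M. g x) / measure M A\<bar> powr p)
    \<le> ennreal (1 / measure M A) * (\<integral>\<^sup>+x\<in>A. ennreal (\<bar>c - g x\<bar> powr p) \<partial>M)"
proof (cases "c = (LINT x:A|M. g x) / measure M A")
  case True
  then show ?thesis using p by simp
next
  case False
  interpret finite_measure M by fact
  define \<mu> where "\<mu> = measure M A"
  define a where "a = \<bar>c - (LINT x:A|M. g x) / \<mu>\<bar>"
  have \<mu>: "0 < \<mu>" using A by (simp add: \<mu>_def)
  have a: "0 < a" using False by (simp add: a_def \<mu>_def)
  have int1: "integrable M (indicator A :: _ \<Rightarrow> real)"
    using A(1) by (simp add: integrable_indicator_iff emeasure_eq_measure)
  have ig: "integrable M (\<lambda>x. indicator A x * g x)"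
    using integrable_mult_indicator [OF A(1) g] by simp
  have icg: "integrable M (\<lambda>x. indicator A x * \<bar>c - g x\<bar>)"
    using integrable_mult_indicator [OF A(1), of "\<lambda>x. \<bar>c - g x\<bar>"] g by simp
  have T: "a * \<mu> \<le> (\<integral>x. indicator A x * \<bar>c - g x\<bar> \<partial>M)"
  proof -
    have "(\<integral>x. indicator A x * (c - g x) \<partial>M) = (\<integral>x. c * indicator A x - indicator A x * g x \<partial>M)"
      by (intro Bochner_Integration.integral_cong) (auto simp: algebra_simps)
    also have "\<dots> = c * \<mu> - (LINT x:A|M. g x)"
      using int1 ig A(1) by (simp add: \<mu>_def set_lebesgue_integral_def)
    also have "\<dots> = (c - (LINT x:A|M. g x) / \<mu>) * \<mu>" using \<mu> by (simp add: left_diff_distrib)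
    finally have "\<bar>\<integral>x. indicator A x * (c - g x) \<partial>M\<bar> = a * \<mu>"
      using \<mu> by (simp only: a_def abs_mult abs_of_pos)
    moreover have "\<bar>\<integral>x. indicator A x * (c - g x) \<partial>M\<bar> \<le> (\<integral>x. \<bar>indicator A x * (c - g x)\<bar> \<partial>M)"
      by (rule integral_abs_bound)
    ultimately show ?thesis by (simp add: abs_mult)
  qed
  define q where "q = p * a powr (p - 1)"
  have q: "0 \<le> q" using p by (simp add: q_def)
  define h where "h x = (a powr p - q * a) * indicator A x + q * (indicator A x * \<bar>c - g x\<bar>)" for x
  have hint: "integrable M h" unfolding h_def using int1 icg by simp
  have "\<mu> * a powr p \<le> \<mu> * a powr p + q * ((\<integral>x. indicator A x * \<bar>c - g x\<bar> \<partial>M) - a * \<mu>)"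
    using T q by simp
  also have "\<dots> = integral\<^sup>L M h"
    unfolding h_def using int1 icg A(1) by (simp add: \<mu>_def algebra_simps)
  finally have "ennreal (\<mu> * a powr p) \<le> (\<integral>\<^sup>+x. ennreal (h x) \<partial>M)"
    using ennreal_integral_le_nn_integral [OF hint] ennreal_leI order_trans by blast
  also have "\<dots> \<le> (\<integral>\<^sup>+x\<in>A. ennreal (\<bar>c - g x\<bar> powr p) \<partial>M)"
  proof (rule nn_integral_mono)
    fix x
    show "ennreal (h x) \<le> ennreal (\<bar>c - g x\<bar> powr p) * indicator A x"
      using powr_tangent_le [OF p a, of "\<bar>c - g x\<bar>"]
      by (auto simp: h_def q_def indicator_def algebra_simps intro!: ennreal_leI)
  qed
  finally have "ennreal (1 / \<mu>) * ennreal (\<mu> * a powr p)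
      \<le> ennreal (1 / \<mu>) * (\<integral>\<^sup>+x\<in>A. ennreal (\<bar>c - g x\<bar> powr p) \<partial>M)"
    by (rule mult_left_mono) simp
  moreover have "ennreal (1 / \<mu>) * ennreal (\<mu> * a powr p) = ennreal (a powr p)"
    using \<mu> by (simp add: ennreal_mult [symmetric])
  ultimately show ?thesis by (simp add: a_def \<mu>_def)
qed

text \<open>The exponent may have either sign.\<close>

lemma powr_le_max:
  fixes x :: real
  assumes "0 < a" "a \<le> x" "x \<le> b" shows "x powr \<theta> \<le> max (a powr \<theta>) (b powr \<theta>)"
proof (cases "0 \<le> \<theta>")
  case True
  then have "x powr \<theta> \<le> b powr \<theta>" using assms by (intro powr_mono2) auto
  then show ?thesis by simp
next
  case False
  then have "x powr \<theta> \<le> a powr \<theta>" using assms by (intro powr_mono2') auto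
  then show ?thesis by simp
qed

lemma ennreal_le_cmult_iff:
  assumes "0 < C" shows "X \<le> ennreal C * Y \<longleftrightarrow> ennreal (1 / C) * X \<le> Y"
proof -
  have 1: "ennreal C * (ennreal (1 / C) * Z) = Z" "ennreal (1 / C) * (ennreal C * Z) = Z" for Z
    using assms by (simp_all add: mult.assoc [symmetric] ennreal_mult [symmetric])
  show ?thesis
  proof
    assume "X \<le> ennreal C * Y"
    then have "ennreal (1 / C) * X \<le> ennreal (1 / C) * (ennreal C * Y)" by (rule mult_left_mono) simp
    then show "ennreal (1 / C) * X \<le> Y" by (simp only: 1)
  next
    assume "ennreal (1 / C) * X \<le> Y"
    then have "ennreal C * (ennreal (1 / C) * X) \<le> ennreal C * Y" by (rule mult_left_mono) simp
    then show "X \<le> ennreal C * Y" by (simp only: 1)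
  qed
qed

context ahlfors_geometry
begin

lemma dist_Gam:
  assumes "u \<in> Gam M w" "x \<in> K u" "y \<in> K w"
  shows "dist x y \<le> real (Suc M) * (cd * rs ^ level w)"
  using assms
proof (induction M arbitrary: u x)
  case 0
  then have "u = w" by (simp add: Gam_iff)
  then have "dist x y \<le> diameter (K w)"
    using 0 K_compact [of w] by (intro diameter_bounded_bound) (auto simp: compact_imp_bounded)
  then show ?case using diameter_K [of w] by simp
next
  case (Suc M)
  obtain v where v: "v \<in> Gam M w" "u \<in> Gam 1 v" using Gam_Suc_obtain [OF Suc.prems(1)] by blast
  obtain z where z: "z \<in> K u" "z \<in> K v" using v(2) unfolding Gam_1_iff by blast
  have "dist x z \<le> diameter (K u)"
    using Suc.prems z K_compact [of u]
    by (intro diameter_bounded_bound) (auto simp: compact_imp_bounded)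
  also have "\<dots> \<le> cd * rs ^ level w"
    using diameter_K [of u] Gam_level [OF Suc.prems(1)] by simp
  finally have "dist x z \<le> cd * rs ^ level w" .
  moreover have "dist z y \<le> real (Suc M) * (cd * rs ^ level w)"
    by (rule Suc.IH [OF v(1) z(2) Suc.prems(3)])
  ultimately show ?case using dist_triangle [of x y z] by (simp add: algebra_simps)
qed

text \<open>Jensen's inequality, once in each variable.\<close>

lemma avg_diff_le:
  assumes g: "integrable m g"
  shows "ennreal (\<bar>avg g v - avg g w\<bar> powr p)
    \<le> ennreal (1 / (measure m (K v) * measure m (K w))) *
      (\<integral>\<^sup>+x\<in>K v. (\<integral>\<^sup>+y\<in>K w. ennreal (\<bar>g x - g y\<bar> powr p) \<partial>m) \<partial>m)"
proof -
  have gm [measurable]: "g \<in> borel_measurable m" using g by auto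
  interpret finite_measure m by (rule finite_m)
  have inner: "ennreal (\<bar>avg g w - g x\<bar> powr p)
      \<le> ennreal (1 / measure m (K w)) * (\<integral>\<^sup>+y\<in>K w. ennreal (\<bar>g x - g y\<bar> powr p) \<partial>m)" for x
    using powr_average_le [OF finite_m _ measure_K_pos g p_gt_1, of w "g x"]
    by (simp add: avg_def abs_minus_commute)
  have "ennreal (\<bar>avg g v - avg g w\<bar> powr p)
      \<le> ennreal (1 / measure m (K v)) * (\<integral>\<^sup>+x\<in>K v. ennreal (\<bar>avg g w - g x\<bar> powr p) \<partial>m)"
    using powr_average_le [OF finite_m _ measure_K_pos g p_gt_1, of v "avg g w"]
    by (simp add: avg_def [of g v] abs_minus_commute)
  also have "(\<integral>\<^sup>+x\<in>K v. ennreal (\<bar>avg g w - g x\<bar> powr p) \<partial>m)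
      \<le> (\<integral>\<^sup>+x. ennreal (1 / measure m (K w)) *
          ((\<integral>\<^sup>+y\<in>K w. ennreal (\<bar>g x - g y\<bar> powr p) \<partial>m) * indicator (K v) x) \<partial>m)"
  proof (rule nn_integral_mono)
    fix x
    show "ennreal (\<bar>avg g w - g x\<bar> powr p) * indicator (K v) x \<le> ennreal (1 / measure m (K w)) *
        ((\<integral>\<^sup>+y\<in>K w. ennreal (\<bar>g x - g y\<bar> powr p) \<partial>m) * indicator (K v) x)"
      using inner [of x] by (cases "x \<in> K v") simp_all
  qed
  also have "\<dots> = ennreal (1 / measure m (K w)) *
      (\<integral>\<^sup>+x\<in>K v. (\<integral>\<^sup>+y\<in>K w. ennreal (\<bar>g x - g y\<bar> powr p) \<partial>m) \<partial>m)"
    by (rule nn_integral_cmult) measurable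
  finally show ?thesis
    using measure_K_pos [of v] measure_K_pos [of w]
    by (simp add: mult_left_mono mult.assoc [symmetric] ennreal_mult [symmetric])
qed

lemma KS_integral_mono: "A \<subseteq> B \<Longrightarrow> KS_integral A g r \<le> KS_integral B g r"
  unfolding KS_integral_def
  by (intro nn_integral_mono) (auto simp: indicator_def)

text \<open>At scale \<open>r\<close> of order \<open>R = rs ^ j\<close> the cells and the ball have measure of order \<open>R powr Q\<close>, and
  \<open>r powr dw\<close> is of order \<open>R powr Q / sigma_p ^ j\<close>.\<close>

lemma cell_ball_measure_bound:
  assumes \<sigma>: "0 < sigma_p"
  shows "\<exists>\<kappa>>0. \<forall>j\<ge>1. \<forall>v\<in>Tn j. \<forall>w\<in>Tn j. \<forall>x r. 2 * cd * rs ^ j < r \<longrightarrow>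
    r \<le> 2 * cd * rs ^ (j - 1) \<longrightarrow> r < 2 \<longrightarrow>
    sigma_p ^ j / (measure m (K v) * measure m (K w)) \<le> \<kappa> / (measure m (ball x r) * r powr dw)"
proof -
  define b where "b = 2 * cd / rs"
  define E where "E = max ((2 * cd) powr dw) (b powr dw)"
  define \<kappa> where "\<kappa> = CA * b powr Q * E * (CA / ci powr Q) ^ 2"
  have E: "0 < E" using cd_pos by (simp add: E_def less_max_iff_disj)
  have \<kappa>: "0 < \<kappa>" using E CA_ge_1 cd_pos rs_pos ci_pos by (simp add: \<kappa>_def b_def)
  have "sigma_p ^ j / (measure m (K v) * measure m (K w)) \<le> \<kappa> / (measure m (ball x r) * r powr dw)"
    if j: "1 \<le> j" and vw: "v \<in> Tn j" "w \<in> Tn j"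
      and r: "2 * cd * rs ^ j < r" "r \<le> 2 * cd * rs ^ (j - 1)" "r < 2" for j v w x r
  proof -
    define R where "R = rs ^ j"
    have R: "0 < R" using rs_pos by (simp add: R_def)
    have "0 < 2 * cd * rs ^ j" using cd_pos rs_pos by simp
    then have r0: "0 < r" using r(1) by (rule less_trans)
    have "rs ^ (j - 1) = R / rs" using j rs_pos by (simp add: R_def power_diff)
    then have "2 * cd * R < r" "r \<le> 2 * cd * (R / rs)" using r by (simp_all add: R_def)
    then have ratio: "2 * cd \<le> r / R" "r / R \<le> b"
      using R rs_pos unfolding b_def by (simp_all add: field_simps)
    have rR: "r powr \<theta> = (r / R) powr \<theta> * R powr \<theta>" for \<theta>
      using r0 R by (simp add: powr_divide)
    define \<rho> where "\<rho> = R powr Q"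
    have \<rho>: "0 < \<rho>" using R by (simp add: \<rho>_def)
    have "measure m (ball x r) \<le> CA * r powr Q" using r0 r(3) by (rule ahlfors_upper)
    also have "r powr Q \<le> b powr Q * \<rho>"
      unfolding rR [of Q] \<rho>_def using ratio Q_pos r0 R by (intro mult_right_mono powr_mono2) auto
    finally have ball_le: "measure m (ball x r) \<le> CA * (b powr Q * \<rho>)"
      using CA_ge_1 by (simp add: mult_left_mono)
    have ball_pos: "0 < measure m (ball x r)"
    proof -
      have "0 < r powr Q / CA" using r0 CA_ge_1 by simp
      then show ?thesis using ahlfors_lower [OF r0 r(3), of x] by linarith
    qed
    have "r powr dw \<le> E * R powr dw"
      unfolding rR [of dw] E_def using ratio cd_pos by (intro mult_right_mono powr_le_max) auto
    also have "R powr dw = \<rho> / sigma_p ^ j" unfolding R_def \<rho>_def by (rule powr_dw [OF \<sigma>])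
    finally have rdw: "r powr dw \<le> E * (\<rho> / sigma_p ^ j)" .
    have cell: "ci powr Q / CA * \<rho> \<le> measure m (K u)" if "u \<in> Tn j" for u
      using measure_K_lower [of u] that j ci_pos R by (simp add: Tn_iff R_def \<rho>_def powr_mult)
    have "sigma_p ^ j * (measure m (ball x r) * r powr dw)
        \<le> sigma_p ^ j * ((CA * (b powr Q * \<rho>)) * (E * (\<rho> / sigma_p ^ j)))"
      using ball_le rdw \<sigma> CA_ge_1 \<rho> by (intro mult_left_mono mult_mono) auto
    also have "\<dots> = \<kappa> * ((ci powr Q / CA * \<rho>) * (ci powr Q / CA * \<rho>))"
      using \<sigma> CA_ge_1 ci_pos by (simp add: \<kappa>_def power2_eq_square)
    also have "\<dots> \<le> \<kappa> * (measure m (K v) * measure m (K w))"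
      using cell vw \<kappa> \<rho> CA_ge_1 by (intro mult_left_mono mult_mono) auto
    finally show ?thesis
      using measure_K_pos [of v] measure_K_pos [of w] ball_pos r0 by (simp add: field_simps)
  qed
  then show ?thesis using \<kappa> by blast
qed

text \<open>For neighbouring cells \<open>K v\<close> and \<open>K w\<close> of level \<open>j\<close> and \<open>x\<close> in \<open>K v\<close>, the whole of \<open>K w\<close> lies
  in the ball of radius \<open>r\<close> about \<open>x\<close>, and a point lies in boundedly many cells.\<close>

lemma energy_le_KS_integral:
  assumes \<sigma>: "0 < sigma_p"
  shows "\<exists>C>0. \<forall>j\<ge>1. \<forall>B\<subseteq>Tn j. \<forall>g\<in>Lp_space p m. \<forall>r. 2 * cd * rs ^ j < r \<longrightarrow>
    r \<le> 2 * cd * rs ^ (j - 1) \<longrightarrow> r < 2 \<longrightarrow>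
    ennreal (sigma_p ^ j * energy j B (avg g)) \<le> ennreal C * KS_integral (\<Union>w\<in>B. K w) g r"
proof -
  obtain \<kappa> where \<kappa>: "0 < \<kappa>" "\<And>j v w x r. 1 \<le> j \<Longrightarrow> v \<in> Tn j \<Longrightarrow> w \<in> Tn j \<Longrightarrow>
      2 * cd * rs ^ j < r \<Longrightarrow> r \<le> 2 * cd * rs ^ (j - 1) \<Longrightarrow> r < 2 \<Longrightarrow>
    sigma_p ^ j / (measure m (K v) * measure m (K w)) \<le> \<kappa> / (measure m (ball x r) * r powr dw)"
    using cell_ball_measure_bound [OF \<sigma>] by blast
  define C where "C = real (N * N) * \<kappa>"
  have C: "0 < C" using \<kappa>(1) N_ge_1 by (simp add: C_def)
  have "ennreal (1 / C) * ennreal (sigma_p ^ j * energy j B (avg g)) \<le> KS_integral (\<Union>w\<in>B. K w) g r"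
    if j: "1 \<le> j" and B: "B \<subseteq> Tn j" and g: "g \<in> Lp_space p m"
      and r: "2 * cd * rs ^ j < r" "r \<le> 2 * cd * rs ^ (j - 1)" "r < 2" for j B g r
  proof -
    have gi: "integrable m g" using g p_gt_1 by (intro Lp_integrable) auto
    then have gm [measurable]: "g \<in> borel_measurable m" by auto
    interpret finite_measure m by (rule finite_m)
    have "0 < 2 * cd * rs ^ j" using cd_pos rs_pos by simp
    then have r0: "0 < r" using r(1) by (rule less_trans)
    define a where "a z = sigma_p ^ j / (measure m (K (fst z)) * measure m (K (snd z)))" for z
    define I where "I w x = (\<integral>\<^sup>+y\<in>K w. ennreal (\<bar>g x - g y\<bar> powr p) \<partial>m)" for w x
    have I [measurable]: "I w \<in> borel_measurable m" for w unfolding I_def by measurable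
    define J where "J x = (\<integral>\<^sup>+y\<in>ball x r. ennreal (\<bar>g x - g y\<bar> powr p) \<partial>m)" for x
    define P where "P = adj j B"
    have "sigma_p ^ j * energy j B (avg g) \<le> (\<Sum>z\<in>P. sigma_p ^ j * \<bar>avg g (fst z) - avg g (snd z)\<bar> powr p)"
    proof -
      have "energy j B (avg g) \<le> (\<Sum>z\<in>P. \<bar>avg g (fst z) - avg g (snd z)\<bar> powr p)"
        using energy_nonneg [of j B "avg g"] by (simp add: energy_adj P_def split_def)
      then have "sigma_p ^ j * energy j B (avg g)
          \<le> sigma_p ^ j * (\<Sum>z\<in>P. \<bar>avg g (fst z) - avg g (snd z)\<bar> powr p)"
        using \<sigma> by (intro mult_left_mono) auto
      then show ?thesis by (simp add: sum_distrib_left)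
    qed
    then have "ennreal (sigma_p ^ j * energy j B (avg g))
        \<le> (\<Sum>z\<in>P. ennreal (sigma_p ^ j * \<bar>avg g (fst z) - avg g (snd z)\<bar> powr p))"
      using \<sigma> by (simp add: sum_ennreal ennreal_leI)
    also have "\<dots> \<le> (\<Sum>z\<in>P. ennreal (a z) * (\<integral>\<^sup>+x\<in>K (fst z). I (snd z) x \<partial>m))"
    proof (rule sum_mono)
      fix z
      have "ennreal (sigma_p ^ j) * ennreal (\<bar>avg g (fst z) - avg g (snd z)\<bar> powr p)
          \<le> ennreal (sigma_p ^ j) * (ennreal (1 / (measure m (K (fst z)) * measure m (K (snd z)))) *
            (\<integral>\<^sup>+x\<in>K (fst z). I (snd z) x \<partial>m))"
        unfolding I_def by (intro mult_left_mono avg_diff_le gi) simp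
      then show "ennreal (sigma_p ^ j * \<bar>avg g (fst z) - avg g (snd z)\<bar> powr p)
          \<le> ennreal (a z) * (\<integral>\<^sup>+x\<in>K (fst z). I (snd z) x \<partial>m)"
        using \<sigma> by (simp add: a_def mult.assoc [symmetric] ennreal_mult [symmetric])
    qed
    also have "\<dots> = (\<integral>\<^sup>+x. (\<Sum>z\<in>P. ennreal (a z) * (I (snd z) x * indicator (K (fst z)) x)) \<partial>m)"
      by (simp add: nn_integral_sum nn_integral_cmult)
    finally have "ennreal (1 / C) * ennreal (sigma_p ^ j * energy j B (avg g)) \<le> ennreal (1 / C) *
        (\<integral>\<^sup>+x. (\<Sum>z\<in>P. ennreal (a z) * (I (snd z) x * indicator (K (fst z)) x)) \<partial>m)"
      by (rule mult_left_mono) simp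
    also have "\<dots> = (\<integral>\<^sup>+x. ennreal (1 / C) *
        (\<Sum>z\<in>P. ennreal (a z) * (I (snd z) x * indicator (K (fst z)) x)) \<partial>m)"
      by (rule nn_integral_cmult [symmetric]) simp
    also have "\<dots> \<le> KS_integral (\<Union>w\<in>B. K w) g r"
      unfolding KS_integral_def
    proof (rule nn_integral_mono)
      fix x
      define \<mu> where "\<mu> = measure m (ball x r)"
      have \<mu>: "0 < \<mu>"
      proof -
        have "0 < r powr Q / CA" using r0 CA_ge_1 by simp
        then show ?thesis using ahlfors_lower [OF r0 r(3), of x] by (simp add: \<mu>_def)
      qed
      define Px where "Px = {z \<in> P. x \<in> K (fst z)}"
      have KS: "(1 / emeasure m (ball x r)) * (\<integral>\<^sup>+y\<in>ball x r. ennreal (\<bar>g x - g y\<bar> powr p / r powr dw) \<partial>m)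
          = ennreal (1 / (\<mu> * r powr dw)) * J x"
      proof -
        have "(\<integral>\<^sup>+y\<in>ball x r. ennreal (\<bar>g x - g y\<bar> powr p / r powr dw) \<partial>m)
            = (\<integral>\<^sup>+y. ennreal (1 / r powr dw) * (ennreal (\<bar>g x - g y\<bar> powr p) * indicator (ball x r) y) \<partial>m)"
          by (intro nn_integral_cong) (auto simp: indicator_def ennreal_mult [symmetric])
        also have "\<dots> = ennreal (1 / r powr dw) * J x"
          unfolding J_def
        proof (rule nn_integral_cmult)
          have [measurable]: "ball x r \<in> sets m" by simp
          show "(\<lambda>y. ennreal (\<bar>g x - g y\<bar> powr p) * indicator (ball x r) y) \<in> borel_measurable m"
            by measurable
        qed
        finally have eq: "(\<integral>\<^sup>+y\<in>ball x r. ennreal (\<bar>g x - g y\<bar> powr p / r powr dw) \<partial>m)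
            = ennreal (1 / r powr dw) * J x" .
        have inv: "1 / emeasure m (ball x r) = ennreal (1 / \<mu>)"
          using divide_ennreal [of 1 \<mu>] \<mu> by (simp add: emeasure_m \<mu>_def [symmetric])
        show ?thesis
          unfolding eq inv using \<mu> by (simp add: mult.assoc [symmetric] ennreal_mult [symmetric])
      qed
      have term_le: "ennreal (a z) * I (snd z) x \<le> ennreal (\<kappa> / (\<mu> * r powr dw)) * J x"
        if z: "z \<in> Px" for z
      proof (intro mult_mono ennreal_leI)
        have zP: "(fst z, snd z) \<in> adj j B" "x \<in> K (fst z)" using z by (auto simp: Px_def P_def)
        then have zT: "fst z \<in> Tn j" "snd z \<in> Tn j" by (simp_all only: adj_iff)
        show "a z \<le> \<kappa> / (\<mu> * r powr dw)"
          unfolding a_def \<mu>_def by (intro \<kappa>(2) j r zT)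
        have "K (snd z) \<subseteq> ball x r"
        proof
          fix y assume "y \<in> K (snd z)"
          then have "dist y x \<le> real (Suc 1) * (cd * rs ^ level (fst z))"
            using adj_1_Gam [OF zP(1)] zP(2) by (intro dist_Gam)
          also have "\<dots> = 2 * cd * rs ^ j" using zT(1) by (simp add: Tn_iff)
          also have "\<dots> < r" by (rule r(1))
          finally show "y \<in> ball x r" by (simp add: dist_commute)
        qed
        then show "I (snd z) x \<le> J x"
          unfolding I_def J_def by (intro nn_integral_mono) (auto simp: indicator_def)
      qed auto
      have card: "card Px \<le> N * N"
      proof (cases "Px = {}")
        case False
        then obtain z0 where z0: "z0 \<in> Px" by blast
        have "Px \<subseteq> (SIGMA v:Gam 1 (fst z0). Gam 1 v)"
        proof
          fix z assume z: "z \<in> Px"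
          have zs: "(fst z, snd z) \<in> adj j B" "(fst z0, snd z0) \<in> adj j B"
            using z z0 by (auto simp: Px_def P_def)
          then have lev: "level (fst z) = j" "level (fst z0) = j" by (simp_all only: adj_iff Tn_iff)
          have "fst z \<in> Gam 1 (fst z0)"
            unfolding Gam_1_iff using z z0 lev by (auto simp: Px_def)
          moreover have "snd z \<in> Gam 1 (fst z)" using zs(1) by (rule adj_1_Gam)
          ultimately show "z \<in> (SIGMA v:Gam 1 (fst z0). Gam 1 v)" by (cases z) simp
        qed
        then have "card Px \<le> card (SIGMA v:Gam 1 (fst z0). Gam 1 v)"
          by (intro card_mono) (auto simp: Gam_finite)
        also have "\<dots> = (\<Sum>v\<in>Gam 1 (fst z0). card (Gam 1 v))"
          by (rule card_SigmaI) (auto simp: Gam_finite)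
        also have "\<dots> \<le> (\<Sum>v\<in>Gam 1 (fst z0). N)" by (intro sum_mono Gam_1_card)
        also have "\<dots> \<le> N * N" using Gam_1_card [of "fst z0"] by simp
        finally show ?thesis .
      qed simp
      have Pfin: "finite P" by (simp add: P_def adj_finite)
      have sum_eq: "(\<Sum>z\<in>P. ennreal (a z) * (I (snd z) x * indicator (K (fst z)) x))
          = (\<Sum>z\<in>Px. ennreal (a z) * I (snd z) x)"
        unfolding Px_def using Pfin
        by (intro sum.mono_neutral_cong_right) (auto simp: indicator_def)
      show "ennreal (1 / C) * (\<Sum>z\<in>P. ennreal (a z) * (I (snd z) x * indicator (K (fst z)) x))
          \<le> (1 / emeasure m (ball x r)) * (\<integral>\<^sup>+y\<in>ball x r. ennreal (\<bar>g x - g y\<bar> powr p / r powr dw) \<partial>m) *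
            indicator (\<Union>w\<in>B. K w) x"
      proof (cases "Px = {}")
        case True
        then show ?thesis unfolding sum_eq by simp
      next
        case False
        then have ind: "x \<in> (\<Union>w\<in>B. K w)" by (force simp: Px_def P_def adj_iff)
        have "(\<Sum>z\<in>Px. ennreal (a z) * I (snd z) x) \<le> of_nat (card Px) * (ennreal (\<kappa> / (\<mu> * r powr dw)) * J x)"
          by (rule sum_bounded_above) (rule term_le)
        also have "\<dots> \<le> ennreal (real (N * N)) * (ennreal (\<kappa> / (\<mu> * r powr dw)) * J x)"
          using card unfolding ennreal_of_nat_eq_real_of_nat
          by (intro mult_right_mono ennreal_leI of_nat_mono) auto
        also have "\<dots> = ennreal C * (ennreal (1 / (\<mu> * r powr dw)) * J x)"
          using \<kappa>(1) \<mu> by (simp add: C_def mult.assoc [symmetric] ennreal_mult [symmetric])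
        finally have "(\<Sum>z\<in>Px. ennreal (a z) * I (snd z) x) \<le> ennreal C * (ennreal (1 / (\<mu> * r powr dw)) * J x)" .
        then have "ennreal (1 / C) * (\<Sum>z\<in>Px. ennreal (a z) * I (snd z) x) \<le> ennreal (1 / (\<mu> * r powr dw)) * J x"
          using ennreal_le_cmult_iff [OF C] by blast
        then show ?thesis unfolding sum_eq KS using ind by simp
      qed
    qed
    finally show ?thesis .
  qed
  then show ?thesis using C ennreal_le_cmult_iff [OF C] by blast
qed

end

section \<open>The local and the global estimate\<close>

lemma Liminf_cmult_bound:
  assumes "0 < C" "eventually (\<lambda>r. X \<le> ennreal C * F r) L"
  shows "X \<le> ennreal C * Liminf L F"
  unfolding ennreal_le_cmult_iff [OF assms(1)]
  by (rule Liminf_bounded) (use assms(2) in \<open>simp add: ennreal_le_cmult_iff [OF assms(1)]\<close>)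

text \<open>For a monotone function the one-sided limit exists, so \<open>Lim\<close> is meaningful and equals the infimum.\<close>

lemma Lim_at_right_mono:
  fixes F :: "real \<Rightarrow> ennreal"
  assumes mono: "\<And>x y. 0 < x \<Longrightarrow> x \<le> y \<Longrightarrow> F x \<le> F y"
  shows "Lim (at_right 0) F = (INF x\<in>{0<..}. F x)"
proof (rule tendsto_Lim)
  show "(F \<longlongrightarrow> (INF x\<in>{0<..}. F x)) (at_right 0)"
  proof (rule order_tendstoI)
    fix a assume a: "a < (INF x\<in>{0<..}. F x)"
    have "a < F x" if "0 < x" for x
      using a INF_lower [of x "{0<..}" F] that by (auto intro: less_le_trans)
    then show "eventually (\<lambda>x. a < F x) (at_right 0)"
      using eventually_at_right_less [of "0::real"] by (rule eventually_mono [rotated])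
  next
    fix a assume "(INF x\<in>{0<..}. F x) < a"
    then obtain y where y: "0 < y" "F y < a" unfolding INF_less_iff by auto
    have "eventually (\<lambda>x. x \<in> {0<..<y}) (at_right 0)" using y(1) by (rule eventually_at_right_real)
    then show "eventually (\<lambda>x. F x < a) (at_right 0)"
    proof eventually_elim
      case (elim x)
      then have "F x \<le> F y" by (intro mono) auto
      then show ?case using y(2) by (rule le_less_trans)
    qed
  qed
qed simp

context ahlfors_geometry
begin

text \<open>The scale \<open>r\<close> determines a level \<open>n + k\<close>. Coarse-graining bounds the energy at level \<open>n\<close> by that at
  level \<open>n + k\<close>, up to a constant and within a distance of order \<open>rs ^ n\<close>, which is then compared with
  the integral at scale \<open>r\<close>.\<close>

lemma energy_le_Liminf_KS_integral:
  assumes "conductively_homogeneous"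
  shows "\<exists>C>0. \<exists>L>0. \<forall>n\<ge>1. \<forall>E. \<forall>g\<in>Lp_space p m.
    ennreal (sigma_p ^ n * energy n (Tn_meet n E) (avg g))
      \<le> ennreal C * Liminf (at_right 0) (KS_integral (\<Union>x\<in>E. ball x (L * rs ^ n)) g)"
proof -
  obtain c1 c2 \<J> where bounds:
      "\<forall>k. ennreal (c1 / sigma_p ^ k) \<le> cap_sup Ms k \<and> cap_sup Ms k \<le> ennreal (c2 / sigma_p ^ k) \<and>
         ennreal (c1 * sigma_p ^ k) \<le> sigma_J \<J> k \<and> sigma_J \<J> k \<le> ennreal (c2 * sigma_p ^ k)"
    and \<J>: "covering_system \<J>" and c2: "0 < c2" and \<sigma>: "0 < sigma_p"
    using sigma_p_bounds [OF assms] by (elim conjE exE) (rule that; assumption)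
  have sJ: "sigma_J \<J> k \<le> ennreal (c2 * sigma_p ^ k)" for k using bounds by blast
  obtain C1 R where C1: "0 < C1" "\<And>n k s f B. 1 \<le> n \<Longrightarrow> 0 \<le> s \<Longrightarrow> sigma_J \<J> k \<le> ennreal s \<Longrightarrow>
      B \<subseteq> Tn n \<Longrightarrow> energy n B (avg_desc k f) \<le> C1 * s * energy (n + k) (descs k (\<Union>b\<in>B. Gam R b)) f"
    using covering_system_energy_local [OF \<J>] by blast
  obtain C3 where C3: "0 < C3" "\<forall>j\<ge>1. \<forall>B\<subseteq>Tn j. \<forall>g\<in>Lp_space p m. \<forall>r. 2 * cd * rs ^ j < r \<longrightarrow>
      r \<le> 2 * cd * rs ^ (j - 1) \<longrightarrow> r < 2 \<longrightarrow>
      ennreal (sigma_p ^ j * energy j B (avg g)) \<le> ennreal C3 * KS_integral (\<Union>w\<in>B. K w) g r"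
    using energy_le_KS_integral [OF \<sigma>] by (elim conjE exE) (rule that; assumption)
  define L where "L = (real R + 2) * cd"
  define C where "C = C1 * c2 * C3"
  have L: "0 < L" using cd_pos by (simp add: L_def)
  have C: "0 < C" using C1 C3 c2 by (simp add: C_def)
  have "ennreal (sigma_p ^ n * energy n (Tn_meet n E) (avg g))
      \<le> ennreal C * Liminf (at_right 0) (KS_integral (\<Union>x\<in>E. ball x (L * rs ^ n)) g)"
    if n: "1 \<le> n" and g: "g \<in> Lp_space p m" for n E g
  proof (rule Liminf_cmult_bound [OF C])
    define B where "B = Tn_meet n E"
    have B: "B \<subseteq> Tn n" by (auto simp: B_def Tn_meet_def)
    have gi: "integrable m g" using g p_gt_1 by (intro Lp_integrable) auto
    define r1 where "r1 = min 2 (2 * cd * rs ^ n)"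
    have r1: "0 < r1" using cd_pos rs_pos by (simp add: r1_def)
    have main: "ennreal (sigma_p ^ n * energy n B (avg g))
        \<le> ennreal C * KS_integral (\<Union>x\<in>E. ball x (L * rs ^ n)) g r"
      if r: "0 < r" "r < r1" for r
    proof -
      have "(\<lambda>k. 2 * cd * rs ^ n * rs ^ k) \<longlonglongrightarrow> 2 * cd * rs ^ n * 0"
        using rs_pos rs_less_1 by (intro tendsto_intros LIMSEQ_power_zero) auto
      then have "eventually (\<lambda>k. 2 * cd * rs ^ n * rs ^ k < r) sequentially"
        by (rule order_tendstoD) (use r in simp)
      then obtain k0 where k0: "2 * cd * rs ^ (n + k0) < r"
        by (auto simp: eventually_sequentially power_add mult.assoc)
      \<comment> \<open>From this \<open>k\<close> on, two neighbouring cells have joint diameter below \<open>r\<close>.\<close>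
      define k where "k = (LEAST k. 2 * cd * rs ^ (n + k) < r)"
      have k: "2 * cd * rs ^ (n + k) < r"
        unfolding k_def by (rule LeastI [where P = "\<lambda>k. 2 * cd * rs ^ (n + k) < r", OF k0])
      have kpos: "1 \<le> k"
      proof (rule ccontr)
        assume "\<not> 1 \<le> k"
        then have "k = 0" by simp
        then show False using k r by (simp add: r1_def)
      qed
      have "\<not> 2 * cd * rs ^ (n + (k - 1)) < r"
        unfolding k_def by (rule not_less_Least) (use kpos in \<open>simp add: k_def\<close>)
      then have k': "r \<le> 2 * cd * rs ^ (n + k - 1)" using kpos by (simp add: Nat.add_diff_assoc)
      define A where "A = descs k (\<Union>b\<in>B. Gam R b)"
      have GB: "(\<Union>b\<in>B. Gam R b) \<subseteq> Tn n" using B Gam_level by (fastforce simp: Tn_iff)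
      have A: "A \<subseteq> Tn (n + k)" unfolding A_def by (rule descs_subset_Tn [OF GB])
      have "energy n B (avg g) = energy n B (avg_desc k (avg g))"
        by (simp add: avg_desc_avg [OF gi, abs_def])
      also have "\<dots> \<le> C1 * (c2 * sigma_p ^ k) * energy (n + k) A (avg g)"
        unfolding A_def using n sJ c2 \<sigma> B by (intro C1(2)) auto
      finally have "sigma_p ^ n * energy n B (avg g)
          \<le> sigma_p ^ n * (C1 * (c2 * sigma_p ^ k) * energy (n + k) A (avg g))"
        using \<sigma> by (intro mult_left_mono) auto
      also have "\<dots> = (C1 * c2) * (sigma_p ^ (n + k) * energy (n + k) A (avg g))"
        by (simp add: power_add mult_ac)
      finally have "ennreal (sigma_p ^ n * energy n B (avg g))
          \<le> ennreal (C1 * c2) * ennreal (sigma_p ^ (n + k) * energy (n + k) A (avg g))"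
        using C1(1) c2 \<sigma> by (simp add: ennreal_mult' [symmetric] ennreal_leI)
      also have "\<dots> \<le> ennreal (C1 * c2) * (ennreal C3 * KS_integral (\<Union>w\<in>A. K w) g r)"
        using C3(2) [rule_format, OF _ A g k k'] n r by (intro mult_left_mono) (auto simp: r1_def)
      also have "\<dots> = ennreal C * KS_integral (\<Union>w\<in>A. K w) g r"
        using C1(1) c2 C3(1) by (simp add: C_def mult.assoc [symmetric] ennreal_mult [symmetric])
      also have "\<dots> \<le> ennreal C * KS_integral (\<Union>x\<in>E. ball x (L * rs ^ n)) g r"
      proof (intro mult_left_mono KS_integral_mono)
        show "(\<Union>w\<in>A. K w) \<subseteq> (\<Union>x\<in>E. ball x (L * rs ^ n))"
        proof
          fix z assume "z \<in> (\<Union>w\<in>A. K w)"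
          then obtain w where w: "w \<in> A" "z \<in> K w" by blast
          then obtain b u where b: "b \<in> B" "u \<in> Gam R b" "w \<in> desc k u"
            by (auto simp: A_def descs_def)
          then have z: "z \<in> K u" using K_desc [of u k] w(2) by blast
          obtain y where y: "y \<in> K b" "y \<in> E" using b(1) by (auto simp: B_def Tn_meet_def)
          have "level b = n" using b(1) B by (auto simp: Tn_iff)
          then have "dist z y \<le> real (Suc R) * (cd * rs ^ n)" using dist_Gam [OF b(2) z y(1)] by simp
          also have "\<dots> < L * rs ^ n" using cd_pos rs_pos by (simp add: L_def algebra_simps)
          finally show "z \<in> (\<Union>x\<in>E. ball x (L * rs ^ n))" using y(2) by (auto simp: dist_commute)
        qed
      qed simp
      finally show ?thesis .
    qed
    have "eventually (\<lambda>r. r \<in> {0<..<r1}) (at_right 0)" using r1 by (rule eventually_at_right_real)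
    then show "eventually (\<lambda>r. ennreal (sigma_p ^ n * energy n (Tn_meet n E) (avg g))
        \<le> ennreal C * KS_integral (\<Union>x\<in>E. ball x (L * rs ^ n)) g r) (at_right 0)"
      by eventually_elim (use main in \<open>simp add: B_def\<close>)
  qed
  then show ?thesis using L C by blast
qed

text \<open>The function \<open>u\<close> is measurable on \<open>U\<close> only, so it is cut off by the indicator of \<open>U\<close>.\<close>

lemma avg_eq_of_AE:
  assumes u: "u \<in> borel_measurable (restrict_space m U)" and U: "open U" and V: "V \<subseteq> U" "K w \<subseteq> V"
    and g: "g \<in> borel_measurable m" and ae: "AE x in m. x \<in> V \<longrightarrow> u x = g x"
  shows "avg u w = avg g w"
proof -
  have "U \<inter> space m \<in> sets m" using U by simp
  then have iu: "(\<lambda>x. indicator U x *\<^sub>R u x) \<in> borel_measurable m"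
    using u by (simp add: borel_measurable_restrict_space_iff)
  have "(\<lambda>x. indicator (K w) x *\<^sub>R (indicator U x *\<^sub>R u x)) \<in> borel_measurable m"
    using iu by measurable
  also have "(\<lambda>x. indicator (K w) x *\<^sub>R (indicator U x *\<^sub>R u x)) = (\<lambda>x. indicator (K w) x *\<^sub>R u x)"
      using V by (auto simp: fun_eq_iff split: split_indicator)
  finally have "(LINT x:K w|m. u x) = (LINT x:K w|m. g x)"
    unfolding set_lebesgue_integral_def
  proof (rule integral_cong_AE)
    show "AE x in m. indicator (K w) x *\<^sub>R u x = indicator (K w) x *\<^sub>R g x"
      using ae by eventually_elim (use V in \<open>auto simp: indicator_def\<close>)
  qed (use g in measurable)
  then show ?thesis by (simp add: avg_def)
qed

lemma KS_integral_cong_AE: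
  assumes ae: "AE x in m. x \<in> V \<longrightarrow> u x = g x" and A: "A \<subseteq> V" "\<And>x. x \<in> A \<Longrightarrow> ball x r \<subseteq> V"
  shows "KS_integral A u r = KS_integral A g r"
  unfolding KS_integral_def
proof (rule nn_integral_cong_AE)
  have inner: "(\<integral>\<^sup>+y\<in>ball x r. ennreal (\<bar>u x - u y\<bar> powr p / r powr dw) \<partial>m)
      = (\<integral>\<^sup>+y\<in>ball x r. ennreal (\<bar>g x - g y\<bar> powr p / r powr dw) \<partial>m)" if x: "x \<in> A" "u x = g x" for x
  proof (rule nn_integral_cong_AE)
    show "AE y in m. ennreal (\<bar>u x - u y\<bar> powr p / r powr dw) * indicator (ball x r) y
        = ennreal (\<bar>g x - g y\<bar> powr p / r powr dw) * indicator (ball x r) y"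
      using ae by eventually_elim (use A(2) [OF x(1)] x(2) in \<open>auto simp: indicator_def\<close>)
  qed
  show "AE x in m. 1 / emeasure m (ball x r) *
        (\<integral>\<^sup>+y\<in>ball x r. ennreal (\<bar>u x - u y\<bar> powr p / r powr dw) \<partial>m) * indicator A x
      = 1 / emeasure m (ball x r) *
        (\<integral>\<^sup>+y\<in>ball x r. ennreal (\<bar>g x - g y\<bar> powr p / r powr dw) \<partial>m) * indicator A x"
    using ae
  proof eventually_elim
    case (elim x)
    then show ?case using inner [of x] A(1) by (cases "x \<in> A") auto
  qed
qed

text \<open>On a neighbourhood \<open>V\<close> of the closure of \<open>E\<close> the function \<open>u\<close> agrees with a function on the whole
  space. On fine levels and for small \<open>\<delta>\<close> and \<open>r\<close>, both sides see \<open>V\<close> only.\<close>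

lemma energy_tilde_limsup_le:
  assumes C: "0 < C" and L: "0 < L"
    and bound: "\<And>n E g. 1 \<le> n \<Longrightarrow> g \<in> Lp_space p m \<Longrightarrow>
      ennreal (sigma_p ^ n * energy n (Tn_meet n E) (avg g))
        \<le> ennreal C * Liminf (at_right 0) (KS_integral (\<Union>x\<in>E. ball x (L * rs ^ n)) g)"
    and U: "open U" and E: "closure E \<subseteq> U" and u: "u \<in> Wp_loc U"
  shows "limsup (\<lambda>n. ennreal (energy_tilde n (Tn_meet n E) u)) \<le> ennreal C *
    Lim (at_right 0) (\<lambda>\<delta>. Liminf (at_right 0) (\<lambda>r. KS_integral (\<Union>x\<in>E. ball x \<delta>) u r))"
proof -
  have cpt: "compact (UNIV :: 'a set)"
    using basic unfolding basic_framework_def is_partition_def by (elim conjE) assumption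
  have cclosed: "compact S" if "closed S" for S :: "'a set"
    using compact_Int_closed [OF cpt that] by simp
  obtain \<epsilon> where \<epsilon>: "0 < \<epsilon>" "(\<Union>x\<in>closure E. ball x \<epsilon>) \<subseteq> U"
    using compact_subset_open_imp_ball_epsilon_subset [OF cclosed [OF closed_closure] U E] by blast
  \<comment> \<open>Room for a cell or a ball around a point near \<open>E\<close>, and for the closure of \<open>V\<close>.\<close>
  define h where "h = \<epsilon> / 4"
  have h: "0 < h" using \<epsilon> by (simp add: h_def)
  define V where "V = (\<Union>x\<in>closure E. ball x (2 * h))"
  have clV: "closure V \<subseteq> U"
  proof
    fix y assume "y \<in> closure V"
    then obtain v where v: "v \<in> V" "dist v y < h" using h by (auto simp: closure_approachable)
    then obtain x where x: "x \<in> closure E" "dist x v < 2 * h" by (auto simp: V_def)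
    then have "dist x y < \<epsilon>" using v(2) dist_triangle [of x y v] h by (simp add: h_def)
    then have "y \<in> (\<Union>x\<in>closure E. ball x \<epsilon>)" by (intro UN_I [OF x(1)]) simp
    then show "y \<in> U" using \<epsilon>(2) by blast
  qed
  have V: "open V" "V \<subseteq> U" using clV closure_subset [of V] by (auto simp: V_def)
  have nbhd: "z \<in> V" if "x \<in> E" "dist x z < 2 * h" for x z
    using that closure_subset [of E] by (auto simp: V_def)
  have um: "u \<in> borel_measurable (restrict_space m U)"
    and ug: "\<And>W. open W \<and> compact (closure W) \<and> closure W \<subseteq> U \<Longrightarrow>
       \<exists>g\<in>Wp. AE x in m. x \<in> W \<longrightarrow> u x = g x"
    using u by (auto simp: Wp_loc_def)
  obtain g where g: "g \<in> Wp" and ae: "AE x in m. x \<in> V \<longrightarrow> u x = g x"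
    using ug [of V] V(1) clV cclosed [OF closed_closure] by blast
  have gLp: "g \<in> Lp_space p m" using g by (simp add: Wp_def)
  then have gm: "g \<in> borel_measurable m" by (simp add: Lp_space_def)
  define F where "F \<delta> = Liminf (at_right 0) (\<lambda>r. KS_integral (\<Union>x\<in>E. ball x \<delta>) u r)" for \<delta>
  have F_mono: "F \<delta> \<le> F \<delta>'" if "\<delta> \<le> \<delta>'" for \<delta> \<delta>'
    unfolding F_def using that
    by (intro Liminf_mono always_eventually allI KS_integral_mono) force
  have F_g: "F \<delta> = Liminf (at_right 0) (KS_integral (\<Union>x\<in>E. ball x \<delta>) g)" if \<delta>: "\<delta> < h" for \<delta>
  proof -
    have "KS_integral (\<Union>x\<in>E. ball x \<delta>) u r = KS_integral (\<Union>x\<in>E. ball x \<delta>) g r" if r: "r < h" for r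
    proof (rule KS_integral_cong_AE [OF ae])
      show "(\<Union>x\<in>E. ball x \<delta>) \<subseteq> V" using \<delta> h by (auto intro: nbhd)
      show "ball z r \<subseteq> V" if "z \<in> (\<Union>x\<in>E. ball x \<delta>)" for z
      proof
        fix y assume "y \<in> ball z r"
        moreover obtain x where "x \<in> E" "dist x z < \<delta>" using \<open>z \<in> (\<Union>x\<in>E. ball x \<delta>)\<close> by auto
        ultimately show "y \<in> V" using \<delta> r dist_triangle [of x y z] by (intro nbhd [of x]) auto
      qed
    qed
    moreover have "eventually (\<lambda>r. r \<in> {0<..<h}) (at_right 0)" using h by (rule eventually_at_right_real)
    ultimately show ?thesis
      unfolding F_def by (intro Liminf_eq) (auto elim: eventually_mono)
  qed
  have small: "limsup (\<lambda>n. ennreal (energy_tilde n (Tn_meet n E) u)) \<le> ennreal C * F \<delta>"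
    if \<delta>: "0 < \<delta>" "\<delta> < h" for \<delta>
  proof (rule Limsup_bounded)
    have to0: "(\<lambda>n. c * rs ^ n) \<longlonglongrightarrow> c * 0" for c
      using rs_pos rs_less_1 by (intro tendsto_intros LIMSEQ_power_zero) auto
    have ev1: "eventually (\<lambda>n. L * rs ^ n < \<delta>) sequentially"
      by (rule order_tendstoD(2) [OF to0]) (use \<delta> in simp)
    have ev2: "eventually (\<lambda>n. cd * rs ^ n < h) sequentially"
      by (rule order_tendstoD(2) [OF to0]) (use h in simp)
    show "eventually (\<lambda>n. ennreal (energy_tilde n (Tn_meet n E) u) \<le> ennreal C * F \<delta>) sequentially"
      using ev1 ev2 eventually_ge_at_top [of 1]
    proof eventually_elim
      case (elim n)
      have "avg u w = avg g w" if w: "w \<in> Tn_meet n E" for w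
      proof (rule avg_eq_of_AE [OF um U V(2) _ gm ae])
        show "K w \<subseteq> V"
        proof
          fix z assume z: "z \<in> K w"
          obtain x where x: "x \<in> K w" "x \<in> E" using w by (auto simp: Tn_meet_def)
          have "dist x z \<le> diameter (K w)"
            using x z K_compact [of w] by (intro diameter_bounded_bound) (auto simp: compact_imp_bounded)
          also have "\<dots> \<le> cd * rs ^ n" using diameter_K [of w] w by (simp add: Tn_meet_def Tn_iff)
          also have "\<dots> < 2 * h" using elim h by simp
          finally show "z \<in> V" by (rule nbhd [OF x(2)])
        qed
      qed
      then have "energy_tilde n (Tn_meet n E) u = sigma_p ^ n * energy n (Tn_meet n E) (avg g)"
        unfolding energy_tilde_def by (intro arg_cong2 [where f = "(*)"] energy_cong refl)
      then have "ennreal (energy_tilde n (Tn_meet n E) u)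
          \<le> ennreal C * Liminf (at_right 0) (KS_integral (\<Union>x\<in>E. ball x (L * rs ^ n)) g)"
        using bound [OF _ gLp] elim by simp
      also have "\<dots> = ennreal C * F (L * rs ^ n)" using F_g [of "L * rs ^ n"] elim \<delta> by simp
      also have "\<dots> \<le> ennreal C * F \<delta>" using elim by (intro mult_left_mono F_mono) auto
      finally show ?case .
    qed
  qed
  have "limsup (\<lambda>n. ennreal (energy_tilde n (Tn_meet n E) u)) \<le> ennreal C * F \<delta>"
    if \<delta>: "0 < \<delta>" for \<delta>
  proof -
    have "limsup (\<lambda>n. ennreal (energy_tilde n (Tn_meet n E) u)) \<le> ennreal C * F (min \<delta> (h / 2))"
      using \<delta> h by (intro small) auto
    also have "\<dots> \<le> ennreal C * F \<delta>" by (intro mult_left_mono F_mono) auto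
    finally show ?thesis .
  qed
  then have "limsup (\<lambda>n. ennreal (energy_tilde n (Tn_meet n E) u)) \<le> ennreal C * (INF \<delta>\<in>{0<..}. F \<delta>)"
    unfolding ennreal_le_cmult_iff [OF C] by (intro INF_greatest) auto
  also have "(INF \<delta>\<in>{0<..}. F \<delta>) = Lim (at_right 0) F"
    by (rule Lim_at_right_mono [symmetric]) (rule F_mono)
  finally show ?thesis unfolding F_def [abs_def] .
qed

lemma Np_powr: "ennpowr (Np f) p = (SUP n. ennreal (sigma_p ^ n * energy n (Tn n) (avg f)))"
proof -
  define S where "S = (SUP n. ennreal (sigma_p ^ n * energy n (Tn n) (avg f)))"
  have "ennpowr (ennpowr S (1 / p)) p = S"
    using p_pos by (cases S) (simp_all add: ennpowr_def powr_powr)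
  then show ?thesis by (simp add: Np_def S_def)
qed

lemma Np_le_Liminf_KS_integral:
  assumes C: "0 < C"
    and bound: "\<And>n E. 1 \<le> n \<Longrightarrow> ennreal (sigma_p ^ n * energy n (Tn_meet n E) (avg f))
        \<le> ennreal C * Liminf (at_right 0) (KS_integral (\<Union>x\<in>E. ball x (L * rs ^ n)) f)"
    and L: "0 < L"
  shows "ennpowr (Np f) p \<le> ennreal C * Liminf (at_right 0) (KS_integral UNIV f)"
  unfolding Np_powr
proof (rule SUP_least)
  fix n
  show "ennreal (sigma_p ^ n * energy n (Tn n) (avg f)) \<le> ennreal C * Liminf (at_right 0) (KS_integral UNIV f)"
  proof (cases "n = 0")
    case True
    \<comment> \<open>The coverings start at level one; level zero consists of the root and has no edges.\<close>
    have "adj 0 (Tn 0) = {}" by (auto simp: adj_iff Tn_iff)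
    then show ?thesis using True by (simp add: energy_adj)
  next
    case False
    have "x \<in> (\<Union>x. ball x (L * rs ^ n))" for x :: 'a
      using L rs_pos by (intro UN_I [of x]) auto
    then have un: "(\<Union>x. ball x (L * rs ^ n)) = (UNIV :: 'a set)" by blast
    have "Tn_meet n UNIV = Tn n" using K_nonempty by (auto simp: Tn_meet_def)
    then show ?thesis using bound [of n UNIV] False un by simp
  qed
qed

end

theorem proposition5p25:
  fixes ET :: "'v set set" and \<phi> :: 'v
    and K :: "'v \<Rightarrow> 'a::metric_space set" and m :: "'a measure"
    and Ms :: nat and rs p :: real
  assumes "1 < p"
    and "tree_partition.basic_framework ET \<phi> K m Ms rs"
    and "tree_partition.ahlfors_regular m"
    and "tree_partition.conductively_homogeneous ET \<phi> K m Ms p"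
    and "\<exists>C0>0. \<forall>x::'a. \<forall>s. 0 < s \<and> s \<le> 1 \<longrightarrow>
      (INF f \<in> {f \<in> tree_partition.Wp ET \<phi> K m Ms p. continuous_on UNIV f \<and>
                 (\<forall>y\<in>ball x s. f y = 1) \<and> closure {y. f y \<noteq> 0} \<subseteq> ball x (2 * s)}.
         ennpowr (tree_partition.Np ET \<phi> K m Ms p f) p)
      \<le> ennreal (C0 * s powr (tree_partition.df TYPE('a) - tree_partition.dw ET \<phi> K m Ms rs p))"
  shows "\<exists>C>0.
    (\<forall>(E :: 'a set) E' u.
       open E' \<and> E' \<noteq> {} \<and> closure E \<subseteq> E' \<and> u \<in> tree_partition.Wp_loc ET \<phi> K m Ms p E' \<longrightarrow>
       limsup (\<lambda>n. ennreal (tree_partition.energy_tilde ET \<phi> K m Ms p n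
                              (tree_partition.Tn_meet ET \<phi> K n E) u))
       \<le> ennreal C * Lim (at_right 0) (\<lambda>\<delta>. Liminf (at_right 0) (\<lambda>r.
            tree_partition.KS_integral ET \<phi> K m Ms rs p (\<Union>x\<in>E. ball x \<delta>) u r))) \<and>
    (\<forall>f \<in> Lp_space p m.
       ennpowr (tree_partition.Np ET \<phi> K m Ms p f) p
       \<le> ennreal C * Liminf (at_right 0) (\<lambda>r.
            tree_partition.KS_integral ET \<phi> K m Ms rs p UNIV f r))"
proof -
  interpret basic_geometry ET \<phi> K m Ms rs p
    by unfold_locales (rule assms(2))
  obtain N where N: "\<forall>w. finite (Gam 1 w) \<and> card (Gam 1 w) \<le> N"
    using basic by (auto simp: basic_framework_def framework1_def uniformly_finite_def)
  obtain D where D: "\<forall>w. card (children w) \<le> D" using children_bounded by blast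
  have f2: "framework2" and diam1: "diameter (UNIV :: 'a set) = 1"
    using basic by (simp_all add: basic_framework_def)
  obtain cd c5 where cd: "0 < cd" "\<And>w. diameter (K w) \<le> cd * rs ^ level w"
    and c5: "0 < c5" "\<And>n w. 1 \<le> n \<Longrightarrow> w \<in> Tn n \<Longrightarrow> \<exists>x\<in>K w. ball x (c5 * rs ^ n) \<subseteq> K w"
    using f2 unfolding framework2_def by meson
  obtain Q CA where Q: "0 < Q" "1 \<le> CA" "\<And>x s. 0 < s \<Longrightarrow> s < 2 \<Longrightarrow>
      s powr Q / CA \<le> measure m (ball x s) \<and> measure m (ball x s) \<le> CA * s powr Q"
    using assms(3) unfolding ahlfors_regular_def diam1 by auto
  have rs0: "0 < rs" using basic by (simp add: basic_framework_def)
  interpret ahlfors_geometry ET \<phi> K m Ms rs p N D cd "min c5 1" Q CA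
  proof unfold_locales
    fix w assume w: "1 \<le> level w"
    obtain x where "ball x (c5 * rs ^ level w) \<subseteq> K w" using c5(2) [OF w, of w] by (auto simp: Tn_iff)
    moreover have "ball x (min c5 1 * rs ^ level w) \<subseteq> ball x (c5 * rs ^ level w)"
      using rs0 by (intro subset_ball mult_right_mono) auto
    ultimately show "\<exists>x. ball x (min c5 1 * rs ^ level w) \<subseteq> K w" by blast
  qed (use assms(1) N D cd c5 Q in auto)
  obtain C L where CL: "0 < C" "0 < L" "\<And>n E g. 1 \<le> n \<Longrightarrow> g \<in> Lp_space p m \<Longrightarrow>
      ennreal (sigma_p ^ n * energy n (Tn_meet n E) (avg g))
        \<le> ennreal C * Liminf (at_right 0) (KS_integral (\<Union>x\<in>E. ball x (L * rs ^ n)) g)"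
    using energy_le_Liminf_KS_integral [OF assms(4)] by blast
  show ?thesis
  proof (intro exI [of _ C] conjI allI ballI impI)
    fix E E' :: "'a set" and u
    assume "open E' \<and> E' \<noteq> {} \<and> closure E \<subseteq> E' \<and> u \<in> Wp_loc E'"
    then show "limsup (\<lambda>n. ennreal (energy_tilde n (Tn_meet n E) u)) \<le> ennreal C *
        Lim (at_right 0) (\<lambda>\<delta>. Liminf (at_right 0) (\<lambda>r. KS_integral (\<Union>x\<in>E. ball x \<delta>) u r))"
      by (intro energy_tilde_limsup_le [OF CL(1,2,3)]) auto
  next
    fix f assume "f \<in> Lp_space p m"
    then show "ennpowr (Np f) p \<le> ennreal C * Liminf (at_right 0) (\<lambda>r. KS_integral UNIV f r)"
      using Np_le_Liminf_KS_integral [of C f L, OF CL(1) CL(3) CL(2)] by simp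
  qed (rule CL(1))
qed

end
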